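(* Let $k\ge 0$ be an integer and let $g$ be an integer (possibly negative) which is not a perfect square in $\mathbb{Z}$ and $g\neq -1$. Let $h\in\mathbb{N}$ be the maximal positive integer such that $g=g_0^h$ for some $g_0\in\mathbb{Z}$, and let $d$ be the discriminant of the quadratic field $\mathbb{Q}[\sqrt{g}]$. Let $p_1=2,p_2=3,\ldots$ be the sequence of all primes, and for $N\ge 1$ let $\sum_{i=1}^{\prime\,N}$ denote the sum over those indices $1\le i\le N$ for which $\left(\frac{g}{p_i}\right)=-1$ and $\gcd(p_i-1,h)=1$. Let $\phi$ be Euler's totient function. (i) If $h=1$, then $$\lim_{N\to\infty}\frac{\sum_{i=1}^{\prime\,N}p_i^k\,\phi(p_i-1)}{\sum_{i=1}^{\prime\,N}p_i^k\,(p_i-1)}=A(g).$$ (ii) If $h>1$, then $$\lim_{N\to\infty}\frac{\sum_{i=1}^{\prime\,N}p_i^k\,\phi(p_i-1)}{\sum_{i=1}^{\prime\,N}p_i^k\,(p_i-1)}=\widetilde A(g),\qquad \widetilde A(g)=\widetilde A_h\,\widetilde A_d,$$ where $$\widetilde A_h=\prod_{p\,\nmid\, h}\Bigl(1-\frac{1}{p(p-1)}\Bigr),\qquad \widetilde A_d=1\ \text{ if } d\mid h,\qquad \widetilde A_d=A_d\ \text{ otherwise.}$$ The quantities $A(g)$ and $A_d$ are the explicit constants defined in the context.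
   Context: All products are over (positive) primes $p$, and $\mu$ is the Möbius function. For $g$, $h$, $d$ as in the statement, define $$A(g)=A_h\,A_d,\qquad A_h=\prod_{p\mid h}\Bigl(1-\frac{1}{p-1}\Bigr)\prod_{p\,\nmid\, h}\Bigl(1-\frac{1}{p(p-1)}\Bigr),$$ $$A_d=1-\mu(|d|)\prod_{p\mid d,\;p\mid h}\frac{1}{p-2}\;\prod_{p\mid d,\;p\,\nmid\, h}\frac{1}{p^2-p-1}.$$ Empty products equal $1$. (Since $g$ is not a perfect square, $h$ is odd, so the factors $p-2$ are nonzero.) The symbol $\left(\frac{g}{p}\right)$ is the Legendre symbol for odd $p$, so $\left(\frac{g}{p}\right)=-1$ means that $g$ is a quadratic nonresidue modulo $p$; the prime $p=2$ is not included in the restricted sums. The ratios are considered for $N$ large enough that the denominator is nonzero. *)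

theory Defs
  imports
    "HOL-Analysis.Analysis"
    "HOL-Library.Infinite_Set"
    "HOL-Computational_Algebra.Computational_Algebra"
    "HOL-Number_Theory.Number_Theory"
begin

definition moebius :: "nat \<Rightarrow> int" where
  "moebius n = (if squarefree n then (-1) ^ card (prime_factors n) else 0)"

text \<open>Indexed from 1, so that \<open>nth_prime 1 = 2\<close>; the value at index 0 is never used.\<close>

definition nth_prime :: "nat \<Rightarrow> nat" where
  "nth_prime i = enumerate {p. prime p} (i - 1)"

text \<open>The following definitions are meant for an integer \<open>g\<close> that is not a perfect square.
  The field is realised as a subfield of the complex numbers; \<open>csqrt\<close> fixes one of the
  two square roots of \<open>g\<close>.\<close>

definition quadratic_field :: "int \<Rightarrow> complex set" where
  "quadratic_field g = {of_rat a + of_rat b * csqrt (of_int g) | a b. True}"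

definition quadratic_conj :: "int \<Rightarrow> complex \<Rightarrow> complex" where
  "quadratic_conj g x =
     (THE y. \<exists>a b. x = of_rat a + of_rat b * csqrt (of_int g) \<and>
                   y = of_rat a - of_rat b * csqrt (of_int g))"

definition quadratic_integers :: "int \<Rightarrow> complex set" where
  "quadratic_integers g = {x \<in> quadratic_field g. algebraic_int x}"

definition is_integral_basis :: "int \<Rightarrow> complex \<Rightarrow> complex \<Rightarrow> bool" where
  "is_integral_basis g u v \<longleftrightarrow>
     quadratic_integers g = {of_int m * u + of_int n * v | m n. True} \<and>
     (\<forall>m n :: int. of_int m * u + of_int n * v = 0 \<longrightarrow> m = 0 \<and> n = 0)"

text \<open>The squared determinant of the matrix of the images of an integral basis under the
  two embeddings of the field, the identity and the conjugation.\<close>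

definition quadratic_disc :: "int \<Rightarrow> int" where
  "quadratic_disc g =
     (THE d. \<exists>u v. is_integral_basis g u v \<and>
        of_int d = (u * quadratic_conj g v - v * quadratic_conj g u)\<^sup>2)"

text \<open>The products over all primes not dividing \<open>h\<close> are infinite products over the
  natural numbers, with factor 1 at the indices that do not occur.\<close>

definition A_h :: "nat \<Rightarrow> real" where
  "A_h h =
     (\<Prod>p | prime p \<and> p dvd h. 1 - 1 / (real p - 1)) *
     (\<Prod>p. if prime p \<and> \<not> p dvd h then 1 - 1 / (real p * (real p - 1)) else 1)"

definition A_d :: "nat \<Rightarrow> int \<Rightarrow> real" where
  "A_d h d =
     1 - of_int (moebius (nat \<bar>d\<bar>)) *
         (\<Prod>p | prime p \<and> int p dvd d \<and> p dvd h. 1 / (real p - 2)) *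
         (\<Prod>p | prime p \<and> int p dvd d \<and> \<not> p dvd h. 1 / ((real p)\<^sup>2 - real p - 1))"

definition A_const :: "nat \<Rightarrow> int \<Rightarrow> real" where
  "A_const h d = A_h h * A_d h d"

definition A_tilde_h :: "nat \<Rightarrow> real" where
  "A_tilde_h h =
     (\<Prod>p. if prime p \<and> \<not> p dvd h then 1 - 1 / (real p * (real p - 1)) else 1)"

definition A_tilde_d :: "nat \<Rightarrow> int \<Rightarrow> real" where
  "A_tilde_d h d = (if d dvd int h then 1 else A_d h d)"

definition A_tilde_const :: "nat \<Rightarrow> int \<Rightarrow> real" where
  "A_tilde_const h d = A_tilde_h h * A_tilde_d h d"

definition restricted_indices :: "int \<Rightarrow> nat \<Rightarrow> nat \<Rightarrow> nat set" where
  "restricted_indices g h N =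
     {i \<in> {1..N}. nth_prime i \<noteq> 2 \<and> Legendre g (int (nth_prime i)) = -1 \<and>
                  gcd (nth_prime i - 1) h = 1}"

definition totient_ratio :: "nat \<Rightarrow> int \<Rightarrow> nat \<Rightarrow> nat \<Rightarrow> real" where
  "totient_ratio k g h N =
     real (\<Sum>i\<in>restricted_indices g h N. nth_prime i ^ k * totient (nth_prime i - 1)) /
     real (\<Sum>i\<in>restricted_indices g h N. nth_prime i ^ k * (nth_prime i - 1))"

end

theory Submission
  imports Defs "HOL-Complex_Analysis.Complex_Analysis" "HOL-Real_Asymp.Real_Asymp"
begin

text \<open>Write $\varphi(p-1)/(p-1)$ as the product of the factors $1 - 1/q$ over the primes $q \mid p-1$ and
  truncate it at $q \le Q$. The truncated product, like the condition $\gcd(p-1,h)=1$, is a product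
  of factors depending only on $p$ modulo single primes $q$, and by quadratic reciprocity the
  Legendre symbol of the squarefree part of $g$ is a product of a character modulo 8 and of
  Legendre symbols modulo odd primes. Expanding into Dirichlet characters, the weighted mean over
  the primes of every nonprincipal character vanishes, so the mean of the whole product is a
  product of local means; comparing the mean with and without the Legendre symbol yields $A_d$. The
  error of the truncation is controlled by an elementary bound of order $N \log q / q$ for the
  logarithmic sum of the primes $p \equiv 1 \pmod q$ up to $N$.

  The vanishing for nonprincipal characters follows from $L(s,\chi) \ne 0$ on the line
  $\mathrm{Re}\, s = 1$, via Newman's contour argument for $\sum \mu(n)\chi(n)/n$ and the hyperbola
  method, which passes from $\mu\chi$ to $\Lambda\chi$.\<close>

section \<open>Dirichlet convolution\<close>

text \<open>The total weight of all primes up to \<open>N\<close> enters only through a lower bound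
  of Chebyshev type: numerator and denominator of the ratio are both divided by it, and it cancels.
  Newman's argument is run on the Moebius coefficients because it asks for bounded coefficients,
  which those of von Mangoldt are not, and because \<open>1 / L\<close> has no pole on the line. The
  truncation needs a bound for primes congruent to 1 modulo \<open>q\<close> that is uniform in
  \<open>q\<close> and \<open>N\<close>; equidistribution for a fixed modulus does not give this,
  and a divisibility argument with factorials supplies it. Both claims of the theorem come from a
  single limit. Let rho be the product of the local corrections at the primes of the squarefree part
  \<open>s\<close> of \<open>g\<close>, or 0 if \<open>s mod 4\<close> is not 1. The numerator
  carries the factor 1 - rho. The sieve in the denominator sees only the primes dividing
  \<open>h\<close>: it carries 1 - rho if all odd primes of \<open>s\<close> are among them, and 1
  otherwise. This is the origin of the case \<open>d dvd h\<close> in the constant.\<close>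

definition dconv :: "(nat \<Rightarrow> 'a::comm_ring_1) \<Rightarrow> (nat \<Rightarrow> 'a) \<Rightarrow> nat \<Rightarrow> 'a" where
  "dconv f g n = (\<Sum>d | d dvd n. f d * g (n div d))"

text \<open>Every number divides 0, so the index set is infinite and the sum takes its default
  value.\<close>

lemma dconv_0 [simp]: "dconv f g 0 = 0"
  by (simp add: dconv_def)

lemma dconv_cong:
  assumes "\<And>n. n > 0 \<Longrightarrow> f n = f' n" "\<And>n. n > 0 \<Longrightarrow> g n = g' n"
  shows "dconv f g n = dconv f' g' n"
proof (cases "n = 0")
  case False
  then show ?thesis
    unfolding dconv_def by (intro sum.cong refl arg_cong2[of _ _ _ _ "(*)"] assms)
      (auto intro: Nat.gr0I simp: dvd_div_eq_0_iff)
qed auto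

lemma dconv_pairs:
  assumes "n > 0"
  shows "dconv f g n = (\<Sum>(a, b) | a * b = n. f a * g b)"
  unfolding dconv_def using assms
  by (intro sum.reindex_bij_witness[of _ fst "\<lambda>d. (d, n div d)"]) auto

lemma dconv_commute: "dconv f g n = dconv g f n"
proof (cases "n = 0")
  case False
  then have n: "n > 0" by simp
  show ?thesis
    unfolding dconv_pairs[OF n]
    by (intro sum.reindex_bij_witness[of _ "\<lambda>(a, b). (b, a)" "\<lambda>(a, b). (b, a)"]) (auto simp: mult.commute)
qed auto

lemma finite_factor_pairs: "n > 0 \<Longrightarrow> finite {(a, b). a * b = (n::nat)}"
  "n > 0 \<Longrightarrow> finite {x. fst x * snd x = (n::nat)}"
  by (rule finite_subset[of _ "{..n} \<times> {..n}"]; auto)+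

lemma dconv_assoc: "dconv (dconv f g) h n = dconv f (dconv g h) n"
proof (cases "n = 0")
  case False
  then have n: "n > 0" by simp
  have "dconv (dconv f g) h n = (\<Sum>(d, c) | d * c = n. \<Sum>(a, b) | a * b = d. f a * g b * h c)"
    unfolding dconv_pairs[OF n]
    by (intro sum.cong refl) (use n in \<open>auto simp: dconv_pairs sum_distrib_right intro!: sum.cong\<close>)
  also have "\<dots> = (\<Sum>((d, c), (a, b)) \<in> (SIGMA x:{(d, c). d * c = n}. {(a, b). a * b = fst x}). f a * g b * h c)"
    by (subst sum.Sigma[symmetric]) (use n in \<open>auto intro!: finite_factor_pairs sum.cong simp: split_def\<close>)
  also have "\<dots> = (\<Sum>((a, e), (b, c)) \<in> (SIGMA x:{(d, c). d * c = n}. {(a, b). a * b = snd x}). f a * (g b * h c))"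
    by (intro sum.reindex_bij_witness[of _ "\<lambda>((a, e), (b, c)). ((a * b, c), (a, b))"
          "\<lambda>((d, c), (a, b)). ((a, b * c), (b, c))"]) (auto simp: mult_ac)
  also have "\<dots> = (\<Sum>(a, e) | a * e = n. \<Sum>(b, c) | b * c = e. f a * (g b * h c))"
    by (subst sum.Sigma[symmetric]) (use n in \<open>auto intro!: finite_factor_pairs sum.cong simp: split_def\<close>)
  also have "\<dots> = dconv f (dconv g h) n"
    unfolding dconv_pairs[OF n]
    by (intro sum.cong refl) (use n in \<open>auto simp: dconv_pairs sum_distrib_left intro!: sum.cong\<close>)
  finally show ?thesis .
qed auto

lemma dconv_add_right: "dconv f (\<lambda>n. g n + h n) n = dconv f g n + dconv f h n"
  by (simp add: dconv_def ring_distribs sum.distrib)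

lemma dconv_delta_left:
  assumes "n > 0"
  shows "dconv (\<lambda>n. if n = 1 then 1 else 0) f n = f n"
proof -
  have "dconv (\<lambda>n. if n = 1 then 1 else 0) f n = (\<Sum>d | d dvd n. if d = 1 then f n else 0)"
    unfolding dconv_def by (intro sum.cong) auto
  also have "\<dots> = f n" using assms by (subst sum.delta) auto
  finally show ?thesis .
qed

lemma dconv_mult_log:
  fixes f g :: "nat \<Rightarrow> complex"
  assumes "n > 0"
  shows "dconv f g n * ln (real n) =
    dconv (\<lambda>n. f n * ln (real n)) g n + dconv f (\<lambda>n. g n * ln (real n)) n"
proof -
  have "f d * g (n div d) * ln (real n) =
        f d * ln (real d) * g (n div d) + f d * (g (n div d) * ln (real (n div d)))"
    if "d dvd n" for d
  proof -
    have "real n = real d * real (n div d)" using that by (metis dvd_mult_div_cancel of_nat_mult)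
    moreover have "d > 0" "n div d > 0" using that assms
      by (auto intro: Nat.gr0I simp: dvd_div_eq_0_iff)
    ultimately have "ln (real n) = ln (real d) + ln (real (n div d))" by (simp add: ln_mult)
    then show ?thesis by (simp add: algebra_simps)
  qed
  then show ?thesis
    unfolding dconv_def sum.distrib[symmetric] sum_distrib_right by (intro sum.cong) auto
qed

section \<open>Completely multiplicative functions and Moebius inversion\<close>

definition completely_multiplicative :: "(nat \<Rightarrow> complex) \<Rightarrow> bool" where
  "completely_multiplicative f \<longleftrightarrow> f 1 = 1 \<and> (\<forall>a b. f (a * b) = f a * f b)"

lemma completely_multiplicativeD:
  assumes "completely_multiplicative f"
  shows "f 1 = 1" "f (Suc 0) = 1" "f (a * b) = f a * f b"
  using assms by (auto simp: completely_multiplicative_def)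

lemma completely_multiplicative_mult:
  "completely_multiplicative f \<Longrightarrow> completely_multiplicative g \<Longrightarrow> completely_multiplicative (\<lambda>n. f n * g n)"
  by (auto simp: completely_multiplicative_def mult_ac)

text \<open>\<open>f n\<close> splits as \<open>f d * f (n div d)\<close> along every divisor.
  Identities for the constant function 1 (those of von Mangoldt and Moebius) are thereby transferred
  to every \<open>f\<close> by twisting.\<close>

lemma dconv_completely_multiplicative:
  assumes "completely_multiplicative f"
  shows "dconv (\<lambda>n. f n * g n) (\<lambda>n. f n * h n) n = f n * dconv g h n"
  unfolding dconv_def sum_distrib_left
proof (intro sum.cong refl)
  fix d assume "d \<in> {d. d dvd n}"
  then have "f n = f d * f (n div d)"
    using completely_multiplicativeD(3)[OF assms] by (metis dvd_mult_div_cancel mem_Collect_eq)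
  then show "f d * g d * (f (n div d) * h (n div d)) = f n * (g d * h (n div d))" by simp
qed

lemma dconv_mangoldt_completely_multiplicative:
  assumes "completely_multiplicative f" "n > 0"
  shows "dconv f (\<lambda>n. f n * mangoldt n) n = f n * ln (real n)"
proof -
  have "dconv f (\<lambda>n. f n * mangoldt n) n = dconv (\<lambda>n. f n * 1) (\<lambda>n. f n * mangoldt n) n" by simp
  also have "\<dots> = f n * dconv (\<lambda>_. 1) mangoldt n"
    by (rule dconv_completely_multiplicative[OF assms(1)])
  also have "dconv (\<lambda>_. 1) mangoldt n = dconv mangoldt (\<lambda>_. 1 :: complex) n"
    by (rule dconv_commute)
  also have "\<dots> = ln (real n)" using mangoldt_sum[of n] assms(2) by (simp add: dconv_def)
  finally show ?thesis .
qed

lemma moebius_1 [simp]: "moebius (Suc 0) = 1" "moebius 1 = 1"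
  by (simp_all add: moebius_def)

lemma abs_moebius_le_1: "\<bar>moebius n\<bar> \<le> 1"
  by (simp add: moebius_def power_abs)

lemma moebius_prime_times:
  assumes "prime p" "\<not> p dvd d" "squarefree d"
  shows "moebius (p * d) = - moebius d" "squarefree (p * d)"
proof -
  have cop: "coprime p d" using assms by (simp add: prime_imp_coprime)
  show sq: "squarefree (p * d)" using cop assms by (simp add: squarefree_mult_coprime squarefree_prime)
  have "d \<noteq> 0" using assms(2) by (intro notI) simp
  then have "prime_factors (p * d) = insert p (prime_factors d)"
    using assms by (auto simp: prime_factors_product prime_prime_factors)
  moreover have "p \<notin> prime_factors d" using assms by auto
  ultimately show "moebius (p * d) = - moebius d" using sq assms by (simp add: moebius_def)
qed

lemma sum_moebius_divisors:
  assumes "n > 0"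
  shows "(\<Sum>d | d dvd n. moebius d) = (if n = 1 then 1 else 0)"
proof (cases "n = 1")
  case False
  then obtain p where p: "prime p" "p dvd n" using prime_factor_nat by blast
  \<comment> \<open>Only squarefree divisors count. Those that avoid \<open>p\<close> are paired
    with their multiples by \<open>p\<close>, where \<open>moebius\<close> has the opposite
    sign.\<close>
  define A where "A = {d. d dvd n \<and> squarefree d \<and> \<not> p dvd d}"
  have fin: "finite {d. d dvd n}" using assms by simp
  have finA: "finite A" by (rule finite_subset[OF _ fin]) (auto simp: A_def)
  have p0: "p > 0" using p by (simp add: prime_gt_0_nat)
  have "(\<Sum>d | d dvd n. moebius d) = (\<Sum>d\<in>A \<union> (*) p ` A. moebius d)"
  proof (rule sum.mono_neutral_right[OF fin])
    show "A \<union> (*) p ` A \<subseteq> {d. d dvd n}"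
    proof
      fix x assume "x \<in> A \<union> (*) p ` A"
      then show "x \<in> {d. d dvd n}"
        using p by (auto simp: A_def intro!: divides_mult simp: prime_imp_coprime)
    qed
    show "\<forall>i\<in>{d. d dvd n} - (A \<union> (*) p ` A). moebius i = 0"
    proof
      fix i assume i: "i \<in> {d. d dvd n} - (A \<union> (*) p ` A)"
      show "moebius i = 0"
      proof (rule ccontr)
        assume "moebius i \<noteq> 0"
        then have sq: "squarefree i" by (auto simp: moebius_def split: if_splits)
        with i have "p dvd i" by (auto simp: A_def)
        then obtain e where e: "i = p * e" by auto
        have "\<not> p dvd e"
        proof
          assume "p dvd e"
          then have "p\<^sup>2 dvd i" unfolding e power2_eq_square by (rule mult_dvd_mono[OF dvd_refl])
          then have "p dvd 1" using sq unfolding squarefree_def by blast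
          then show False using p by simp
        qed
        moreover have "squarefree e" using sq e by (auto dest: squarefree_multD)
        moreover have "e dvd n" using i e by (auto intro: dvd_mult_right)
        ultimately have "e \<in> A" by (auto simp: A_def)
        then show False using i e by auto
      qed
    qed
  qed
  also have "\<dots> = (\<Sum>d\<in>A. moebius d) + (\<Sum>d\<in>(*) p ` A. moebius d)"
    by (rule sum.union_disjoint) (use finA in \<open>auto simp: A_def\<close>)
  also have "(\<Sum>d\<in>(*) p ` A. moebius d) = (\<Sum>d\<in>A. moebius (p * d))"
    using p0 by (subst sum.reindex) (auto simp: inj_on_def)
  also have "\<dots> = (\<Sum>d\<in>A. - moebius d)"
    using p by (intro sum.cong) (auto simp: A_def moebius_prime_times)
  finally show ?thesis using False by (simp add: sum_negf)
qed (simp add: assms)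

lemma dconv_moebius_completely_multiplicative:
  assumes "completely_multiplicative f" "n > 0"
  shows "dconv (\<lambda>n. f n * of_int (moebius n)) f n = (if n = 1 then 1 else 0)"
proof -
  have "dconv (\<lambda>n. f n * of_int (moebius n)) f n =
        dconv (\<lambda>n. f n * of_int (moebius n)) (\<lambda>n. f n * 1) n" by simp
  also have "\<dots> = f n * of_int (\<Sum>d | d dvd n. moebius d)"
    by (subst dconv_completely_multiplicative[OF assms(1)]) (simp add: dconv_def)
  also have "\<dots> = (if n = 1 then 1 else 0)"
    using assms completely_multiplicativeD[OF assms(1)] by (simp add: sum_moebius_divisors)
  finally show ?thesis .
qed

text \<open>The coefficient sequences of $\zeta^2 L(s,f) L(s,\overline f)$: the recursion for
  $-D'/D$ shows their nonnegativity.\<close>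
lemma dconv_log_recursion:
  fixes f g :: "nat \<Rightarrow> complex"
  assumes f: "completely_multiplicative f" and g: "completely_multiplicative g" and n: "n > 0"
  defines "u \<equiv> (\<lambda>_::nat. 1::complex)"
  defines "c \<equiv> dconv (dconv u u) (dconv f g)"
  shows "c n * ln (real n) = dconv c (\<lambda>n. mangoldt n * (2 + f n + g n)) n"
proof -
  let ?L = "\<lambda>h n. h n * complex_of_real (ln (real n))"
  have u: "completely_multiplicative u" by (simp add: completely_multiplicative_def u_def)
  \<comment> \<open>The product rule: if \<open>x\<close> and \<open>y\<close> are the coefficients
    of the negated logarithmic derivatives of \<open>a\<close> and \<open>b\<close>, their sum
    belongs to \<open>dconv a b\<close>.\<close>
  have step: "?L (dconv a b) n = dconv (dconv a b) (\<lambda>n. x n + y n) n"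
    if "\<And>n. n > 0 \<Longrightarrow> dconv a x n = ?L a n" "\<And>n. n > 0 \<Longrightarrow> dconv b y n = ?L b n" "n > 0"
    for a b x y n
  proof -
    have "?L (dconv a b) n = dconv (dconv a x) b n + dconv a (dconv b y) n"
      using that dconv_mult_log[OF that(3)] dconv_cong[of "?L a" "dconv a x" b b n]
        dconv_cong[of a a "?L b" "dconv b y" n] by simp
    also have "dconv (dconv a x) b n = dconv (dconv a b) x n"
    proof -
      have "dconv x b = dconv b x" by (rule ext) (rule dconv_commute)
      then show ?thesis by (simp add: dconv_assoc)
    qed
    also have "dconv a (dconv b y) n = dconv (dconv a b) y n" by (simp add: dconv_assoc)
    finally show ?thesis by (simp add: dconv_add_right)
  qed
  note base = dconv_mangoldt_completely_multiplicative
  have 1: "\<And>n. n > 0 \<Longrightarrow> dconv (dconv u u) (\<lambda>n. u n * mangoldt n + u n * mangoldt n) n = ?L (dconv u u) n"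
    by (rule step[symmetric]) (auto intro: base u)
  have 2: "\<And>n. n > 0 \<Longrightarrow> dconv (dconv f g) (\<lambda>n. f n * mangoldt n + g n * mangoldt n) n = ?L (dconv f g) n"
    by (rule step[symmetric]) (auto intro: base f g)
  have "?L c n = dconv c (\<lambda>n. (u n * mangoldt n + u n * mangoldt n) + (f n * mangoldt n + g n * mangoldt n)) n"
    unfolding c_def by (rule step) (use 1 2 n in auto)
  also have "\<dots> = dconv c (\<lambda>n. mangoldt n * (2 + f n + g n)) n"
    by (simp add: u_def algebra_simps)
  finally show ?thesis .
qed

section \<open>Dirichlet series\<close>

text \<open>Index 0 is harmless here and in \<open>dseries\<close>, because
  \<open>0 powr z = 0\<close>; the value \<open>a 0\<close> never enters.\<close>

definition dsummable :: "(nat \<Rightarrow> complex) \<Rightarrow> complex \<Rightarrow> bool" where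
  "dsummable a s \<longleftrightarrow> summable (\<lambda>n. norm (a n * of_nat n powr (-s)))"

definition dseries :: "(nat \<Rightarrow> complex) \<Rightarrow> complex \<Rightarrow> complex" where
  "dseries a s = (\<Sum>n. a n * of_nat n powr (-s))"

lemma norm_of_nat_powr: "norm (of_nat n powr s :: complex) = real n powr Re s"
  by (subst norm_powr_real_powr) auto

lemma dsummable_bounded:
  assumes "\<And>n. norm (a n) \<le> C" "Re s > 1"
  shows "dsummable a s"
  unfolding dsummable_def
proof (rule summable_comparison_test)
  show "summable (\<lambda>n. C * real n powr (- Re s))"
    using assms(2) by (intro summable_mult) (simp add: summable_real_powr_iff)
  show "\<exists>N. \<forall>n\<ge>N. norm (norm (a n * of_nat n powr - s)) \<le> C * real n powr - Re s"
    using assms(1) by (auto simp: norm_mult norm_of_nat_powr intro!: exI[of _ 0] mult_right_mono)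
qed

lemma dseries_cong:
  assumes "\<And>n. n > 0 \<Longrightarrow> a n = b n"
  shows "dseries a s = dseries b s"
proof -
  have "(\<lambda>n. a n * of_nat n powr (-s)) = (\<lambda>n. b n * of_nat n powr (-s))"
    using assms by (intro ext) (metis mult_zero_right not_gr_zero of_nat_0 powr_0)
  then show ?thesis by (simp add: dseries_def)
qed

lemma dsummable_has_sum:
  assumes "dsummable a s"
  shows "((\<lambda>n. a n * of_nat n powr (-s)) has_sum dseries a s) {0<..}"
proof -
  have "((\<lambda>n. a n * of_nat n powr (-s)) has_sum dseries a s) UNIV"
    using assms unfolding dsummable_def dseries_def
    by (intro norm_summable_imp_has_sum) (auto intro: summable_sums summable_norm_cancel)
  then show ?thesis
    by (subst has_sum_cong_neutral[where T = "UNIV" and g = "\<lambda>n. a n * of_nat n powr (-s)"]) auto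
qed

lemma dsummable_iff_abs_summable_on:
  "dsummable a s \<longleftrightarrow> (\<lambda>n. norm (a n * of_nat n powr (-s))) summable_on {0<..}"
proof -
  have "dsummable a s \<longleftrightarrow> (\<lambda>n. norm (a n * of_nat n powr (-s))) summable_on UNIV"
    unfolding dsummable_def by (subst summable_on_UNIV_nonneg_real_iff) auto
  also have "\<dots> \<longleftrightarrow> (\<lambda>n. norm (a n * of_nat n powr (-s))) summable_on {0<..}"
    by (rule summable_on_cong_neutral) auto
  finally show ?thesis .
qed

text \<open>Absorbs a vertical shift into the coefficients, so that a point \<open>1 + v\<close>
  with \<open>Re v = 0\<close> can be treated like the point 1.\<close>

lemma dseries_twist:
  "dseries (\<lambda>n. a n * of_nat n powr (-w)) s = dseries a (s + w)"
  "dsummable (\<lambda>n. a n * of_nat n powr (-w)) s = dsummable a (s + w)"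
proof -
  have *: "a n * of_nat n powr (-w) * of_nat n powr (-s) = a n * of_nat n powr (-(s + w))" for n
    by (cases "n = 0") (auto simp: powr_def exp_add ring_distribs exp_diff exp_minus field_simps)
  show "dseries (\<lambda>n. a n * of_nat n powr (-w)) s = dseries a (s + w)"
    by (simp only: dseries_def *)
  show "dsummable (\<lambda>n. a n * of_nat n powr (-w)) s = dsummable a (s + w)"
    by (simp only: dsummable_def *)
qed

lemma completely_multiplicative_of_nat_powr: "completely_multiplicative (\<lambda>n. of_nat n powr s)"
  by (simp add: completely_multiplicative_def powr_times_real)

text \<open>Absolute convergence permits grouping the double series over pairs of positive indices
  by their product, and each group is finite.\<close>

lemma dseries_dconv:
  assumes a: "dsummable a s" and b: "dsummable b s"
  shows "dsummable (dconv a b) s" "dseries (dconv a b) s = dseries a s * dseries b s"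
proof -
  let ?P = "{0<..} :: nat set"
  let ?a = "\<lambda>n. a n * of_nat n powr (-s)" and ?b = "\<lambda>n. b n * of_nat n powr (-s)"
  let ?f = "\<lambda>(x, y). ?a x * ?b y"
  let ?S = "SIGMA n:?P. {(x, y). x * y = n}"
  have abs: "(\<lambda>p. norm (?f p)) summable_on ?P \<times> ?P"
  proof -
    have "(\<lambda>x. (\<Sum>\<^sub>\<infinity>y\<in>?P. norm (?a x) * norm (?b y))) = (\<lambda>x. norm (?a x) * (\<Sum>\<^sub>\<infinity>y\<in>?P. norm (?b y)))"
      by (intro ext infsum_cmult_right') 
    then show ?thesis
      using a b unfolding dsummable_iff_abs_summable_on
      by (intro iffD2[OF Infinite_Sum.abs_summable_on_Sigma_iff])
         (auto simp: norm_mult abs_mult infsum_nonneg intro!: summable_on_cmult_right summable_on_cmult_left)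
  qed
  have "bij_betw (\<lambda>(n, p). p) ?S (?P \<times> ?P)"
    by (rule bij_betw_byWitness[of _ "\<lambda>p. (fst p * snd p, p)"]) auto
  then have bij: "bij_betw snd ?S (?P \<times> ?P)" by (simp add: case_prod_unfold)
  have abs': "(\<lambda>x. norm (?f (snd x))) summable_on ?S"
    using abs summable_on_reindex_bij_betw[OF bij, of "\<lambda>p. norm (?f p)"] by simp
  have inner: "(\<Sum>\<^sub>\<infinity>p\<in>{(x, y). x * y = n}. ?f p) = dconv a b n * of_nat n powr (-s)" if "n > 0" for n
  proof -
    have "(\<Sum>\<^sub>\<infinity>p\<in>{(x, y). x * y = n}. ?f p) = (\<Sum>p\<in>{(x, y). x * y = n}. ?f p)"
      by (rule infsum_finite) (rule finite_factor_pairs(1)[OF that])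
    also have "\<dots> = (\<Sum>(x, y)\<in>{(x, y). x * y = n}. a x * b y * of_nat n powr (-s))"
      by (intro sum.cong) (auto simp: powr_times_real)
    also have "\<dots> = dconv a b n * of_nat n powr (-s)"
      using that by (simp add: dconv_pairs sum_distrib_right split_def)
    finally show ?thesis .
  qed
  have sm: "(\<lambda>x. ?f (snd x)) summable_on ?S" by (rule abs_summable_summable[OF abs'])
  have "(\<Sum>\<^sub>\<infinity>p\<in>?P \<times> ?P. ?f p) = (\<Sum>\<^sub>\<infinity>x\<in>?S. ?f (snd x))"
    by (rule infsum_reindex_bij_betw[OF bij, symmetric])
  also have "\<dots> = (\<Sum>\<^sub>\<infinity>n\<in>?P. \<Sum>\<^sub>\<infinity>p\<in>{(x, y). x * y = n}. ?f p)"
    using infsum_Sigma_banach[OF sm] by simp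
  also have "\<dots> = (\<Sum>\<^sub>\<infinity>n\<in>?P. dconv a b n * of_nat n powr (-s))"
    by (intro infsum_cong inner) auto
  finally have 1: "(\<Sum>\<^sub>\<infinity>p\<in>?P \<times> ?P. ?f p) = (\<Sum>\<^sub>\<infinity>n\<in>?P. dconv a b n * of_nat n powr (-s))" .
  have "(\<Sum>\<^sub>\<infinity>p\<in>?P \<times> ?P. ?f p) = (\<Sum>\<^sub>\<infinity>x\<in>?P. \<Sum>\<^sub>\<infinity>y\<in>?P. ?a x * ?b y)"
    using infsum_Sigma_banach[OF abs_summable_summable[OF abs]] by simp
  also have "\<dots> = (\<Sum>\<^sub>\<infinity>x\<in>?P. ?a x * dseries b s)"
    using infsumI[OF dsummable_has_sum[OF b]] by (simp add: infsum_cmult_right')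
  also have "\<dots> = dseries a s * dseries b s"
    using infsumI[OF dsummable_has_sum[OF a]] by (simp add: infsum_cmult_left')
  finally have 2: "(\<Sum>\<^sub>\<infinity>p\<in>?P \<times> ?P. ?f p) = dseries a s * dseries b s" .
  have "(\<lambda>n. \<Sum>\<^sub>\<infinity>p\<in>{(x, y). x * y = n}. norm (?f p)) summable_on ?P"
    using summable_on_Sigma_banach[of "\<lambda>x y. norm (?f y)" ?P "\<lambda>n. {(x, y). x * y = n}"] abs'
    by (simp add: case_prod_unfold)
  then have "(\<lambda>n. norm (dconv a b n * of_nat n powr (-s))) summable_on ?P"
  proof (rule Infinite_Sum.abs_summable_on_comparison_test')
    fix n :: nat assume "n \<in> ?P"
    then have n: "n > 0" by simp
    have "norm (\<Sum>p\<in>{(x, y). x * y = n}. ?f p) \<le> (\<Sum>p\<in>{(x, y). x * y = n}. norm (?f p))"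
      by (rule norm_sum)
    then show "norm (dconv a b n * of_nat n powr (-s)) \<le> (\<Sum>\<^sub>\<infinity>p\<in>{(x, y). x * y = n}. norm (?f p))"
      using inner[OF n] finite_factor_pairs(1)[OF n] by (simp add: infsum_finite)
  qed
  then show ds: "dsummable (dconv a b) s" by (simp add: dsummable_iff_abs_summable_on)
  show "dseries (dconv a b) s = dseries a s * dseries b s"
    using 1 2 infsumI[OF dsummable_has_sum[OF ds]] by simp
qed

lemma dseries_delta: "dseries (\<lambda>n. if n = 1 then 1 else 0) s = 1"
proof -
  have "dseries (\<lambda>n. if n = 1 then 1 else 0) s = (\<Sum>n\<in>{1::nat}. (if n = 1 then 1 else 0) * of_nat n powr (-s))"
    unfolding dseries_def by (rule suminf_finite) auto
  then show ?thesis by simp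
qed

lemma dseries_moebius_mult:
  assumes f: "completely_multiplicative f" and bd: "\<And>n. norm (f n) \<le> 1" and s: "Re s > 1"
  shows "dseries (\<lambda>n. f n * of_int (moebius n)) s * dseries f s = 1"
proof -
  have "norm (f n * of_int (moebius n)) \<le> 1" for n
    using bd[of n] abs_moebius_le_1[of n] by (auto simp: norm_mult abs_le_iff intro!: mult_le_one)
  then have "dseries (\<lambda>n. f n * of_int (moebius n)) s * dseries f s =
             dseries (dconv (\<lambda>n. f n * of_int (moebius n)) f) s"
    using s bd by (intro dseries_dconv(2)[symmetric] dsummable_bounded[of _ 1])
  also have "\<dots> = dseries (\<lambda>n. if n = 1 then 1 else 0) s"
    using dconv_moebius_completely_multiplicative[OF f] by (intro dseries_cong) auto
  finally show ?thesis by (simp only: dseries_delta)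
qed

section \<open>Continuation of Dirichlet series with periodic coefficients of mean zero\<close>

definition zero_mean_periodic :: "nat \<Rightarrow> (nat \<Rightarrow> complex) \<Rightarrow> bool" where
  "zero_mean_periodic m a \<longleftrightarrow> m > 0 \<and> (\<forall>n. a (n + m) = a n) \<and> (\<Sum>n\<in>{1..m}. a n) = 0"

definition lblock :: "nat \<Rightarrow> (nat \<Rightarrow> complex) \<Rightarrow> nat \<Rightarrow> complex \<Rightarrow> complex" where
  "lblock m a k s = (\<Sum>j\<in>{1..m}. a j * of_nat (k * m + j) powr (-s))"

text \<open>Summation by blocks continues the Dirichlet series to the half plane
  $\mathrm{Re}\, s > 0$.\<close>
definition lfun :: "nat \<Rightarrow> (nat \<Rightarrow> complex) \<Rightarrow> complex \<Rightarrow> complex" where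
  "lfun m a s = (\<Sum>k. lblock m a k s)"

lemma zero_mean_periodic_mult:
  assumes "zero_mean_periodic m a"
  shows "a (k * m + j) = a j"
proof (induction k)
  case (Suc k)
  have "a (Suc k * m + j) = a ((k * m + j) + m)" by (simp add: add_ac)
  also have "\<dots> = a (k * m + j)" using assms unfolding zero_mean_periodic_def by blast
  finally show ?case using Suc by simp
qed simp

lemma norm_of_real_powr_diff_le:
  assumes "0 < x" "x \<le> y" "Re s > 0"
  shows "norm (of_real y powr (-s) - of_real x powr (-s) :: complex) \<le> norm s * x powr (- Re s - 1) * (y - x)"
proof -
  have "norm (of_real y powr (-s) - of_real x powr (-s) :: complex)
        \<le> (norm s * x powr (- Re s - 1)) * norm (of_real y - of_real x :: complex)"
  proof (rule field_differentiable_bound[where S = "closed_segment (of_real x) (of_real y :: complex)"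
        and f' = "\<lambda>z. -s * z powr (-s - 1)"])
    fix z assume "z \<in> closed_segment (of_real x) (of_real y :: complex)"
    then obtain t where t: "z = of_real t" "x \<le> t" "t \<le> y"
      using assms by (auto simp: closed_segment_of_real closed_segment_eq_real_ivl)
    have "z \<notin> \<real>\<^sub>\<le>\<^sub>0" unfolding t(1) complex_nonpos_Reals_iff using t(2) assms(1) by simp
    then show "((\<lambda>z. z powr - s) has_field_derivative - s * z powr (- s - 1))
                 (at z within closed_segment (of_real x) (of_real y))"
      by (rule has_field_derivative_at_within[OF has_field_derivative_powr])
    have "norm (z powr (- s - 1)) = t powr (- Re s - 1)"
      using t assms by (subst norm_powr_real_powr) auto
    also have "\<dots> \<le> x powr (- Re s - 1)" using t assms by (intro powr_mono2') auto
    finally show "norm (- s * z powr (- s - 1)) \<le> norm s * x powr (- Re s - 1)"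
      by (simp add: norm_mult mult_left_mono)
  qed auto
  then show ?thesis using assms by (metis abs_of_nonneg diff_ge_0_iff_ge norm_of_real of_real_diff)
qed

text \<open>Since the coefficients of a period sum to zero, the same power
  \<open>?x powr (-s)\<close> may be subtracted from every term of the block. Each difference gains
  a factor \<open>1 / ?x\<close> by the mean value estimate, which gives absolute convergence of the
  blocks for positive real part. The bounds \<open>\<sigma>\<close> and \<open>B\<close> make the
  estimate uniform on compact sets.\<close>

lemma norm_lblock_le:
  assumes a: "zero_mean_periodic m a" and bd: "\<And>j. norm (a j) \<le> M"
    and s: "\<sigma> \<le> Re s" "\<sigma> > 0" "norm s \<le> B"
  shows "norm (lblock m a k s) \<le> real m * (M * (B * real m)) * real (Suc k) powr (- \<sigma> - 1)"
proof -
  have m: "m > 0" using a by (simp add: zero_mean_periodic_def)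
  have M: "M \<ge> 0" using order_trans[OF norm_ge_zero bd] .
  have B: "B \<ge> 0" using order_trans[OF norm_ge_zero s(3)] .
  let ?x = "real (k * m + 1)"
  have x0: "?x > 0" by (simp only: of_nat_0_less_iff)
  have "k \<le> k * m" using m by simp
  then have xk: "real (Suc k) \<le> ?x" by (simp only: of_nat_le_iff)
  have "lblock m a k s = lblock m a k s - (\<Sum>j\<in>{1..m}. a j) * of_real ?x powr (-s)"
    using a by (simp add: zero_mean_periodic_def)
  also have "\<dots> = (\<Sum>j\<in>{1..m}. a j * (of_real (real (k * m + j)) powr (-s) - of_real ?x powr (-s)))"
    unfolding lblock_def by (simp add: sum_distrib_right sum_subtractf right_diff_distrib)
  also have "norm \<dots> \<le> (\<Sum>j\<in>{1..m}. M * (B * real m) * real (Suc k) powr (- \<sigma> - 1))"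
  proof (rule sum_norm_le)
    fix j assume j: "j \<in> {1..m}"
    have "norm (of_real (real (k * m + j)) powr (-s) - of_real ?x powr (-s) :: complex)
          \<le> norm s * ?x powr (- Re s - 1) * (real (k * m + j) - ?x)"
      using j s by (intro norm_of_real_powr_diff_le[OF x0]) auto
    also have "\<dots> \<le> B * real (Suc k) powr (- \<sigma> - 1) * real m"
    proof (intro mult_mono)
      have "?x powr (- Re s - 1) \<le> ?x powr (- \<sigma> - 1)" using s by (intro powr_mono) auto
      also have "\<dots> \<le> real (Suc k) powr (- \<sigma> - 1)"
        using s xk by (intro powr_mono2') auto
      finally show "?x powr (- Re s - 1) \<le> real (Suc k) powr (- \<sigma> - 1)" .
    qed (use j s B in auto)
    finally have "norm (a j) * norm (of_real (real (k * m + j)) powr (-s) - of_real ?x powr (-s) :: complex)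
        \<le> M * (B * real (Suc k) powr (- \<sigma> - 1) * real m)"
      using bd M by (intro mult_mono) auto
    then show "norm (a j * (of_real (real (k * m + j)) powr (-s) - of_real ?x powr (-s)))
        \<le> M * (B * real m) * real (Suc k) powr (- \<sigma> - 1)"
      by (simp add: norm_mult mult_ac)
  qed
  also have "\<dots> = real m * (M * (B * real m)) * real (Suc k) powr (- \<sigma> - 1)" by simp
  finally show ?thesis .
qed

lemma zero_mean_periodic_bounded:
  assumes "zero_mean_periodic m a"
  obtains M where "\<And>n. norm (a n) \<le> M"
proof
  fix n
  have m: "m > 0" using assms by (simp add: zero_mean_periodic_def)
  have "a n = a (n mod m)" using zero_mean_periodic_mult[OF assms, of "n div m" "n mod m"] by simp
  also have "norm \<dots> \<le> (\<Sum>i<m. norm (a i))"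
    using m by (intro member_le_sum) auto
  finally show "norm (a n) \<le> (\<Sum>i<m. norm (a i))" .
qed

lemma lfun_holomorphic:
  assumes a: "zero_mean_periodic m a"
  shows "lfun m a holomorphic_on {s. Re s > 0}"
proof (rule holomorphic_uniform_sequence[where f = "\<lambda>n s. \<Sum>k<n. lblock m a k s"])
  show "open {s. Re s > 0}" by (rule open_halfspace_Re_gt)
  show "(\<lambda>s. \<Sum>k<n. lblock m a k s) holomorphic_on {s. Re s > 0}" for n
    unfolding lblock_def by (intro holomorphic_intros)
next
  fix x :: complex assume x: "x \<in> {s. Re s > 0}"
  define d where "d = Re x / 2"
  have d: "d > 0" using x by (simp add: d_def)
  have sub: "Re s \<ge> d" "norm s \<le> norm x + d" if "s \<in> cball x d" for s
  proof -
    have "norm (x - s) \<le> d" using that by (simp add: dist_norm)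
    then show "Re s \<ge> d" using abs_Re_le_cmod[of "x - s"] by (simp add: d_def)
    show "norm s \<le> norm x + d" using \<open>norm (x - s) \<le> d\<close> norm_triangle_sub[of s x] by (simp add: norm_minus_commute)
  qed
  obtain M where M: "\<And>n. norm (a n) \<le> M" using zero_mean_periodic_bounded[OF a] by blast
  have "uniform_limit (cball x d) (\<lambda>n s. \<Sum>k<n. lblock m a k s) (lfun m a) sequentially"
    unfolding lfun_def
  proof (rule Weierstrass_m_test)
    show "norm (lblock m a k s) \<le> real m * (M * ((norm x + d) * real m)) * real (Suc k) powr (- d - 1)"
      if "s \<in> cball x d" for k s
      using sub[OF that] d by (intro norm_lblock_le[OF a M])
    show "summable (\<lambda>k. real m * (M * ((norm x + d) * real m)) * real (Suc k) powr (- d - 1))"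
      using d by (intro summable_mult) (subst summable_Suc_iff, simp add: summable_real_powr_iff)
  qed
  moreover have "cball x d \<subseteq> {s. Re s > 0}"
    using d sub(1) by fastforce
  ultimately show "\<exists>d>0. cball x d \<subseteq> {s. Re s > 0} \<and>
      uniform_limit (cball x d) (\<lambda>n s. \<Sum>k<n. lblock m a k s) (lfun m a) sequentially"
    using d by blast
qed

lemma lfun_eq_dseries:
  assumes a: "zero_mean_periodic m a" and s: "Re s > 1"
  shows "lfun m a s = dseries a s"
proof -
  have m: "m > 0" using a by (simp add: zero_mean_periodic_def)
  obtain M where M: "\<And>n. norm (a n) \<le> M" using zero_mean_periodic_bounded[OF a] by blast
  let ?f = "\<lambda>n. a n * of_nat n powr (-s)"
  have "summable (\<lambda>n. norm (?f n))" using dsummable_bounded[OF M s] unfolding dsummable_def .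
  then have "?f sums dseries a s"
    unfolding dseries_def by (rule summable_sums[OF summable_norm_cancel])
  then have "(\<lambda>n. ?f (Suc n)) sums dseries a s"
    by (subst sums_Suc_iff) simp
  then have "(\<lambda>k. \<Sum>n\<in>{k * m..<k * m + m}. ?f (Suc n)) sums dseries a s"
    using m by (rule sums_group)
  moreover have "(\<Sum>n\<in>{k * m..<k * m + m}. ?f (Suc n)) = lblock m a k s" for k
  proof -
    have "lblock m a k s = (\<Sum>j\<in>{1..m}. ?f (k * m + j))"
      by (simp add: lblock_def zero_mean_periodic_mult[OF a])
    also have "\<dots> = (\<Sum>n\<in>{k * m..<k * m + m}. ?f (Suc n))"
      by (rule sum.reindex_bij_witness[of _ "\<lambda>n. Suc n - k * m" "\<lambda>j. k * m + j - 1"]) auto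
    finally show ?thesis ..
  qed
  ultimately show ?thesis unfolding lfun_def by (simp add: sums_iff)
qed

section \<open>Landau's theorem for Dirichlet series with nonnegative coefficients\<close>

lemma has_sum_suminf:
  fixes f :: "nat \<Rightarrow> 'a :: banach"
  assumes "summable (\<lambda>n. norm (f n))"
  shows "(f has_sum suminf f) UNIV"
  using assms norm_summable_imp_has_sum summable_norm_cancel summable_sums by blast

text \<open>Tonelli for nonnegative double series. It is applied below once by rows and once by
  columns, which relates the convergence of the Dirichlet series to that of a power series.\<close>

lemma summable_on_nat_times_iff:
  fixes f :: "nat \<Rightarrow> nat \<Rightarrow> real"
  assumes nonneg: "\<And>x y. f x y \<ge> 0" and rows: "\<And>x. (f x) sums g x"
  shows "(\<lambda>(x, y). f x y) summable_on UNIV \<longleftrightarrow> summable g"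
proof -
  have g: "g x \<ge> 0" for x using sums_le[OF _ sums_zero rows] nonneg by simp
  have row: "(f x has_sum g x) UNIV" for x
    using rows[of x] nonneg by (intro norm_summable_imp_has_sum) (auto simp: sums_iff)
  have "(\<lambda>(x, y). f x y) summable_on (SIGMA x:UNIV. UNIV) \<longleftrightarrow> g summable_on UNIV"
  proof
    assume "(\<lambda>(x, y). f x y) summable_on (SIGMA x:UNIV. UNIV)"
    then have "(\<lambda>x. infsum (f x) UNIV) summable_on UNIV" by (rule summable_on_Sigma_banach)
    then show "g summable_on UNIV" using infsumI[OF row] by simp
  next
    assume "g summable_on UNIV"
    then show "(\<lambda>(x, y). f x y) summable_on (SIGMA x:UNIV. UNIV)"
      using row nonneg by (intro summable_on_SigmaI) auto
  qed
  also have "g summable_on UNIV \<longleftrightarrow> summable g"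
    using g by (intro summable_on_UNIV_nonneg_real_iff) auto
  finally show ?thesis by simp
qed

text \<open>Landau: expand both sums around $2$; all terms are nonnegative for real arguments to the
  left of $2$, so the double series may be summed in either order.\<close>
lemma landau_dirichlet_series:
  fixes r :: "nat \<Rightarrow> real"
  assumes nonneg: "\<And>n. r n \<ge> 0"
    and conv: "\<And>s. Re s > 1 \<Longrightarrow> dsummable (\<lambda>n. of_real (r n)) s"
    and D: "D holomorphic_on ball 2 2"
    and eq: "\<And>s. Re s > 1 \<Longrightarrow> s \<in> ball 2 2 \<Longrightarrow> D s = dseries (\<lambda>n. of_real (r n)) s"
    and x: "0 < x"
  shows "summable (\<lambda>n. r n * real n powr (-x))"
proof -
  \<comment> \<open>With \<open>s = 2 - z\<close>, this is the coefficient of \<open>z ^ k\<close>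
    in \<open>r n * n powr (z - 2)\<close>, from the exponential series of
    \<open>n powr z\<close>.\<close>
  define t where "t n k = r n * real n powr (-2) * ln (real n) ^ k / fact k" for n k :: nat
  have t0: "t n k \<ge> 0" for n k
    by (cases "n = 0") (auto simp: t_def nonneg)
  have row: "(\<lambda>k. t n k * \<rho> ^ k) sums (r n * real n powr (\<rho> - 2))" for n and \<rho> :: real
  proof (cases "n = 0")
    case False
    have "(\<lambda>k. (r n * real n powr (-2)) * ((\<rho> * ln (real n)) ^ k /\<^sub>R fact k)) sums
          ((r n * real n powr (-2)) * exp (\<rho> * ln (real n)))"
      by (intro sums_mult exp_converges)
    also have "(r n * real n powr (-2)) * exp (\<rho> * ln (real n)) = r n * real n powr (\<rho> - 2)"
      using False by (simp add: powr_def exp_add [symmetric] algebra_simps)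
    also have "(\<lambda>k. (r n * real n powr (-2)) * ((\<rho> * ln (real n)) ^ k /\<^sub>R fact k)) = (\<lambda>k. t n k * \<rho> ^ k)"
      by (simp add: t_def power_mult_distrib divide_inverse mult_ac)
    finally show ?thesis .
  qed (simp add: t_def)
  have crow: "(\<lambda>k. of_real (t n k) * z ^ k) sums (of_real (r n) * of_nat n powr (z - 2))" for n and z :: complex
  proof (cases "n = 0")
    case False
    have "(\<lambda>k. (of_real (r n * real n powr (-2))) * ((z * ln (of_nat n)) ^ k /\<^sub>R fact k)) sums
          ((of_real (r n * real n powr (-2))) * exp (z * ln (of_nat n)))"
      by (intro sums_mult exp_converges)
    also have "(of_real (r n * real n powr (-2))) * exp (z * ln (of_nat n)) = of_real (r n) * of_nat n powr (z - 2)"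
    proof -
      have "complex_of_real (real n powr (-2)) = of_nat n powr (-2)"
        using powr_of_real[of "real n" "-2"] by simp
      then show ?thesis using False by (simp add: powr_def exp_add [symmetric] algebra_simps)
    qed
    also have "(\<lambda>k. (of_real (r n * real n powr (-2))) * ((z * ln (of_nat n)) ^ k /\<^sub>R fact k)) = (\<lambda>k. of_real (t n k) * z ^ k)"
      using False by (simp add: t_def power_mult_distrib divide_inverse mult_ac scaleR_conv_of_real Ln_of_nat)
    finally show ?thesis .
  qed (simp add: t_def)
  have summ: "summable (\<lambda>n. r n * real n powr (\<rho> - 2))" if "\<rho> < 1" for \<rho> :: real
    using conv[of "of_real (2 - \<rho>)"] that nonneg
    by (simp add: dsummable_def norm_mult norm_of_nat_powr)
  have pairs: "(\<lambda>(n, k). t n k * \<rho> ^ k) summable_on UNIV \<longleftrightarrow> summable (\<lambda>n. r n * real n powr (\<rho> - 2))"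
    if "\<rho> \<ge> 0" for \<rho> :: real
    by (rule summable_on_nat_times_iff) (use t0 row that in auto)
  \<comment> \<open>Any radius strictly between 0 and 1 would do: the double series converges there,
    hence so does each column, and the constant factor \<open>(1/2) ^ k\<close> is divided out
    again.\<close>
  have col0: "summable (\<lambda>n. t n k)" for k
  proof -
    have "(\<lambda>(n, k). t n k * (1/2) ^ k) summable_on (SIGMA n:UNIV. UNIV)"
      using pairs[of "1/2"] summ[of "1/2"] by simp
    then have "(\<lambda>(k, n). t n k * (1/2) ^ k) summable_on (SIGMA k:UNIV. UNIV)"
      by (subst (asm) summable_on_swap) (simp add: case_prod_unfold)
    then have "(\<lambda>n. t n k * (1/2) ^ k) summable_on UNIV"
      by (drule_tac summable_on_SigmaD1) auto
    then have "summable (\<lambda>n. t n k * (1/2) ^ k)"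
      by (rule summable_on_imp_summable)
    then have "summable (\<lambda>n. t n k * (1/2) ^ k * 2 ^ k)" by (rule summable_mult2)
    then show ?thesis by (simp add: power_one_over)
  qed
  \<comment> \<open>These turn out to be the Taylor coefficients of \<open>D (2 - z)\<close> at
    0.\<close>
  define q where "q k = (\<Sum>n. t n k)" for k
  have q0: "q k \<ge> 0" for k unfolding q_def by (intro suminf_nonneg col0 t0)
  have col: "(\<lambda>n. t n k * \<rho> ^ k) sums (q k * \<rho> ^ k)" for k and \<rho> :: real
    unfolding q_def by (intro sums_mult2 summable_sums col0)
  have pairs': "(\<lambda>(k, n). t n k * \<rho> ^ k) summable_on UNIV \<longleftrightarrow> summable (\<lambda>k. q k * \<rho> ^ k)"
    if "\<rho> \<ge> 0" for \<rho> :: real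
    by (rule summable_on_nat_times_iff) (use t0 col that in auto)
  have swap: "summable (\<lambda>k. q k * \<rho> ^ k) \<longleftrightarrow> summable (\<lambda>n. r n * real n powr (\<rho> - 2))" if "\<rho> \<ge> 0" for \<rho> :: real
  proof -
    have "(\<lambda>(n, k). t n k * \<rho> ^ k) summable_on UNIV \<times> UNIV \<longleftrightarrow> (\<lambda>(k, n). t n k * \<rho> ^ k) summable_on UNIV \<times> UNIV"
      by (subst summable_on_swap) (simp add: case_prod_unfold)
    then show ?thesis using pairs[OF that] pairs'[OF that] by simp
  qed
  have qsums: "(\<lambda>k. of_real (q k) * z ^ k) sums D (2 - z)" if z: "norm z < 1" for z :: complex
  proof -
    have "(\<lambda>(n, k). t n k * norm z ^ k) summable_on UNIV"
      using pairs[of "norm z"] summ[of "norm z"] z by simp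
    then have abs: "(\<lambda>p. norm ((\<lambda>(n, k). of_real (t n k) * z ^ k) p)) summable_on (UNIV \<times> UNIV)"
      using t0 by (simp add: case_prod_unfold norm_mult norm_power)
    have rowc: "(\<Sum>\<^sub>\<infinity>k. of_real (t n k) * z ^ k) = of_real (r n) * of_nat n powr (z - 2)" for n
      using crow[of n z] row[of n "norm z"] t0
      by (intro infsumI norm_summable_imp_has_sum) (auto simp: norm_mult norm_power sums_iff)
    have colc: "(\<Sum>\<^sub>\<infinity>n. of_real (t n k) * z ^ k) = of_real (q k) * z ^ k" for k
    proof (intro infsumI norm_summable_imp_has_sum)
      show "summable (\<lambda>n. norm (of_real (t n k) * z ^ k))"
        using col0[of k] t0 by (simp add: norm_mult summable_mult2)
      show "(\<lambda>n. of_real (t n k) * z ^ k) sums (of_real (q k) * z ^ k)"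
        unfolding q_def by (intro sums_mult2 sums_of_real summable_sums col0)
    qed
    have sm: "(\<lambda>(n, k). of_real (t n k) * z ^ k) summable_on (UNIV \<times> UNIV)"
      by (rule abs_summable_summable[OF abs])
    have "D (2 - z) = dseries (\<lambda>n. of_real (r n)) (2 - z)"
      using z abs_Re_le_cmod[of z] by (intro eq) (auto simp: dist_norm)
    also have "\<dots> = (\<Sum>\<^sub>\<infinity>n. of_real (r n) * of_nat n powr (z - 2))"
    proof -
      have "dsummable (\<lambda>n. of_real (r n)) (2 - z)"
        using z abs_Re_le_cmod[of z] by (intro conv) auto
      then have "((\<lambda>n. of_real (r n) * of_nat n powr (z - 2)) has_sum dseries (\<lambda>n. of_real (r n)) (2 - z)) UNIV"
        using has_sum_suminf unfolding dsummable_def dseries_def by fastforce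
      then show ?thesis by (simp add: infsumI)
    qed
    also have "\<dots> = (\<Sum>\<^sub>\<infinity>n. \<Sum>\<^sub>\<infinity>k. of_real (t n k) * z ^ k)"
      by (simp add: rowc)
    also have "\<dots> = (\<Sum>\<^sub>\<infinity>k. \<Sum>\<^sub>\<infinity>n. of_real (t n k) * z ^ k)"
      by (rule infsum_swap_banach) (use sm in simp)
    also have "\<dots> = (\<Sum>\<^sub>\<infinity>k. of_real (q k) * z ^ k)"
      by (simp add: colc)
    finally have *: "D (2 - z) = (\<Sum>\<^sub>\<infinity>k. of_real (q k) * z ^ k)" .
    have "summable (\<lambda>k. norm (of_real (q k) * z ^ k))"
      using swap[of "norm z"] summ[of "norm z"] z q0 by (simp add: norm_mult norm_power)
    then have "((\<lambda>k. of_real (q k) * z ^ k) has_sum (\<Sum>k. of_real (q k) * z ^ k)) UNIV"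
      by (rule has_sum_suminf)
    then show ?thesis using * by (metis has_sum_imp_sums infsumI)
  qed
  have "(\<lambda>z. D (2 - z)) has_fps_expansion Abs_fps (\<lambda>k. of_real (q k))"
    unfolding has_fps_expansion_def
  proof
    have "summable (\<lambda>k. fps_nth (Abs_fps (\<lambda>k. of_real (q k))) k * (1/2 :: complex) ^ k)"
      using qsums[of "1/2"] by (simp add: sums_iff)
    then have "fps_conv_radius (Abs_fps (\<lambda>k. of_real (q k) :: complex)) \<ge> norm (1/2 :: complex)"
      unfolding fps_conv_radius_def by (rule conv_radius_geI)
    then show "fps_conv_radius (Abs_fps (\<lambda>k. of_real (q k) :: complex)) > 0"
      by (rule order.strict_trans2[rotated]) simp
    have "eventually (\<lambda>z. z \<in> ball 0 1) (nhds (0::complex))"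
      by (intro eventually_nhds_in_open) auto
    then show "eventually (\<lambda>z. eval_fps (Abs_fps (\<lambda>k. of_real (q k))) z = D (2 - z)) (nhds 0)"
      by eventually_elim (use qsums in \<open>auto simp: eval_fps_def sums_iff\<close>)
  qed
  moreover have "(\<lambda>z. D (2 - z)) holomorphic_on eball 0 (ereal 2)"
  proof -
    have "(D \<circ> (\<lambda>z. 2 - z)) holomorphic_on ball 0 2"
      by (rule holomorphic_on_compose_gen[OF _ D]) (auto intro!: holomorphic_intros simp: dist_norm)
    then show ?thesis by (simp add: o_def eball_def ball_def)
  qed
  \<comment> \<open>Near 0 the power series represents \<open>D (2 - z)\<close>, which is
    holomorphic on the disc of radius 2; so the series converges on that whole disc. At the real
    point \<open>z = 2 - x\<close> all terms are nonnegative, and \<open>swap\<close> carries the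
    convergence back to the Dirichlet series.\<close>
  ultimately have big: "(\<lambda>k. of_real (q k) * z ^ k) sums D (2 - z)" if "norm z < 2" for z :: complex
    using has_fps_expansion_imp_sums_complex[of "\<lambda>z. D (2 - z)" _ "ereal 2" z] that by fastforce
  show ?thesis
  proof (cases "x < 2")
    case True
    have "summable (\<lambda>k. complex_of_real (q k) * of_real (2 - x) ^ k)"
      using big[of "of_real (2 - x)"] x True by (simp add: sums_iff norm_of_real del: of_real_diff)
    then have "summable (\<lambda>k. complex_of_real (q k * (2 - x) ^ k))" by simp
    then have "summable (\<lambda>k. q k * (2 - x) ^ k)" by (simp only: summable_complex_of_real)
    then show ?thesis using swap[of "2 - x"] True by simp
  next
    case False
    then show ?thesis using summ[of "2 - x"] by simp
  qed
qed

section \<open>Nonvanishing on the line of real part one\<close>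

text \<open>Both sides are the logarithm of \<open>fact N\<close>: expand \<open>ln n\<close> over
  the divisors of \<open>n\<close>, then count the multiples of each \<open>d\<close>.\<close>

lemma sum_ln_mangoldt:
  "(\<Sum>n=1..N. ln (real n)) = (\<Sum>d=1..N. mangoldt d * real (N div d))"
proof -
  have "(\<Sum>n=1..N. ln (real n)) = (\<Sum>n=1..N. \<Sum>d\<in>{1..N}. if d dvd n then mangoldt d else 0)"
  proof (intro sum.cong refl)
    fix n assume n: "n \<in> {1..N}"
    have "ln (real n) = (\<Sum>d | d dvd n. mangoldt d :: real)"
      using mangoldt_sum[of n, where ?'a = real] n by simp
    also have "{d. d dvd n} = {d \<in> {1..N}. d dvd n}"
      using n by (auto dest: dvd_imp_le intro: Nat.gr0I simp: Suc_le_eq)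
    also have "(\<Sum>d\<in>\<dots>. mangoldt d :: real) = (\<Sum>d\<in>{1..N}. if d dvd n then mangoldt d else 0)"
      by (rule sum.inter_filter) simp
    finally show "ln (real n) = (\<Sum>d\<in>{1..N}. if d dvd n then mangoldt d else 0)" .
  qed
  also have "\<dots> = (\<Sum>d\<in>{1..N}. \<Sum>n=1..N. if d dvd n then mangoldt d else 0)"
    by (rule sum.swap)
  also have "\<dots> = (\<Sum>d=1..N. mangoldt d * real (N div d))"
  proof (intro sum.cong refl)
    fix d assume d: "d \<in> {1..N}"
    have "(\<Sum>n=1..N. if d dvd n then mangoldt d else 0) = (\<Sum>n\<in>{n\<in>{1..N}. d dvd n}. mangoldt d :: real)"
      by (rule sum.inter_filter[symmetric]) simp
    also have "{n\<in>{1..N}. d dvd n} = (*) d ` {1..N div d}"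
      using d by (auto simp: less_eq_div_iff_mult_less_eq mult.commute image_iff elim!: dvdE)
    also have "(\<Sum>n\<in>\<dots>. mangoldt d :: real) = mangoldt d * real (N div d)"
      using d by (subst sum.reindex) (auto simp: inj_on_def)
    finally show "(\<Sum>n=1..N. if d dvd n then mangoldt d else 0) = mangoldt d * real (N div d)" .
  qed
  finally show ?thesis .
qed

lemma real_of_nat_div_le: "real (N div d) \<le> real N / real d"
  by (metis floor_divide_of_nat_eq of_int_floor_le of_int_of_nat_eq)

lemma sum_ln_ge: "(\<Sum>n=1..N. ln (real n)) \<ge> real N * ln (real N) - real N"
proof (induction N)
  case (Suc N)
  show ?case
  proof (cases "N = 0")
    case False
    have "real (Suc N) = real N * (1 + 1 / real N)" using False by (simp add: field_simps)
    then have "ln (real (Suc N)) = ln (real N) + ln (1 + 1 / real N)"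
      using False by (subst ln_mult_pos[symmetric]) (auto intro: add_pos_pos)
    then have "real N * (ln (real (Suc N)) - ln (real N)) = real N * ln (1 + 1 / real N)" by simp
    also have "\<dots> \<le> real N * (1 / real N)"
      by (intro mult_left_mono ln_add_one_self_le_self) auto
    also have "\<dots> = 1" using False by simp
    finally show ?thesis using Suc by (simp add: algebra_simps)
  qed simp
qed simp

text \<open>If the series converged to \<open>S\<close>, the logarithm of \<open>fact N\<close>
  would be at most \<open>N * S\<close>, against the Stirling lower bound
  \<open>N * ln N - N\<close>.\<close>

lemma not_summable_mangoldt_div: "\<not> summable (\<lambda>n. mangoldt n / real n)"
proof
  assume sm: "summable (\<lambda>n. mangoldt n / real n)"
  define S :: real where "S = (\<Sum>n. mangoldt n / real n)"
  have bd: "ln (real N) - 1 \<le> S" if "N > 0" for N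
  proof -
    have "real N * ln (real N) - real N \<le> (\<Sum>d=1..N. mangoldt d * real (N div d))"
      using sum_ln_ge[of N] sum_ln_mangoldt[of N] by simp
    also have "\<dots> \<le> (\<Sum>d=1..N. mangoldt d * (real N / real d))"
      by (intro sum_mono mult_left_mono mangoldt_nonneg real_of_nat_div_le)
    also have "\<dots> = real N * (\<Sum>d=1..N. mangoldt d / real d)"
      by (simp add: sum_distrib_left mult_ac)
    also have "\<dots> \<le> real N * S"
      unfolding S_def by (intro mult_left_mono sum_le_suminf sm) (auto intro!: divide_nonneg_nonneg mangoldt_nonneg)
    finally have "real N * (ln (real N) - 1) \<le> real N * S" by (simp add: algebra_simps)
    then show ?thesis using that by simp
  qed
  obtain N :: nat where N: "real N > exp (S + 1)" using reals_Archimedean2 by blast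
  have "real N > 0" by (rule less_trans[OF exp_gt_zero N])
  then have "ln (real N) > S + 1" using N by (metis exp_less_cancel_iff exp_ln)
  then show False using bd[of N] \<open>real N > 0\<close> by simp
qed

text \<open>If \<open>n\<close> is a prime power, its square is a power of the same prime; otherwise
  \<open>mangoldt n\<close> vanishes.\<close>

lemma mangoldt_power2: "mangoldt (n\<^sup>2) = (mangoldt n :: real) \<or> mangoldt n = (0 :: real)"
proof (cases "primepow n")
  case True
  then obtain p k where "prime p" "k > 0" "n = p ^ k" unfolding primepow_def by blast
  then show ?thesis by (simp add: power_mult [symmetric])
qed (simp add: mangoldt_def)

text \<open>At $n$ and $n^2$ together the weights $2+2\mathrm{Re}\,f$ cannot both be small, since
  $2 + 2\cos\theta + 2 + 2\cos 2\theta \ge 7/4$.\<close>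
lemma not_summable_mangoldt_twisted:
  fixes f :: "nat \<Rightarrow> complex"
  assumes f: "completely_multiplicative f" and nf: "\<And>n. f n = 0 \<or> norm (f n) = 1"
  shows "\<not> summable (\<lambda>n. mangoldt n * (2 + 2 * Re (f n)) * real n powr (-1/2))"
proof
  define u where "u n = mangoldt n * (2 + 2 * Re (f n)) * real n powr (-1/2)" for n
  assume "summable (\<lambda>n. mangoldt n * (2 + 2 * Re (f n)) * real n powr (-1/2))"
  then have su: "summable u" unfolding u_def .
  have w: "2 + 2 * Re (f n) \<ge> 0" for n
    using nf[of n] abs_Re_le_cmod[of "f n"] by auto
  have u0: "u n \<ge> 0" for n
    unfolding u_def by (intro mult_nonneg_nonneg mangoldt_nonneg w) auto
  have "u summable_on UNIV" using su u0 by (simp add: summable_on_UNIV_nonneg_real_iff)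
  then have "u summable_on range (\<lambda>n. n\<^sup>2)" by (rule summable_on_subset_banach) auto
  then have "(\<lambda>n. u (n\<^sup>2)) summable_on UNIV"
    by (subst (asm) summable_on_reindex) (auto simp: inj_on_def o_def)
  then have su2: "summable (\<lambda>n. u (n\<^sup>2))" by (rule summable_on_imp_summable)
  have "summable (\<lambda>n. mangoldt n / real n)"
  proof (rule summable_comparison_test)
    show "summable (\<lambda>n. u n + u (n\<^sup>2))" by (intro summable_add su su2)
    show "\<exists>N. \<forall>n\<ge>N. norm (mangoldt n / real n) \<le> u n + u (n\<^sup>2)"
    proof (intro exI[of _ 1] allI impI)
      fix n :: nat assume n: "n \<ge> 1"
      have L0: "mangoldt n \<ge> (0::real)" by (rule mangoldt_nonneg)
      have a: "u n \<ge> mangoldt n / real n * (2 + 2 * Re (f n))"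
      proof -
        have "real n powr (-1) \<le> real n powr (-1/2)" using n by (intro powr_mono) auto
        then have "mangoldt n * (2 + 2 * Re (f n)) * (1 / real n) \<le> u n"
          unfolding u_def using n w L0 by (intro mult_left_mono) (auto simp: powr_minus_divide)
        then show ?thesis by (simp add: mult_ac)
      qed
      \<comment> \<open>The exponent \<open>-1/2\<close> is the one at which the square of
        \<open>n\<close> receives the weight \<open>1 / n\<close>, that of the divergent
        series.\<close>
      have sq: "real (n\<^sup>2) powr (-1/2) = 1 / real n"
      proof -
        have "real (n\<^sup>2) powr (-1/2) = (real n powr 2) powr (-1/2)"
          using n by (simp add: powr_numeral)
        then show ?thesis using n by (simp add: powr_powr powr_minus_divide)
      qed
      have f2: "f (n\<^sup>2) = (f n)\<^sup>2" using f by (simp add: power2_eq_square completely_multiplicativeD)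
      have b: "u (n\<^sup>2) = mangoldt n / real n * (2 + 2 * Re ((f n)\<^sup>2)) \<or> mangoldt n = (0::real)"
        using mangoldt_power2[of n] unfolding u_def sq f2 by auto
      have "2 + 2 * Re (f n) + (2 + 2 * Re ((f n)\<^sup>2)) \<ge> 1"
      proof (cases "f n = 0")
        case False
        then have "(Re (f n))\<^sup>2 + (Im (f n))\<^sup>2 = 1" using nf[of n] by (auto simp: cmod_def)
        then have "Re ((f n)\<^sup>2) = 2 * (Re (f n))\<^sup>2 - 1" by (simp add: power2_eq_square)
        \<comment> \<open>The sum in question equals this square plus 7/4.\<close>
        moreover have "(2 * Re (f n) + 1/2)\<^sup>2 \<ge> 0" by simp
        ultimately show ?thesis by (simp add: power2_eq_square algebra_simps)
      qed simp
      then have "mangoldt n / real n * 1 \<le> mangoldt n / real n * (2 + 2 * Re (f n) + (2 + 2 * Re ((f n)\<^sup>2)))"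
        using L0 by (intro mult_left_mono) auto
      also have "\<dots> = mangoldt n / real n * (2 + 2 * Re (f n)) + mangoldt n / real n * (2 + 2 * Re ((f n)\<^sup>2))"
        by (rule distrib_left)
      finally have "mangoldt n / real n \<le> u n + u (n\<^sup>2)"
        using a b u0[of n] u0[of "n\<^sup>2"] by auto
      then show "norm (mangoldt n / real n) \<le> u n + u (n\<^sup>2)"
        using L0 by simp
    qed
  qed
  then show False using not_summable_mangoldt_div by blast
qed

lemma sum_nonneg_Reals:
  fixes f :: "'a \<Rightarrow> complex"
  assumes "\<And>x. x \<in> A \<Longrightarrow> f x \<in> \<real>\<^sub>\<ge>\<^sub>0"
  shows "sum f A \<in> \<real>\<^sub>\<ge>\<^sub>0"
  using assms by (induction A rule: infinite_finite_induct) auto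

lemma dconv_1 [simp]: "dconv f g (Suc 0) = f 1 * g 1"
  by (simp add: dconv_def)

text \<open>The recursion for \<open>c n * ln n\<close> has nonnegative weights, so nonnegativity
  passes from smaller arguments to \<open>n\<close>. Keeping only the divisor 1 in it gives the
  lower bound, which turns convergence of the series of \<open>c\<close> into convergence of a
  twisted sum over prime powers.\<close>

lemma rankin_coefficients:
  fixes f :: "nat \<Rightarrow> complex"
  assumes f: "completely_multiplicative f" and nf: "\<And>n. f n = 0 \<or> norm (f n) = 1"
  defines "u \<equiv> (\<lambda>_::nat. 1::complex)"
  defines "c \<equiv> dconv (dconv u u) (dconv f (\<lambda>n. cnj (f n)))"
  shows "c n \<in> \<real>\<^sub>\<ge>\<^sub>0" "Re (c n) * ln (real n) \<ge> mangoldt n * (2 + 2 * Re (f n))"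
proof -
  define w where "w n = complex_of_real (mangoldt n * (2 + 2 * Re (f n)))" for n
  have wpos: "2 + 2 * Re (f n) \<ge> 0" for n
    using nf[of n] abs_Re_le_cmod[of "f n"] by auto
  have w: "w n \<in> \<real>\<^sub>\<ge>\<^sub>0" for n
    unfolding w_def nonneg_Reals_of_real_iff by (intro mult_nonneg_nonneg mangoldt_nonneg wpos)
  \<comment> \<open>Because \<open>mangoldt 1 = 0\<close>, the divisor \<open>d = n\<close> drops
    out and the recursion determines \<open>c n\<close> from smaller arguments.\<close>
  have w1: "w (Suc 0) = 0" by (simp add: w_def)
  have g: "completely_multiplicative (\<lambda>n. cnj (f n))"
    using f by (simp add: completely_multiplicative_def)
  have rec: "c n * ln (real n) = dconv c w n" if "n > 0" for n
  proof -
    have "(\<lambda>n. mangoldt n * (2 + f n + cnj (f n))) = w"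
      by (auto simp: w_def fun_eq_iff complex_eq_iff)
    then show ?thesis using dconv_log_recursion[OF f g that] unfolding c_def u_def by simp
  qed
  have c1: "c 1 = 1"
    using completely_multiplicativeD[OF f] by (simp add: c_def u_def)
  have split: "dconv c w n = w n + (\<Sum>d | d dvd n \<and> d \<noteq> 1 \<and> d \<noteq> n. c d * w (n div d))" if "n > 1" for n
  proof -
    have "dconv c w n = (\<Sum>d\<in>insert 1 (insert n {d. d dvd n \<and> d \<noteq> 1 \<and> d \<noteq> n}). c d * w (n div d))"
      unfolding dconv_def by (rule sum.cong) auto
    also have "\<dots> = w n + (\<Sum>d | d dvd n \<and> d \<noteq> 1 \<and> d \<noteq> n. c d * w (n div d))"
      using that c1 w1 by (subst sum.insert; simp)+
    finally show ?thesis .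
  qed
  have nonneg: "c n \<in> \<real>\<^sub>\<ge>\<^sub>0" for n
  proof (induction n rule: less_induct)
    case (less n)
    consider "n = 0" | "n = 1" | "n > 1" by linarith
    then show ?case
    proof cases
      case 3
      then have ln: "ln (real n) > 0" by simp
      have "(\<Sum>d | d dvd n \<and> d \<noteq> 1 \<and> d \<noteq> n. c d * w (n div d)) \<in> \<real>\<^sub>\<ge>\<^sub>0"
        using 3 by (intro sum_nonneg_Reals nonneg_Reals_mult_I w less) (auto dest!: dvd_imp_le)
      then have "(w n + (\<Sum>d | d dvd n \<and> d \<noteq> 1 \<and> d \<noteq> n. c d * w (n div d))) / of_real (ln (real n)) \<in> \<real>\<^sub>\<ge>\<^sub>0"
        using ln by (intro nonneg_Reals_divide_I nonneg_Reals_add_I w) auto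
      also have "(w n + (\<Sum>d | d dvd n \<and> d \<noteq> 1 \<and> d \<noteq> n. c d * w (n div d))) / of_real (ln (real n)) = c n"
        using split[OF 3] rec[of n] 3 ln by (auto simp: field_simps)
      finally show ?thesis .
    qed (auto simp: c1[unfolded One_nat_def], simp add: c_def)
  qed
  show "c n \<in> \<real>\<^sub>\<ge>\<^sub>0" by (rule nonneg)
  show "Re (c n) * ln (real n) \<ge> mangoldt n * (2 + 2 * Re (f n))"
  proof (cases "n > 1")
    case True
    have "(\<Sum>d | d dvd n \<and> d \<noteq> 1 \<and> d \<noteq> n. c d * w (n div d)) \<in> \<real>\<^sub>\<ge>\<^sub>0"
      by (intro sum_nonneg_Reals nonneg_Reals_mult_I w nonneg)
    then have "Re (c n * ln (real n)) \<ge> Re (w n)"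
      using True rec[of n] split[OF True] by (simp add: complex_nonneg_Reals_iff)
    then show ?thesis by (simp add: w_def)
  next
    case False
    then have "n = 0 \<or> n = 1" by auto
    then show ?thesis by auto
  qed
qed

section \<open>Nonvanishing of the L-functions of nonprincipal characters\<close>

definition nonprincipal_character :: "nat \<Rightarrow> (nat \<Rightarrow> complex) \<Rightarrow> bool" where
  "nonprincipal_character m \<psi> \<longleftrightarrow> completely_multiplicative \<psi> \<and> zero_mean_periodic m \<psi> \<and>
     (\<forall>n. \<psi> n = 0 \<or> norm (\<psi> n) = 1)"

text \<open>These are the coefficients of the eta function, so the continuation built for characters
  also provides one for zeta up to an elementary factor.\<close>

lemma zero_mean_periodic_alternating:
  "zero_mean_periodic 2 (\<lambda>n. if even n then -1 else 1)"
proof -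
  have "{1..2::nat} = {1, 2}" by auto
  then show ?thesis by (simp add: zero_mean_periodic_def)
qed

text \<open>The alternating series is zeta minus twice its even part; as a convolution, the
  coefficients are those of \<open>1 - 2 * 2 powr (-s)\<close> times the constant 1.\<close>

lemma dseries_alternating:
  assumes s: "Re s > 1"
  shows "dseries (\<lambda>n. if even n then -1 else 1) s = (1 - 2 powr (1 - s)) * dseries (\<lambda>_. 1) s"
proof -
  define b :: "nat \<Rightarrow> complex" where "b n = (if n = 1 then 1 else if n = 2 then -2 else 0)" for n
  have b: "norm (b n) \<le> 2" for n by (simp add: b_def)
  have b12: "b (Suc 0) = 1" "b 2 = -2" by (simp_all add: b_def)
  have conv: "dconv b (\<lambda>_. 1) n = (if even n then -1 else 1)" if "n > 0" for n
  proof -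
    have "dconv b (\<lambda>_. 1) n = (\<Sum>d\<in>{d. d dvd n} \<inter> {1, 2}. b d)"
      unfolding dconv_def using that by (intro sum.mono_neutral_cong_right) (auto simp: b_def)
    also have "{d. d dvd n} \<inter> {1, 2} = (if even n then {1, 2} else {1})" by auto
    finally show ?thesis using b12 by (cases "even n") simp_all
  qed
  have "dseries b s = (\<Sum>n\<in>{1, 2}. b n * of_nat n powr (-s))"
    unfolding dseries_def by (rule suminf_finite) (auto simp: b_def)
  also have "\<dots> = 1 - 2 powr (1 - s)"
    by (simp add: b_def powr_diff powr_minus divide_inverse)
  finally have bs: "dseries b s = 1 - 2 powr (1 - s)" .
  have "dseries (\<lambda>n. if even n then -1 else 1) s = dseries (dconv b (\<lambda>_. 1)) s"
    using conv by (intro dseries_cong) simp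
  also have "\<dots> = dseries b s * dseries (\<lambda>_. 1) s"
    using s by (intro dseries_dconv dsummable_bounded[OF b] dsummable_bounded[of _ 1]) auto
  finally show ?thesis by (simp add: bs)
qed

text \<open>The solutions are spaced vertically by \<open>2 * pi / ln 2\<close>, which is more than
  9. Hence division by this factor in the disc around 2 of radius 2 creates a problem only at
  \<open>s = 1\<close>.\<close>

lemma two_powr_eq_1_imp:
  assumes "2 powr (1 - s) = 1" "\<bar>Im s\<bar> < 2"
  shows "s = 1"
proof -
  have "exp ((1 - s) * of_real (ln 2)) = 1"
    using assms(1) by (simp add: powr_def Ln_of_real[of 2, simplified])
  then obtain n :: int where n: "Re ((1 - s) * of_real (ln 2)) = 0" "Im ((1 - s) * of_real (ln 2)) = of_int (2 * n) * pi"
    unfolding exp_eq_1 by blast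
  have r: "Re s = 1" using n(1) by simp
  have i: "- Im s * ln 2 = of_int (2 * n) * pi" using n(2) by simp
  have "\<bar>of_int (2 * n) * pi\<bar> < 2 * 1"
    unfolding i[symmetric] abs_mult using assms(2) ln_2_less_1 by (intro mult_strict_mono) auto
  then have "\<bar>real_of_int n\<bar> * pi < 1" by (simp add: abs_mult)
  moreover have "1 \<le> \<bar>real_of_int n\<bar>" if "n \<noteq> 0" using that by linarith
  ultimately have "n = 0"
    using pi_gt3 by (smt (verit) mult_le_cancel_right1)
  then have "Im s = 0" using i by simp
  then show ?thesis using r by (simp add: complex_eq_iff)
qed

text \<open>A zero at \<open>w = 1 + v\<close> gives a zero at 1 to both the shifted L-function and
  its conjugate, and these cancel the double pole of the squared zeta factor. The product then
  continues to a disc reaching down to 0, and by Landau its nonnegative Dirichlet series converges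
  for every positive exponent. The lower bound for its coefficients makes a twisted sum over prime
  powers converge that is known to diverge. Real and complex characters, and \<open>w = 1\<close>,
  are treated alike.\<close>

lemma lfun_nonzero_line:
  assumes \<psi>: "nonprincipal_character m \<psi>" and w: "Re w = 1"
  shows "lfun m \<psi> w \<noteq> 0"
proof
  assume zero: "lfun m \<psi> w = 0"
  have cm: "completely_multiplicative \<psi>" and per: "zero_mean_periodic m \<psi>"
    and n\<psi>: "\<And>n. \<psi> n = 0 \<or> norm (\<psi> n) = 1"
    using \<psi> by (auto simp: nonprincipal_character_def)
  define v where "v = \<i> * of_real (Im w)"
  have v: "1 + v = w" "Re v = 0" using w by (auto simp: v_def complex_eq_iff)
  define f where "f n = \<psi> n * of_nat n powr (-v)" for n
  have f: "completely_multiplicative f" unfolding f_def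
    by (intro completely_multiplicative_mult cm completely_multiplicative_of_nat_powr)
  have nf: "f n = 0 \<or> norm (f n) = 1" for n
    using n\<psi>[of n] v by (cases "n = 0") (auto simp: f_def norm_mult norm_of_nat_powr)
  have f1: "norm (f n) \<le> 1" "norm (cnj (f n)) \<le> 1" for n using nf[of n] by auto
  define u where "u = (\<lambda>_::nat. 1::complex)"
  define c where "c = dconv (dconv u u) (dconv f (\<lambda>n. cnj (f n)))"
  note c = rankin_coefficients[OF f nf, folded u_def, folded c_def]
  define r where "r n = Re (c n)" for n
  have cr: "c n = of_real (r n)" and r0: "r n \<ge> 0" for n
    using c(1)[of n] by (auto simp: r_def complex_nonneg_Reals_iff complex_eq_iff)
  have cr': "c = (\<lambda>n. of_real (r n))" using cr by blast
  let ?H = "{s. Re s > 0}"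
  define L1 where "L1 s = lfun m \<psi> (s + v)" for s
  \<comment> \<open>Reflection keeps this function holomorphic and turns the coefficients
    \<open>f n\<close> into their conjugates; it vanishes at 1 together with
    \<open>L1\<close>.\<close>
  define L2 where "L2 s = cnj (L1 (cnj s))" for s
  define e where "e s = 1 - 2 powr (1 - s)" for s :: complex
  define E where "E = lfun 2 (\<lambda>n. if even n then -1 else 1)"
  have hL: "lfun m \<psi> holomorphic_on ?H" by (rule lfun_holomorphic[OF per])
  have h1: "L1 holomorphic_on ?H"
  proof -
    have "(lfun m \<psi> \<circ> (\<lambda>s. s + v)) holomorphic_on ?H"
      by (rule holomorphic_on_compose_gen[OF _ hL]) (auto intro!: holomorphic_intros simp: v)
    then show ?thesis by (simp add: L1_def[abs_def] o_def)
  qed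
  have h2: "L2 holomorphic_on ?H"
  proof -
    have img: "cnj ` ?H = ?H"
    proof -
      have "s \<in> cnj ` ?H" if "s \<in> ?H" for s
        using that by (intro image_eqI[of _ _ "cnj s"]) auto
      then show ?thesis by auto
    qed
    have "cnj \<circ> L1 \<circ> cnj holomorphic_on ?H"
      by (rule holomorphic_on_compose_cnj_cnj) (use h1 img open_halfspace_Re_gt in auto)
    then show ?thesis by (simp add: L2_def[abs_def] o_def)
  qed
  have hE: "E holomorphic_on ?H"
    unfolding E_def by (rule lfun_holomorphic[OF zero_mean_periodic_alternating])
  have he: "e holomorphic_on UNIV" unfolding e_def by (intro holomorphic_intros) auto
  have z1: "L1 1 = 0" "L2 1 = 0" "e 1 = 0" using zero v by (auto simp: L1_def L2_def e_def)
  have de: "(e has_field_derivative ln 2) (at 1)"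
    unfolding e_def powr_def by (auto intro!: derivative_eq_intros)
  define Q :: "(complex \<Rightarrow> complex) \<Rightarrow> complex \<Rightarrow> complex"
    where "Q h s = (if s = 1 then deriv h 1 else (h s - h 1) / (s - 1))" for h s
  have hQ: "Q h holomorphic_on ?H" if "h holomorphic_on ?H" for h
    unfolding Q_def[abs_def] by (rule pole_lemma_open[OF that open_halfspace_Re_gt])
  \<comment> \<open>On the half plane of convergence \<open>E = e * zeta\<close>, so
    \<open>D\<close> is zeta squared times \<open>L1\<close> times \<open>L2\<close>. Each zero at 1
    has been divided out by \<open>Q\<close>, two in the numerator against the two of
    \<open>e\<close> in the denominator; at 1 itself \<open>Q e\<close> equals \<open>ln 2\<close>,
    not 0.\<close>
  define D where "D s = (E s)\<^sup>2 * Q L1 s * Q L2 s / (Q e s)\<^sup>2" for s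
  have ball: "s \<in> ?H" "\<bar>Im s\<bar> < 2" if "s \<in> ball 2 2" for s :: complex
  proof -
    have "norm (s - 2) < 2" using that by (simp add: dist_norm norm_minus_commute)
    then show "s \<in> ?H" "\<bar>Im s\<bar> < 2"
      using abs_Re_le_cmod[of "s - 2"] abs_Im_le_cmod[of "s - 2"] by auto
  qed
  have Qe: "Q e s \<noteq> 0" if "s \<in> ball 2 2" for s
  proof (cases "s = 1")
    case True
    then show ?thesis using DERIV_imp_deriv[OF de] by (simp add: Q_def)
  next
    case False
    then have "e s \<noteq> 0" using two_powr_eq_1_imp[of s] ball[OF that] by (auto simp: e_def)
    then show ?thesis using False z1 by (simp add: Q_def)
  qed
  have hD: "D holomorphic_on ball 2 2"
  proof -
    have sub: "ball 2 2 \<subseteq> ?H" using ball(1) by blast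
    have "Q e holomorphic_on ?H" by (rule hQ) (rule holomorphic_on_subset[OF he], simp)
    then have "E holomorphic_on ball 2 2" "Q L1 holomorphic_on ball 2 2"
        "Q L2 holomorphic_on ball 2 2" "Q e holomorphic_on ball 2 2"
      using holomorphic_on_subset[OF _ sub] hQ h1 h2 hE by blast+
    then show ?thesis
      unfolding D_def using Qe by (intro holomorphic_intros) auto
  qed
  have L1s: "L1 s = dseries f s" if "Re s > 1" for s
    using that v lfun_eq_dseries[OF per, of "s + v"] dseries_twist(1)[of \<psi> v s]
    by (simp add: L1_def f_def[abs_def])
  have L2s: "L2 s = dseries (\<lambda>n. cnj (f n)) s" if "Re s > 1" for s
  proof -
    have "L2 s = cnj (dseries f (cnj s))" using L1s[of "cnj s"] that by (simp add: L2_def)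
    also have "\<dots> = dseries (\<lambda>n. cnj (f n)) s"
    proof -
      have "dsummable f (cnj s)" by (rule dsummable_bounded[OF f1(1)]) (use that in simp)
      then have "(\<lambda>n. f n * of_nat n powr (- cnj s)) sums dseries f (cnj s)"
        unfolding dsummable_def dseries_def by (rule summable_sums[OF summable_norm_cancel])
      then have "(\<lambda>n. cnj (f n * of_nat n powr (- cnj s))) sums cnj (dseries f (cnj s))"
        by (simp only: sums_cnj)
      moreover have "cnj (of_nat n powr (- cnj s)) = of_nat n powr (-s)" for n
        by (cases "n = 0") (auto simp: cnj_powr)
      ultimately show ?thesis by (simp add: dseries_def sums_iff)
    qed
    finally show ?thesis .
  qed
  have ds: "dsummable u s" "dsummable f s" "dsummable (\<lambda>n. cnj (f n)) s" if "Re s > 1" for s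
    using f1 that by (auto intro!: dsummable_bounded[of _ 1] simp: u_def)
  have dc: "dsummable c s" "dseries c s = (dseries u s)\<^sup>2 * dseries f s * dseries (\<lambda>n. cnj (f n)) s"
    if "Re s > 1" for s
    unfolding c_def using ds[OF that]
    by (simp_all add: dseries_dconv power2_eq_square)
  have Deq: "D s = dseries c s" if s: "Re s > 1" "s \<in> ball 2 2" for s
  proof -
    have ne: "s \<noteq> 1" using s by auto
    then have "e s \<noteq> 0" using two_powr_eq_1_imp[of s] ball[OF s(2)] by (auto simp: e_def)
    moreover have "E s = e s * dseries u s"
      using s lfun_eq_dseries[OF zero_mean_periodic_alternating s(1)] dseries_alternating[OF s(1)]
      by (simp add: E_def e_def u_def)
    moreover have "(a * b)\<^sup>2 * (x / z) * (y / z) / (a / z)\<^sup>2 = b\<^sup>2 * x * y"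
      if "a \<noteq> 0" "z \<noteq> 0" for a b x y z :: complex
      using that by (simp add: power2_eq_square field_simps)
    ultimately show ?thesis
      using ne z1 L1s[OF s(1)] L2s[OF s(1)] dc(2)[OF s(1)] by (simp add: D_def Q_def)
  qed
  \<comment> \<open>The exponent 1/4 leaves a factor \<open>n powr (1/4)\<close> to absorb the
    logarithm when passing to the exponent 1/2.\<close>
  have sm: "summable (\<lambda>n. r n * real n powr (-(1/4)))"
    by (rule landau_dirichlet_series[of r D]) (use r0 dc(1) hD Deq in \<open>auto simp: cr'[symmetric]\<close>)
  have "summable (\<lambda>n. mangoldt n * (2 + 2 * Re (f n)) * real n powr (-1/2))"
  proof (rule summable_comparison_test)
    show "summable (\<lambda>n. 4 * (r n * real n powr (-(1/4))))" by (intro summable_mult sm)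
    show "\<exists>N. \<forall>n\<ge>N. norm (mangoldt n * (2 + 2 * Re (f n)) * real n powr (-1/2)) \<le> 4 * (r n * real n powr (-(1/4)))"
    proof (intro exI[of _ 1] allI impI)
      fix n :: nat assume n: "n \<ge> 1"
      have pos: "0 \<le> 2 + 2 * Re (f n)" using nf[of n] abs_Re_le_cmod[of "f n"] by auto
      have "ln (real n powr (1/4)) \<le> real n powr (1/4) - 1" using n by (intro ln_le_minus_one) auto
      then have ln: "ln (real n) \<le> 4 * real n powr (1/4)" using n by (simp add: ln_powr)
      have "norm (mangoldt n * (2 + 2 * Re (f n)) * real n powr (-1/2)) = mangoldt n * (2 + 2 * Re (f n)) * real n powr (-1/2)"
        using pos mangoldt_nonneg[of n] by simp
      also have "\<dots> \<le> (r n * ln (real n)) * real n powr (-1/2)"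
        using c(2)[of n] by (intro mult_right_mono) (auto simp: r_def)
      also have "\<dots> \<le> (r n * (4 * real n powr (1/4))) * real n powr (-1/2)"
        using ln r0 by (intro mult_right_mono mult_left_mono) auto
      also have "\<dots> = 4 * (r n * (real n powr (1/4) * real n powr (-1/2)))" by simp
      also have "real n powr (1/4) * real n powr (-1/2) = real n powr (-(1/4))"
        by (simp add: powr_add [symmetric])
      finally show "norm (mangoldt n * (2 + 2 * Re (f n)) * real n powr (-1/2)) \<le> 4 * (r n * real n powr (-(1/4)))" .
    qed
  qed
  then show False using not_summable_mangoldt_twisted[OF f nf] by blast
qed

lemma lfun_nonzero:
  assumes \<psi>: "nonprincipal_character m \<psi>" and s: "Re s \<ge> 1"
  shows "lfun m \<psi> s \<noteq> 0"
proof (cases "Re s = 1")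
  case False
  have *: "completely_multiplicative \<psi>" "zero_mean_periodic m \<psi>" "\<And>n. norm (\<psi> n) \<le> 1"
    using \<psi> by (auto simp: nonprincipal_character_def) (metis norm_zero order_refl zero_le_one)
  show ?thesis
    using dseries_moebius_mult[OF *(1,3), of s] lfun_eq_dseries[OF *(2), of s] s False by auto
qed (use lfun_nonzero_line[OF \<psi>] in auto)

section \<open>Newman's Tauberian theorem\<close>

lemma suminf_norm_le_real:
  fixes f :: "nat \<Rightarrow> complex"
  assumes "\<And>n. norm (f n) \<le> g n" "summable g"
  shows "norm (suminf f) \<le> suminf g"
proof -
  have "summable (\<lambda>n. norm (f n))"
    by (rule summable_comparison_test[OF _ assms(2)]) (use assms(1) in auto)
  then show ?thesis
    using summable_norm[of f] suminf_le[of "\<lambda>n. norm (f n)" g] assms by fastforce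
qed

lemma powr_diff_mvt:
  fixes y x :: real
  assumes "y > 0"
  obtains c where "y < c" "c < y + 1" "(y + 1) powr x - y powr x = x * c powr (x - 1)"
proof -
  have "\<exists>z. z > y \<and> z < y + 1 \<and> (y + 1) powr x - y powr x = (y + 1 - y) * (x * z powr (x - 1))"
    using assms by (intro MVT2) (auto intro!: derivative_eq_intros)
  then show ?thesis using that by auto
qed

text \<open>Comparison with an integral, carried out termwise by the mean value theorem and
  telescoping.\<close>

lemma sum_powr_tail:
  assumes x: "x > 0" and N: "N > 0"
  shows "summable (\<lambda>n. real (n + Suc N) powr (-1 - x))"
    "(\<Sum>n. real (n + Suc N) powr (-1 - x)) \<le> real N powr (-x) / x"
proof -
  have "summable (\<lambda>n. real n powr (-1 - x))" using x by (simp add: summable_real_powr_iff)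
  then show sm: "summable (\<lambda>n. real (n + Suc N) powr (-1 - x))" by (subst summable_iff_shift)
  let ?g = "\<lambda>n. real (n + N) powr (-x)"
  have "?g \<longlonglongrightarrow> 0"
    using x by real_asymp
  then have tel: "(\<lambda>n. (?g n - ?g (Suc n)) / x) sums ((?g 0 - 0) / x)"
    by (intro sums_divide telescope_sums')
  have "(\<Sum>n. real (n + Suc N) powr (-1 - x)) \<le> (?g 0 - 0) / x"
  proof (rule sums_le[OF _ summable_sums[OF sm] tel])
    fix n
    obtain c where c: "real (n + N) < c" "c < real (n + N) + 1"
      "(real (n + N) + 1) powr (-x) - real (n + N) powr (-x) = -x * c powr (-x - 1)"
      using powr_diff_mvt[of "real (n + N)" "-x"] N by auto
    have "(real (n + N) + 1) powr (-1 - x) \<le> c powr (-1 - x)"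
      using c x N by (intro powr_mono2') auto
    then have "x * (real (n + N) + 1) powr (-1 - x) \<le> x * c powr (-1 - x)"
      using x by (intro mult_left_mono) auto
    moreover have "- x - 1 = -1 - x" by simp
    moreover have "real (Suc n + N) = real (n + N) + 1" by simp
    ultimately have "x * (real (n + N) + 1) powr (-1 - x) \<le> ?g n - ?g (Suc n)"
      using c(3) by (simp only:)
    then show "real (n + Suc N) powr (-1 - x) \<le> (?g n - ?g (Suc n)) / x"
      using x by (simp add: field_simps)
  qed
  then show "(\<Sum>n. real (n + Suc N) powr (-1 - x)) \<le> real N powr (-x) / x" by simp
qed

text \<open>For \<open>x <= 1\<close> the summands decrease and the integral alone bounds them. For
  \<open>x > 1\<close> they increase, and the extra term \<open>N powr (x - 1)\<close> pays for the
  last summand.\<close>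

lemma sum_powr_upto:
  assumes x: "x > 0"
  shows "(\<Sum>n=1..N. real n powr (x - 1)) \<le> real N powr x / x + real N powr (x - 1)"
proof (cases "x \<le> 1")
  case True
  have "x * (\<Sum>n=1..N. real n powr (x - 1)) \<le> real N powr x"
  proof (induction N)
    case (Suc N)
    have "x * real (Suc N) powr (x - 1) \<le> real (Suc N) powr x - real N powr x"
    proof (cases "N = 0")
      case False
      then obtain c where c: "real N < c" "c < real N + 1"
        "(real N + 1) powr x - real N powr x = x * c powr (x - 1)"
        using powr_diff_mvt[of "real N" x] by auto
      have "(real N + 1) powr (x - 1) \<le> c powr (x - 1)"
        using c True False by (intro powr_mono2') auto
      then have "x * (real N + 1) powr (x - 1) \<le> x * c powr (x - 1)" using x by simp
      then show ?thesis using c(3) by (simp add: add.commute)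
    qed (use True in simp)
    then show ?case using Suc by (simp add: distrib_left)
  qed simp
  then have "(\<Sum>n=1..N. real n powr (x - 1)) \<le> real N powr x / x" using x by (simp add: field_simps)
  then show ?thesis by (rule order_trans) simp
next
  case False
  have "x * (\<Sum>n=1..N. real n powr (x - 1)) \<le> real N powr x + x * real N powr (x - 1)"
  proof (induction N)
    case (Suc N)
    have "x * real N powr (x - 1) \<le> real (Suc N) powr x - real N powr x"
    proof (cases "N = 0")
      case N: False
      then obtain c where c: "real N < c" "c < real N + 1"
        "(real N + 1) powr x - real N powr x = x * c powr (x - 1)"
        using powr_diff_mvt[of "real N" x] by auto
      have "real N powr (x - 1) \<le> c powr (x - 1)"
        using c False by (intro powr_mono2) auto
      then have "x * real N powr (x - 1) \<le> x * c powr (x - 1)" using x by simp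
      then show ?thesis using c(3) by (simp add: add.commute)
    qed simp
    then show ?case using Suc by (simp add: distrib_left)
  qed simp
  then show ?thesis using x by (simp add: field_simps)
qed

text \<open>The exponential is \<open>N powr z\<close>, which tends to 0 where \<open>Re z\<close>
  is negative and has norm at most 1 on the path; dominated convergence applies. Where
  \<open>Re z = 0\<close> there is no damping, and \<open>f\<close> has to vanish itself. In the
  application these are the points \<open>iR\<close> and \<open>-iR\<close>, zeros of
  \<open>1 + z^2 / R^2\<close>.\<close>

lemma contour_integral_linepath_damped_tendsto_0:
  fixes f :: "complex \<Rightarrow> complex"
  assumes f: "continuous_on (closed_segment p q) f"
    and le: "\<And>z. z \<in> closed_segment p q \<Longrightarrow> Re z \<le> 0"
    and neg: "\<And>z. z \<in> closed_segment p q \<Longrightarrow> Re z = 0 \<Longrightarrow> f z = 0"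
  shows "(\<lambda>N. contour_integral (linepath p q) (\<lambda>z. f z * exp (z * of_real (ln (real N))))) \<longlonglongrightarrow> 0"
proof -
  obtain M where M: "\<And>z. z \<in> closed_segment p q \<Longrightarrow> norm (f z) \<le> M"
    using compact_imp_bounded[OF compact_continuous_image[OF f compact_segment]]
    by (auto simp: bounded_iff)
  define g where "g N t = f (linepath p q t) * exp (linepath p q t * of_real (ln (real N))) * (q - p)" for N :: nat and t
  have seg: "linepath p q t \<in> closed_segment p q" if "t \<in> {0..1}" for t
    using that by (auto simp: linepath_def closed_segment_def)
  have "(\<lambda>N. integral {0..1} (g N)) \<longlonglongrightarrow> integral {0..1} (\<lambda>t::real. 0)"
  proof (rule dominated_convergence(2))
    show "g N integrable_on {0..1}" for N
      unfolding g_def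
      by (intro integrable_continuous_interval continuous_intros continuous_on_compose2[OF f] continuous_on_linepath)
         (use seg in auto)
    show "(\<lambda>t::real. M * norm (q - p)) integrable_on {0..1}" by (rule integrable_const_ivl)
    show "norm (g N t) \<le> M * norm (q - p)" if t: "t \<in> {0..1}" for N t
    proof -
      have "Re (linepath p q t) * ln (real N) \<le> 0"
        using le[OF seg[OF t]] by (cases "N = 0") (auto intro: mult_nonpos_nonneg)
      then have "norm (f (linepath p q t)) * exp (Re (linepath p q t) * ln (real N)) \<le> M * 1"
        using M[OF seg[OF t]] by (intro mult_mono) (auto intro: order_trans[OF norm_ge_zero])
      then show ?thesis
        unfolding g_def norm_mult by (intro mult_right_mono) auto
    qed
    show "(\<lambda>N. g N t) \<longlonglongrightarrow> 0" if t: "t \<in> {0..1}" for t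
    proof (cases "Re (linepath p q t) = 0")
      case True
      then show ?thesis using neg[OF seg[OF t]] by (simp add: g_def)
    next
      case False
      then have neg': "Re (linepath p q t) < 0" using le[OF seg[OF t]] by simp
      define x where "x = Re (linepath p q t)"
      have "(\<lambda>N. norm (f (linepath p q t)) * exp (x * ln (real N)) * norm (q - p)) \<longlonglongrightarrow> 0"
        using neg' unfolding x_def[symmetric] by real_asymp
      then show ?thesis
        by (intro tendsto_norm_zero_cancel[of "\<lambda>N. g N t"]) (simp add: g_def norm_mult x_def)
    qed
  qed
  then show ?thesis by (simp add: contour_integral_integral g_def[abs_def])
qed

text \<open>Newman's kernel: on the circle of radius $R$ it equals $2\,\mathrm{Re}\,z/R^2$.\<close>
lemma norm_newman_kernel:
  assumes "norm z = R" "R > 0"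
  shows "norm (1 / z + z / of_real (R\<^sup>2)) = 2 * \<bar>Re z\<bar> / R\<^sup>2"
proof -
  have z: "z \<noteq> 0" using assms by auto
  have "z * cnj z = of_real (R\<^sup>2)" using assms by (simp add: complex_norm_square[symmetric])
  then have "1 / z = cnj z / of_real (R\<^sup>2)" using z assms by (simp add: field_simps)
  then have "1 / z + z / of_real (R\<^sup>2) = of_real (2 * Re z / R\<^sup>2)"
    by (simp add: add_divide_distrib[symmetric] complex_eq_iff)
  then show ?thesis by (simp only: norm_of_real) (simp add: abs_mult)
qed

text \<open>The partial sum at 0 is a Cauchy integral over the full circle, since partial sums are
  entire. The integral of \<open>f z * N powr z\<close> against the same kernel over the right half
  circle is deformed into the left half plane, where it tends to 0; for this \<open>f 0 = 0\<close>
  removes the pole of the kernel at 0. What remains on the right half circle is of order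
  \<open>C / R\<close>. First \<open>N\<close> tends to infinity, then \<open>R\<close>.\<close>

lemma newman_tauberian_at_0:
  fixes a :: "nat \<Rightarrow> complex" and f :: "complex \<Rightarrow> complex"
  assumes bd: "\<And>n. norm (a n) \<le> C"
    and f: "f holomorphic_on V" and V: "open V" "{z. Re z \<ge> 0} \<subseteq> V"
    and eq: "\<And>z. Re z > 0 \<Longrightarrow> f z = dseries a (1 + z)"
    and f0: "f 0 = 0"
  shows "(\<lambda>N. \<Sum>n=1..N. a n / of_nat n) \<longlonglongrightarrow> 0"
proof -
  have C: "C \<ge> 0" using order_trans[OF norm_ge_zero bd[of 0]] .
  define S where "S N z = (\<Sum>n=1..N. a n * of_nat n powr (-1 - z))" for N and z :: complex
  have S0: "S N 0 = (\<Sum>n=1..N. a n / of_nat n)" for N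
    by (simp add: S_def powr_minus divide_inverse)
  have main: "\<exists>b. (b \<longlonglongrightarrow> 0) \<and> (\<forall>N>0. norm (S N 0) \<le> C * (2 / R + 1 / real N) + norm (b N :: complex))"
    if R: "R > 0" for R :: real
  proof -
    \<comment> \<open>A compact piece of the imaginary axis has a neighbourhood of uniform width
      \<open>\<delta>\<close> inside \<open>V\<close>. This width depends on \<open>R\<close>, which
      is why \<open>R\<close> is fixed while \<open>N\<close> grows.\<close>
    define K where "K = {z. Re z = 0 \<and> \<bar>Im z\<bar> \<le> R + 1}"
    have "compact K"
    proof -
      have "K = cbox (Complex 0 (-(R+1))) (Complex 0 (R+1))"
        by (auto simp: K_def in_cbox_complex_iff)
      then show ?thesis by simp
    qed
    moreover have "K \<subseteq> V" using V(2) by (auto simp: K_def)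
    ultimately obtain \<delta> where \<delta>: "\<delta> > 0" "(\<Union>x\<in>K. ball x \<delta>) \<subseteq> V"
      using compact_subset_open_imp_ball_epsilon_subset[of K V] V(1) by blast
    define U where "U = {z. Re z > -\<delta>} \<inter> {z. Im z < R + 1} \<inter> {z. Im z > -(R + 1)}"
    have U: "open U" "convex U"
      unfolding U_def
      by (intro open_Int open_halfspace_Re_gt open_halfspace_Im_lt open_halfspace_Im_gt
          convex_Int convex_halfspace_Re_gt convex_halfspace_Im_lt convex_halfspace_Im_gt)+
    have UV: "U \<subseteq> V"
    proof
      fix z assume z: "z \<in> U"
      show "z \<in> V"
      proof (cases "Re z \<ge> 0")
        case False
        have "dist (Complex 0 (Im z)) z = \<bar>Re z\<bar>" by (simp add: dist_norm cmod_def)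
        then have "z \<in> ball (Complex 0 (Im z)) \<delta>" using z False by (auto simp: U_def)
        moreover have "Complex 0 (Im z) \<in> K" using z by (auto simp: U_def K_def)
        ultimately show ?thesis using \<delta>(2) by blast
      qed (use V(2) in auto)
    qed
    define Q where "Q z = (if z = 0 then deriv f 0 else f z / z)" for z
    have hQ: "Q holomorphic_on U"
    proof -
      have "(\<lambda>z. if z = 0 then deriv f 0 else (f z - f 0) / (z - 0)) holomorphic_on U"
        by (rule pole_lemma_open[OF holomorphic_on_subset[OF f UV] U(1)])
      moreover have "(\<lambda>z. if z = 0 then deriv f 0 else (f z - f 0) / (z - 0)) = Q"
        by (auto simp: Q_def f0 fun_eq_iff)
      ultimately show ?thesis by simp
    qed
    define G where "G z = Q z * (1 + z\<^sup>2 / of_real (R\<^sup>2))" for z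
    define P where "P N z = exp (z * of_real (ln (real N)))" for N :: nat and z :: complex
    have hG: "G holomorphic_on U"
      unfolding G_def by (intro holomorphic_intros hQ) (use R in auto)
    define A where "A = part_circlepath 0 R (-(pi/2)) (pi/2)"
    \<comment> \<open>The left tip of the contour: the half circle is closed by the two segments
      from \<open>iR\<close> to \<open>q\<close> and from \<open>q\<close> to
      \<open>-iR\<close>.\<close>
    define q where "q = complex_of_real (-\<delta>/2)"
    define iR where "iR = \<i> * complex_of_real R"
    have R2: "of_real (R\<^sup>2) \<noteq> (0::complex)" using R by simp
    have ends: "pathstart A = -iR" "pathfinish A = iR"
      using exp_Euler[of "complex_of_real (pi/2)"] exp_Euler[of "complex_of_real (-(pi/2))"]
      by (simp_all add: A_def iR_def cos_of_real sin_of_real mult.commute)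
    have Aim: "norm z = R" "Re z \<ge> 0" "z \<in> U" if zA: "z \<in> path_image A" for z
    proof -
      obtain t where t: "t \<in> {-(pi/2)..pi/2}" "z = of_real R * cis t"
        using zA by (auto simp: A_def path_image_part_circlepath' closed_segment_eq_real_ivl split: if_splits)
      show n: "norm z = R" using t R by (simp add: norm_mult)
      show r: "Re z \<ge> 0" using t R by (auto intro!: mult_nonneg_nonneg cos_ge_zero)
      show "z \<in> U" using n r abs_Im_le_cmod[of z] \<delta>(1) by (auto simp: U_def)
    qed
    have pU: "iR \<in> U" "-iR \<in> U" "q \<in> U" using R \<delta>(1) by (auto simp: U_def iR_def q_def)
    have segU: "closed_segment iR q \<subseteq> U" "closed_segment q (-iR) \<subseteq> U"
      using pU closed_segment_subset[OF _ _ U(2)] by blast+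
    define B where "B N = contour_integral (linepath iR q) (\<lambda>z. G z * P N z)
        + contour_integral (linepath q (-iR)) (\<lambda>z. G z * P N z)" for N
    have hGP: "(\<lambda>z. G z * P N z) holomorphic_on U" for N
      unfolding P_def by (intro holomorphic_intros hG)
    have cA: "(\<lambda>z. G z * P N z) contour_integrable_on A" for N
      by (rule contour_integrable_holomorphic_simple[OF hGP U(1)]) (use Aim in \<open>auto simp: A_def\<close>)
    have cB: "(\<lambda>z. G z * P N z) contour_integrable_on linepath iR q"
             "(\<lambda>z. G z * P N z) contour_integrable_on linepath q (-iR)" for N
      by (rule contour_integrable_holomorphic_simple[OF hGP U(1)]; use segU in simp)+
    have cauchy: "contour_integral A (\<lambda>z. G z * P N z) = - B N" for N
    proof -
      let ?g = "A +++ linepath iR q +++ linepath q (-iR)"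
      have "((\<lambda>z. G z * P N z) has_contour_integral 0) ?g"
      proof (rule Cauchy_theorem_convex_simple[OF hGP U(2)])
        show "valid_path ?g" using ends by (auto intro!: valid_path_join simp: A_def)
        show "path_image ?g \<subseteq> U"
          using segU Aim(3) by (auto simp: path_image_join ends)
        show "pathfinish ?g = pathstart ?g" by (simp add: ends)
      qed
      moreover have "((\<lambda>z. G z * P N z) has_contour_integral
          contour_integral A (\<lambda>z. G z * P N z) + (contour_integral (linepath iR q) (\<lambda>z. G z * P N z)
          + contour_integral (linepath q (-iR)) (\<lambda>z. G z * P N z))) ?g"
        by (intro has_contour_integral_join has_contour_integral_integral cA cB valid_path_join)
           (simp_all add: A_def)
      ultimately have "contour_integral A (\<lambda>z. G z * P N z) + B N = 0"
        unfolding B_def by (rule has_contour_integral_unique[symmetric])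
      then show ?thesis by (simp add: eq_neg_iff_add_eq_0)
    qed
    have Blim: "B \<longlonglongrightarrow> 0"
    proof -
      have segre: "Re z \<le> 0 \<and> (Re z = 0 \<longrightarrow> z = w)"
        if z: "z \<in> closed_segment w q" and w: "Re w = 0" for z w
      proof -
        obtain t where t: "0 \<le> t" "t \<le> 1" "z = (1 - t) *\<^sub>R w + t *\<^sub>R q"
          using z by (auto simp: closed_segment_def)
        then have "Re z = - (t * \<delta>) / 2" using w by (simp add: q_def)
        then show ?thesis using t \<delta>(1) by auto
      qed
      have iR0: "Re iR = 0" "Re (-iR) = 0" "G iR = 0" "G (-iR) = 0"
        using R R2 by (simp_all add: iR_def G_def power_mult_distrib)
      have cont: "continuous_on (closed_segment iR q) G" "continuous_on (closed_segment q (-iR)) G"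
        using hG segU by (auto intro: holomorphic_on_imp_continuous_on holomorphic_on_subset)
      have "(\<lambda>N. B N) \<longlonglongrightarrow> 0 + 0"
        unfolding B_def P_def
      proof (intro tendsto_add contour_integral_linepath_damped_tendsto_0 cont)
        fix z assume "z \<in> closed_segment iR q"
        then show "Re z \<le> 0" "Re z = 0 \<Longrightarrow> G z = 0" using segre[of z iR] iR0 by auto
      next
        fix z assume "z \<in> closed_segment q (-iR)"
        then have "z \<in> closed_segment (-iR) q" by (simp add: closed_segment_commute)
        then show "Re z \<le> 0" "Re z = 0 \<Longrightarrow> G z = 0" using segre[of z "-iR"] iR0 by auto
      qed
      then show ?thesis by simp
    qed
    define T where "T N z = S N z * P N z" for N z
    have hT: "T N holomorphic_on UNIV" for N
      unfolding T_def S_def P_def by (intro holomorphic_intros) auto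
    define k where "k z = 1 / z + z / of_real (R\<^sup>2)" for z :: complex
    have kk: "T N z * k z = T N z * (1 + z\<^sup>2 / of_real (R\<^sup>2)) / z" if "z \<noteq> 0" for N z
      using that R2 by (simp add: k_def field_simps power2_eq_square)
    \<comment> \<open>The left half circle is folded onto the right one by
      \<open>z \<mapsto> -z\<close>. As the kernel is odd, \<open>k z dz\<close> is unchanged by
      this, so the fold only adds \<open>T N (-z)\<close>.\<close>
    have circ: "((\<lambda>z. T N z * k z + T N (-z) * k z) has_contour_integral 2 * of_real pi * \<i> * S N 0) A" for N
    proof -
      define W where "W t = \<i> * (T N (of_real R * cis t) * (1 + (of_real R * cis t)\<^sup>2 / of_real (R\<^sup>2)))" for t
      \<comment> \<open>\<open>circlepath\<close> starts at angle 0, whereas the half circle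
        \<open>A\<close> starts at \<open>-pi/2\<close>. The rotation by \<open>-\<i>\<close> shifts
        the parameter, so that the full circle splits into \<open>A\<close> and its
        antipode.\<close>
      define H where "H z = T N (-\<i> * z) * (1 + (-\<i> * z)\<^sup>2 / of_real (R\<^sup>2))" for z
      have "(T N \<circ> (\<lambda>z. -\<i> * z)) holomorphic_on UNIV"
        by (rule holomorphic_on_compose_gen[OF _ hT]) (auto intro!: holomorphic_intros)
      then have hH: "H holomorphic_on UNIV"
        unfolding H_def[abs_def] o_def by (intro holomorphic_intros) (use R in auto)
      have "((\<lambda>u. H u / (u - 0)) has_contour_integral 2 * of_real pi * \<i> * H 0) (circlepath 0 R)"
        using R hH by (intro Cauchy_integral_circlepath)
          (auto intro: holomorphic_on_subset holomorphic_on_imp_continuous_on)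
      then have "((\<lambda>t. H (of_real R * cis t) / (of_real R * cis t) * of_real R * \<i> * cis t) has_integral 2 * of_real pi * \<i> * H 0) {0..2 * pi}"
        unfolding circlepath_def by (subst (asm) has_contour_integral_part_circlepath_iff) auto
      moreover have "H (of_real R * cis t) / (of_real R * cis t) * of_real R * \<i> * cis t = W (t - pi / 2)" for t
      proof -
        have "cis (t - pi / 2) = -\<i> * cis t"
          by (simp add: complex_eq_iff cos_diff sin_diff)
        then have "of_real R * cis (t - pi / 2) = -\<i> * (of_real R * cis t)" by simp
        then show ?thesis unfolding W_def H_def using R by simp
      qed
      moreover have "H 0 = T N 0" by (simp add: H_def)
      ultimately have "((\<lambda>t. W (t - pi / 2)) has_integral 2 * of_real pi * \<i> * T N 0) {0..2 * pi}"
        by simp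
      then have W1: "(W has_integral 2 * of_real pi * \<i> * T N 0) {-(pi/2)..3 * pi / 2}"
        using has_integral_shift_Icc_real[of "\<lambda>t. W (t - pi / 2)" "pi / 2" _ "-(pi/2)" "3 * pi / 2"]
        by (simp add: o_def)
      have cW: "continuous_on UNIV W"
        unfolding W_def using R
        by (intro continuous_intros continuous_on_compose2[OF holomorphic_on_imp_continuous_on[OF hT]] continuous_on_cis) auto
      have W2: "(W has_integral integral {-(pi/2)..pi/2} W) {-(pi/2)..pi/2}"
               "(W has_integral integral {pi/2..3 * pi / 2} W) {pi/2..3 * pi / 2}"
        by (intro integrable_integral integrable_continuous_interval continuous_on_subset[OF cW] subset_UNIV)+
      have "(W has_integral (integral {-(pi/2)..pi/2} W + integral {pi/2..3 * pi / 2} W)) {-(pi/2)..3 * pi / 2}"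
        by (rule has_integral_combine[OF _ _ W2]) (auto simp: field_simps)
      then have tot: "integral {-(pi/2)..pi/2} W + integral {pi/2..3 * pi / 2} W = 2 * of_real pi * \<i> * T N 0"
        using W1 by (rule has_integral_unique)
      have "((\<lambda>t. W (t + pi)) has_integral integral {pi/2..3 * pi / 2} W) {-(pi/2)..pi/2}"
        using W2(2) has_integral_shift_Icc_real[of W pi _ "-(pi/2)" "pi / 2"]
        by (simp add: o_def add.commute)
      then have "((\<lambda>t. W t + W (t + pi)) has_integral 2 * of_real pi * \<i> * T N 0) {-(pi/2)..pi/2}"
        unfolding tot[symmetric] by (intro has_integral_add W2)
      moreover have "W t + W (t + pi) = (T N (0 + of_real R * cis t) * k (0 + of_real R * cis t)
            + T N (- (0 + of_real R * cis t)) * k (0 + of_real R * cis t)) * of_real R * \<i> * cis t" for t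
      proof -
        have "cis (t + pi) = - cis t" by (simp add: complex_eq_iff)
        then have "of_real R * cis (t + pi) = - (of_real R * cis t)" by simp
        then show ?thesis unfolding W_def k_def using R
          by (simp add: field_simps power2_eq_square)
      qed
      moreover have "T N 0 = S N 0" by (simp add: T_def P_def)
      ultimately show ?thesis
        unfolding A_def by (subst has_contour_integral_part_circlepath_iff) auto
    qed
    \<comment> \<open>Both the tail of the series and the reflected partial sum cost a factor
      \<open>1 / x\<close> with \<open>x = Re z\<close>; the kernel has norm
      \<open>2 * x / R^2\<close> and cancels it. The two points with \<open>x = 0\<close> are left
      out.\<close>
    have bound: "norm ((T N z * k z + T N (-z) * k z) - G z * P N z) \<le> C * (4 / R\<^sup>2 + 2 / (R * real N))"
      if z: "z \<in> path_image A - {iR, -iR}" and N: "N > 0" for N z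
    proof -
      define x where "x = Re z"
      have nz: "norm z = R" "x \<ge> 0" using Aim[of z] z by (auto simp: x_def)
      have "x \<noteq> 0"
      proof
        assume "x = 0"
        then have "\<bar>Im z\<bar> = R" using nz by (simp add: x_def cmod_def)
        then have "z = iR \<or> z = -iR" using \<open>x = 0\<close> by (auto simp: x_def iR_def complex_eq_iff abs_if split: if_splits)
        then show False using z by auto
      qed
      then have x: "x > 0" "x \<le> R" using nz abs_Re_le_cmod[of z] by (auto simp: x_def)
      have z0: "z \<noteq> 0" using x by (auto simp: x_def)
      have nP: "norm (P N z) = real N powr x" "norm (P N (-z)) = real N powr (-x)"
        using N by (simp_all add: P_def x_def powr_def)
      have "G z = f z * k z"
        using z0 R2 by (simp add: G_def Q_def k_def field_simps power2_eq_square)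
      then have expr: "(T N z * k z + T N (-z) * k z) - G z * P N z
          = k z * (S N (-z) * P N (-z) - (f z - S N z) * P N z)"
        by (simp add: T_def algebra_simps)
      have r: "norm (f z - S N z) \<le> C * (real N powr (-x) / x)"
      proof -
        let ?t = "\<lambda>n. a n * of_nat n powr (-(1 + z))"
        have ds: "dsummable a (1 + z)" by (rule dsummable_bounded[OF bd]) (use x in \<open>simp add: x_def\<close>)
        then have sm: "summable ?t" unfolding dsummable_def by (rule summable_norm_cancel)
        have "f z = suminf ?t" using eq[of z] x by (simp add: x_def dseries_def)
        also have "\<dots> = (\<Sum>n. ?t (n + Suc N)) + (\<Sum>n<Suc N. ?t n)"
          by (rule suminf_split_initial_segment[OF sm])
        also have "(\<Sum>n<Suc N. ?t n) = S N z"
          unfolding S_def by (intro sum.mono_neutral_cong_right) (auto simp: Suc_le_eq less_Suc_eq_le)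
        finally have "f z - S N z = (\<Sum>n. ?t (n + Suc N))" by simp
        also have "norm \<dots> \<le> (\<Sum>n. C * real (n + Suc N) powr (-1 - x))"
        proof (rule suminf_norm_le_real)
          show "norm (?t (n + Suc N)) \<le> C * real (n + Suc N) powr (-1 - x)" for n
            unfolding norm_mult norm_of_nat_powr using bd C by (intro mult_mono) (auto simp: x_def)
          show "summable (\<lambda>n. C * real (n + Suc N) powr (-1 - x))"
            by (intro summable_mult sum_powr_tail x N)
        qed
        also have "\<dots> = C * (\<Sum>n. real (n + Suc N) powr (-1 - x))"
          by (intro suminf_mult sum_powr_tail x N)
        also have "\<dots> \<le> C * (real N powr (-x) / x)"
          by (intro mult_left_mono sum_powr_tail x N C)
        finally show ?thesis .
      qed
      have s: "norm (S N (-z)) \<le> C * (real N powr x / x + real N powr (x - 1))"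
      proof -
        have "norm (S N (-z)) \<le> (\<Sum>n=1..N. C * real n powr (x - 1))"
          unfolding S_def
        proof (rule sum_norm_le)
          fix n show "norm (a n * of_nat n powr (- 1 - - z)) \<le> C * real n powr (x - 1)"
            unfolding norm_mult norm_of_nat_powr using bd C by (intro mult_mono) (auto simp: x_def)
        qed
        also have "\<dots> \<le> C * (real N powr x / x + real N powr (x - 1))"
          unfolding sum_distrib_left[symmetric] by (intro mult_left_mono sum_powr_upto x C)
        finally show ?thesis .
      qed
      have pw: "real N powr x * real N powr (-x) = 1" "real N powr (x - 1) * real N powr (-x) = 1 / real N"
        using N by (simp_all only: powr_add[symmetric]) (simp_all add: powr_minus_divide)
      have "norm (S N (-z) * P N (-z)) \<le> C * (real N powr x / x + real N powr (x - 1)) * real N powr (-x)"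
        unfolding norm_mult nP by (intro mult_right_mono s) auto
      also have "\<dots> = C * (real N powr x * real N powr (-x) / x + real N powr (x - 1) * real N powr (-x))"
        by (simp add: algebra_simps)
      also have "\<dots> = C * (1 / x + 1 / real N)" unfolding pw ..
      finally have b1: "norm (S N (-z) * P N (-z)) \<le> C * (1 / x + 1 / real N)" .
      have "norm ((f z - S N z) * P N z) \<le> C * (real N powr (-x) / x) * real N powr x"
        unfolding norm_mult nP by (intro mult_right_mono r) auto
      also have "\<dots> = C * (real N powr x * real N powr (-x) / x)" by simp
      also have "\<dots> = C * (1 / x)" unfolding pw ..
      finally have b2: "norm ((f z - S N z) * P N z) \<le> C * (1 / x)" .
      have nk: "norm (k z) = 2 * x / R\<^sup>2"
        unfolding k_def using norm_newman_kernel[OF nz(1) R] x by (simp add: x_def)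
      have "norm (S N (-z) * P N (-z) - (f z - S N z) * P N z) \<le> C * (1 / x + 1 / real N) + C * (1 / x)"
        using norm_triangle_ineq4[of "S N (-z) * P N (-z)" "(f z - S N z) * P N z"] b1 b2 by linarith
      then have "norm ((T N z * k z + T N (-z) * k z) - G z * P N z) \<le> (2 * x / R\<^sup>2) * (C * (1 / x + 1 / real N) + C * (1 / x))"
        unfolding expr norm_mult nk using x by (intro mult_left_mono) auto
      also have "\<dots> = C * (4 / R\<^sup>2 + 2 * x / (R\<^sup>2 * real N))"
        using x N R by (simp add: field_simps)
      also have "\<dots> \<le> C * (4 / R\<^sup>2 + 2 * R / (R\<^sup>2 * real N))"
        using x N R C by (intro mult_left_mono add_left_mono divide_right_mono) auto
      also have "\<dots> = C * (4 / R\<^sup>2 + 2 / (R * real N))"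
        using R by (simp add: power2_eq_square)
      finally show ?thesis .
    qed
    have fin: "norm (S N 0) \<le> C * (2 / R + 1 / real N) + norm (B N / (2 * of_real pi * \<i>))" if N: "N > 0" for N
    proof -
      have "((\<lambda>z. (T N z * k z + T N (-z) * k z) - G z * P N z) has_contour_integral
          (2 * of_real pi * \<i> * S N 0 - (- B N))) A"
        using has_contour_integral_diff[OF circ has_contour_integral_integral[OF cA[of N]]]
        by (simp only: cauchy)
      then have "norm (2 * of_real pi * \<i> * S N 0 - (- B N)) \<le> C * (4 / R\<^sup>2 + 2 / (R * real N)) * R * (pi/2 - (-(pi/2)))"
        unfolding A_def
        by (rule has_contour_integral_bound_part_circlepath_strong[where k = "{iR, -iR}"])
           (use R C N bound in \<open>auto simp: A_def[symmetric]\<close>)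
      also have "\<dots> = 2 * pi * (C * (2 / R + 1 / real N))"
        using R N by (simp add: field_simps power2_eq_square)
      finally have "norm (2 * of_real pi * \<i> * S N 0 + B N) \<le> 2 * pi * (C * (2 / R + 1 / real N))" by simp
      moreover have "norm (2 * of_real pi * \<i> * S N 0) \<le> norm (2 * of_real pi * \<i> * S N 0 + B N) + norm (B N)"
        by (metis add_diff_cancel_right' norm_triangle_ineq4)
      ultimately have "2 * pi * norm (S N 0) \<le> 2 * pi * (C * (2 / R + 1 / real N)) + norm (B N)"
        by (simp add: norm_mult)
      then show ?thesis by (simp add: norm_mult norm_divide field_simps)
    qed
    have "(\<lambda>N. B N / (2 * of_real pi * \<i>)) \<longlonglongrightarrow> 0"
      using tendsto_divide[OF Blim tendsto_const, of "2 * of_real pi * \<i>"] by simp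
    then show ?thesis using fin by blast
  qed
  have "(\<lambda>N. S N 0) \<longlonglongrightarrow> 0"
  proof (rule LIMSEQ_I)
    fix e :: real assume e: "e > 0"
    \<comment> \<open>Makes \<open>C * (2 / R)\<close> at most \<open>e / 2\<close>;
      \<open>C + 1\<close> keeps \<open>R\<close> positive when \<open>C = 0\<close>.\<close>
    define R where "R = 4 * (C + 1) / e"
    have R: "R > 0" using e C by (simp add: R_def)
    obtain b where b: "b \<longlonglongrightarrow> (0::complex)" "\<forall>N>0. norm (S N 0) \<le> C * (2 / R + 1 / real N) + norm (b N)"
      using main[OF R] by blast
    have "(\<lambda>N. C * (2 / R + 1 / real N) + norm (b N)) \<longlonglongrightarrow> C * (2 / R + 0) + norm (0::complex)"
      by (intro tendsto_intros b lim_1_over_n)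
    moreover have "C * (2 / R + 0) + norm (0::complex) < e"
    proof -
      have *: "C * (2 / (4 * D / e)) = (C / D) * (e / 2)" if "D > 0" for D
        using that e by (simp add: field_simps)
      have "C * (2 / R) = (C / (C + 1)) * (e / 2)" unfolding R_def by (rule *) (use C in simp)
      also have "\<dots> \<le> 1 * (e / 2)" using C e by (intro mult_right_mono) auto
      finally show ?thesis using e by simp
    qed
    ultimately have "eventually (\<lambda>N. C * (2 / R + 1 / real N) + norm (b N) < e) sequentially"
      by (rule order_tendstoD)
    then have "eventually (\<lambda>N. norm (S N 0 - 0) < e) sequentially"
      using eventually_gt_at_top[of 0]
    proof eventually_elim
      case (elim N)
      then have "norm (S N 0) < e" using b(2) by (meson le_less_trans)
      then show ?case by (simp only: diff_zero)
    qed
    then show "\<exists>no. \<forall>n\<ge>no. norm (S n 0 - 0) < e" by (simp add: eventually_sequentially)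
  qed
  then show ?thesis by (simp add: S0)
qed

theorem newman_tauberian:
  fixes a :: "nat \<Rightarrow> complex" and F :: "complex \<Rightarrow> complex"
  assumes bd: "\<And>n. norm (a n) \<le> C"
    and F: "F holomorphic_on V" and V: "open V" "{s. Re s \<ge> 1} \<subseteq> V"
    and eq: "\<And>s. Re s > 1 \<Longrightarrow> F s = dseries a s"
  shows "(\<lambda>N. \<Sum>n=1..N. a n / of_nat n) \<longlonglongrightarrow> F 1"
proof -
  \<comment> \<open>Changing the coefficient at 1 shifts the series by the constant
    \<open>F 1\<close>, which normalises its value at \<open>s = 1\<close> to 0.\<close>
  define b where "b n = a n - (if n = 1 then F 1 else 0)" for n
  have C: "C \<ge> 0" using order_trans[OF norm_ge_zero bd[of 0]] .
  have "(\<lambda>N. \<Sum>n=1..N. b n / of_nat n) \<longlonglongrightarrow> 0"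
  proof (rule newman_tauberian_at_0[where f = "\<lambda>z. F (1 + z) - F 1" and V = "(\<lambda>z. 1 + z) -` V" and C = "C + norm (F 1)"])
    show "norm (b n) \<le> C + norm (F 1)" for n
      using norm_triangle_ineq4[of "a n" "F 1"] bd[of n] by (auto simp: b_def add_increasing2)
    have "(F \<circ> (\<lambda>z. 1 + z)) holomorphic_on ((\<lambda>z. 1 + z) -` V)"
      by (rule holomorphic_on_compose_gen[OF _ F]) (auto intro!: holomorphic_intros)
    then show "(\<lambda>z. F (1 + z) - F 1) holomorphic_on ((\<lambda>z. 1 + z) -` V)"
      by (intro holomorphic_intros) (simp add: o_def)
    show "open ((\<lambda>z. 1 + z) -` V)"
      by (intro open_vimage V continuous_intros)
    show "{z. Re z \<ge> 0} \<subseteq> (\<lambda>z. 1 + z) -` V" by (auto intro!: subsetD[OF V(2)])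
    show "F (1 + z) - F 1 = dseries b (1 + z)" if "Re z > 0" for z
    proof -
      have "dsummable a (1 + z)" by (rule dsummable_bounded[OF bd]) (use that in simp)
      then have "(\<lambda>n. a n * of_nat n powr (-(1 + z))) sums dseries a (1 + z)"
        unfolding dsummable_def dseries_def by (rule summable_sums[OF summable_norm_cancel])
      moreover have "(\<lambda>n. if n = 1 then F 1 * of_nat n powr (-(1 + z)) else 0) sums (F 1 * of_nat 1 powr (-(1 + z)))"
        by (rule sums_single)
      ultimately have "(\<lambda>n. a n * of_nat n powr (-(1 + z)) - (if n = 1 then F 1 * of_nat n powr (-(1 + z)) else 0))
          sums (dseries a (1 + z) - F 1 * of_nat 1 powr (-(1 + z)))"
        by (rule sums_diff)
      moreover have "(\<lambda>n. a n * of_nat n powr (-(1 + z)) - (if n = 1 then F 1 * of_nat n powr (-(1 + z)) else 0))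
          = (\<lambda>n. b n * of_nat n powr (-(1 + z)))"
        by (auto simp: b_def fun_eq_iff)
      ultimately have "dseries b (1 + z) = dseries a (1 + z) - F 1 * of_nat 1 powr (-(1 + z))"
        unfolding dseries_def by (simp add: sums_iff)
      then show ?thesis using eq[of "1 + z"] that by simp
    qed
  qed simp
  then have "(\<lambda>N. (\<Sum>n=1..N. b n / of_nat n) + F 1) \<longlonglongrightarrow> 0 + F 1"
    by (intro tendsto_intros)
  moreover have "eventually (\<lambda>N. (\<Sum>n=1..N. b n / of_nat n) + F 1 = (\<Sum>n=1..N. a n / of_nat n)) sequentially"
    using eventually_ge_at_top[of 1]
  proof eventually_elim
    case (elim N)
    have "(\<Sum>n=1..N. b n / of_nat n) = (\<Sum>n=1..N. a n / of_nat n - (if n = 1 then F 1 else 0))"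
      by (intro sum.cong) (auto simp: b_def diff_divide_distrib)
    also have "\<dots> = (\<Sum>n=1..N. a n / of_nat n) - F 1"
      using elim by (simp add: sum_subtractf)
    finally show ?case by simp
  qed
  ultimately show ?thesis by (simp add: Lim_transform_eventually)
qed

section \<open>Mean values of characters over the primes\<close>

lemma cesaro_mean_tendsto:
  fixes A :: "nat \<Rightarrow> complex"
  assumes "A \<longlonglongrightarrow> L"
  shows "(\<lambda>N. (\<Sum>n<N. A n) / of_nat N) \<longlonglongrightarrow> L"
proof (rule LIMSEQ_I)
  fix e :: real assume e: "e > 0"
  obtain M where M: "\<And>n. n \<ge> M \<Longrightarrow> norm (A n - L) < e / 2"
    using LIMSEQ_D[OF assms, of "e / 2"] e by auto
  define K where "K = (\<Sum>n<M. norm (A n - L))"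
  have K: "K \<ge> 0" unfolding K_def by (intro sum_nonneg) auto
  obtain N0 :: nat where N0: "real N0 > 2 * K / e" using reals_Archimedean2 by blast
  show "\<exists>no. \<forall>N\<ge>no. norm ((\<Sum>n<N. A n) / of_nat N - L) < e"
  proof (intro exI[of _ "Suc (max N0 M)"] allI impI)
    fix N assume N: "N \<ge> Suc (max N0 M)"
    have "(\<Sum>n<N. A n) / of_nat N - L = (\<Sum>n<N. A n - L) / of_nat N"
      using N by (simp add: sum_subtractf diff_divide_distrib)
    also have "norm \<dots> = norm (\<Sum>n<N. A n - L) / real N" by (simp add: norm_divide)
    also have "norm (\<Sum>n<N. A n - L) \<le> (\<Sum>n<N. norm (A n - L))" by (rule norm_sum)
    also have "(\<Sum>n<N. norm (A n - L)) = K + (\<Sum>n\<in>{M..<N}. norm (A n - L))"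
      unfolding K_def using N by (subst sum.union_disjoint[symmetric]) (auto intro!: sum.cong)
    also have "(\<Sum>n\<in>{M..<N}. norm (A n - L)) \<le> (\<Sum>n\<in>{M..<N}. e / 2)"
      using M by (intro sum_mono) (auto intro: less_imp_le)
    also have "K + (\<Sum>n\<in>{M..<N}. e / 2) \<le> K + real N * (e / 2)"
      using e by (simp add: mult_right_mono)
    also have "(K + real N * (e / 2)) / real N < e"
    proof -
      have "2 * K / e < real N" using N0 N by linarith
      then have "2 * K < e * real N" using e by (simp add: field_simps)
      then show ?thesis using N by (simp add: field_simps)
    qed
    finally show "norm ((\<Sum>n<N. A n) / of_nat N - L) < e"
      by (simp add: divide_right_mono)
  qed
qed

text \<open>Abel summation writes the mean as the partial sum of \<open>a n / n\<close> minus the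
  Cesaro mean of these partial sums; both tend to \<open>L\<close>.\<close>

lemma kronecker_mean_tendsto_0:
  fixes a :: "nat \<Rightarrow> complex"
  assumes "(\<lambda>N. \<Sum>n=1..N. a n / of_nat n) \<longlonglongrightarrow> L"
  shows "(\<lambda>N. (\<Sum>n=1..N. a n) / of_nat N) \<longlonglongrightarrow> 0"
proof -
  define A where "A N = (\<Sum>n=1..N. a n / of_nat n)" for N
  have abel: "(\<Sum>n=1..N. a n) = of_nat N * A N - (\<Sum>n<N. A n)" for N
  proof (induction N)
    case (Suc N)
    have "A (Suc N) = A N + a (Suc N) / of_nat (Suc N)" by (simp add: A_def)
    then have "of_nat (Suc N) * A (Suc N) = of_nat (Suc N) * A N + a (Suc N)"
      by (simp add: distrib_left del: of_nat_Suc)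
    then show ?case using Suc by (simp add: algebra_simps)
  qed (simp add: A_def)
  have "(\<lambda>N. A N - (\<Sum>n<N. A n) / of_nat N) \<longlonglongrightarrow> L - L"
    using assms unfolding A_def[symmetric] by (intro tendsto_intros cesaro_mean_tendsto)
  moreover have "eventually (\<lambda>N. A N - (\<Sum>n<N. A n) / of_nat N = (\<Sum>n=1..N. a n) / of_nat N) sequentially"
    using eventually_gt_at_top[of 0]
    by eventually_elim (simp add: abel[unfolded One_nat_def] diff_divide_distrib)
  ultimately show ?thesis by (simp add: Lim_transform_eventually)
qed

text \<open>By nonvanishing, \<open>1 / lfun m \<psi>\<close> is holomorphic on a neighbourhood of
  the closed half plane, so the series of \<open>\<psi> n * moebius n / n\<close> converges by
  Newman; convergence to any limit forces the mean to vanish.\<close>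

theorem moebius_character_mean_tendsto_0:
  assumes \<psi>: "nonprincipal_character m \<psi>"
  shows "(\<lambda>N. (\<Sum>n=1..N. \<psi> n * of_int (moebius n)) / of_nat N) \<longlonglongrightarrow> 0"
proof (rule kronecker_mean_tendsto_0)
  have *: "completely_multiplicative \<psi>" "zero_mean_periodic m \<psi>" "\<And>n. norm (\<psi> n) \<le> 1"
    using \<psi> by (auto simp: nonprincipal_character_def) (metis norm_zero order_refl zero_le_one)
  let ?V = "{s. Re s > 0} \<inter> {s. lfun m \<psi> s \<noteq> 0}"
  have hol: "lfun m \<psi> holomorphic_on {s. Re s > 0}" by (rule lfun_holomorphic[OF *(2)])
  have "open ({s. Re s > 0} \<inter> lfun m \<psi> -` (-{0}))"
    by (rule continuous_open_preimage[OF holomorphic_on_imp_continuous_on[OF hol] open_halfspace_Re_gt]) auto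
  then have V: "open ?V" by (simp add: vimage_def Collect_neg_eq[symmetric])
  show "(\<lambda>N. \<Sum>n=1..N. \<psi> n * of_int (moebius n) / of_nat n) \<longlonglongrightarrow> 1 / lfun m \<psi> 1"
  proof (rule newman_tauberian[OF _ _ V, where C = 1 and F = "\<lambda>s. 1 / lfun m \<psi> s"])
    show "norm (\<psi> n * of_int (moebius n)) \<le> 1" for n
      using *(3)[of n] abs_moebius_le_1[of n] by (auto simp: norm_mult abs_le_iff intro!: mult_le_one)
    show "(\<lambda>s. 1 / lfun m \<psi> s) holomorphic_on ?V"
      by (intro holomorphic_intros holomorphic_on_subset[OF hol]) auto
    show "{s. Re s \<ge> 1} \<subseteq> ?V" using lfun_nonzero[OF \<psi>] by auto
    show "1 / lfun m \<psi> s = dseries (\<lambda>n. \<psi> n * of_int (moebius n)) s" if "Re s > 1" for s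
    proof -
      have "dseries (\<lambda>n. \<psi> n * of_int (moebius n)) s * lfun m \<psi> s = 1"
        using dseries_moebius_mult[OF *(1,3) that] lfun_eq_dseries[OF *(2) that] by simp
      moreover have "lfun m \<psi> s \<noteq> 0" using lfun_nonzero[OF \<psi>] that by auto
      ultimately show ?thesis by (simp add: field_simps)
    qed
  qed
qed

lemma sum_dconv:
  "(\<Sum>n=1..N. dconv u v n) = (\<Sum>a=1..N. u a * (\<Sum>b=1..N div a. v b))"
proof -
  have "(\<Sum>n=1..N. dconv u v n) = (\<Sum>n=1..N. \<Sum>p\<in>{(a, b). a * b = n}. u (fst p) * v (snd p))"
    by (intro sum.cong refl) (simp add: dconv_pairs case_prod_unfold)
  also have "\<dots> = (\<Sum>x\<in>(SIGMA n:{1..N}. {(a, b). a * b = n}). u (fst (snd x)) * v (snd (snd x)))"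
    by (subst sum.Sigma) (auto intro!: finite_factor_pairs sum.cong)
  also have "\<dots> = (\<Sum>x\<in>(SIGMA a:{1..N}. {1..N div a}). u (fst x) * v (snd x))"
  proof (rule sum.reindex_bij_witness[of _ "\<lambda>(a, b). (a * b, (a, b))" snd])
    fix x assume "x \<in> (SIGMA n:{1..N}. {(a, b). a * b = n})"
    then obtain a b where x: "x = (a * b, (a, b))" "1 \<le> a * b" "a * b \<le> N" by auto
    then have pos: "a \<ge> 1" "b \<ge> 1" by (auto simp: Suc_le_eq)
    then have "a \<le> N" using x(3) by (metis le_trans mult.right_neutral mult_le_mono2)
    then show "snd x \<in> (SIGMA a:{1..N}. {1..N div a})"
      using x pos by (auto simp: less_eq_div_iff_mult_less_eq mult.commute)
    show "(case snd x of (a, b) \<Rightarrow> (a * b, (a, b))) = x" using x by simp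
  next
    fix y assume y: "y \<in> (SIGMA a:{1..N}. {1..N div a})"
    obtain a b where ab: "y = (a, b)" by force
    then have "1 \<le> a" "1 \<le> b" "a * b \<le> N"
      using y by (auto simp: less_eq_div_iff_mult_less_eq mult.commute)
    then show "(case y of (a, b) \<Rightarrow> (a * b, (a, b))) \<in> (SIGMA n:{1..N}. {(a, b). a * b = n})"
      using ab by (auto simp: Suc_le_eq)
    show "snd (case y of (a, b) \<Rightarrow> (a * b, a, b)) = y" using ab by simp
  qed auto
  also have "\<dots> = (\<Sum>a=1..N. u a * (\<Sum>b=1..N div a. v b))"
    by (simp add: sum_distrib_left sum.Sigma case_prod_unfold)
  finally show ?thesis .
qed

lemma mangoldt_character_eq_dconv:
  assumes f: "completely_multiplicative f" and n: "n > 0"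
  shows "dconv (\<lambda>n. f n * of_int (moebius n)) (\<lambda>n. f n * ln (real n)) n = f n * mangoldt n"
proof -
  have "dconv (\<lambda>n. f n * of_int (moebius n)) (\<lambda>n. f n * ln (real n)) n
      = dconv (\<lambda>n. f n * of_int (moebius n)) (dconv f (\<lambda>n. f n * mangoldt n)) n"
    by (intro dconv_cong) (simp_all add: dconv_mangoldt_completely_multiplicative[OF f])
  also have "\<dots> = dconv (dconv (\<lambda>n. f n * of_int (moebius n)) f) (\<lambda>n. f n * mangoldt n) n"
    by (rule dconv_assoc[symmetric])
  also have "\<dots> = dconv (\<lambda>n. if n = 1 then 1 else 0) (\<lambda>n. f n * mangoldt n) n"
    by (intro dconv_cong dconv_moebius_completely_multiplicative f) auto
  also have "\<dots> = f n * mangoldt n" by (rule dconv_delta_left[OF n])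
  finally show ?thesis .
qed

text \<open>Abel summation; since \<open>v\<close> increases, its total variation telescopes to
  \<open>v N - v 1\<close>.\<close>

lemma norm_abel_sum_le:
  fixes c :: "nat \<Rightarrow> complex" and v D :: "nat \<Rightarrow> real"
  assumes v: "\<And>n. 1 \<le> n \<Longrightarrow> v n \<le> v (Suc n)" and v1: "v 1 \<ge> 0"
    and D: "\<And>n. n \<le> N \<Longrightarrow> norm (\<Sum>i=1..n. c i) \<le> B"
    and B: "B \<ge> 0" and N: "N \<ge> 1"
  shows "norm (\<Sum>n=1..N. c n * of_real (v n)) \<le> 2 * B * v N"
proof -
  have False: "N \<noteq> 0" using N by simp
  define S where "S n = (\<Sum>i=1..n. c i)" for n
  have abel: "(\<Sum>n=1..N. c n * of_real (v n)) = S N * of_real (v N) - (\<Sum>n=1..<N. S n * of_real (v (Suc n) - v n))"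
    if "N \<ge> 1" for N
    using that
  proof (induction N rule: dec_induct)
    case (step n)
    have "S (Suc n) = S n + c (Suc n)" by (simp add: S_def)
    then show ?case using step by (simp add: algebra_simps)
  qed (simp add: S_def)
  have tel: "(\<Sum>n=1..<N. v (Suc n) - v n) = v N - v 1"
    using False by (intro sum_Suc_diff') simp
  have mono: "v 1 \<le> v N" using False
  proof (induction N)
    case (Suc n)
    then show ?case using v[of n] by (cases "n = 0") auto
  qed simp
  have "norm (\<Sum>n=1..N. c n * of_real (v n)) \<le> norm (S N * of_real (v N)) + norm (\<Sum>n=1..<N. S n * of_real (v (Suc n) - v n))"
    using False by (subst abel) (auto intro: norm_triangle_ineq4)
  also have "norm (S N * of_real (v N)) \<le> B * v N"
    using D[of N] mono v1 by (auto simp: norm_mult S_def intro!: mult_right_mono)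
  also have "norm (\<Sum>n=1..<N. S n * of_real (v (Suc n) - v n)) \<le> (\<Sum>n=1..<N. B * (v (Suc n) - v n))"
  proof (rule sum_norm_le)
    fix n assume n: "n \<in> {1..<N}"
    then show "norm (S n * of_real (v (Suc n) - v n)) \<le> B * (v (Suc n) - v n)"
      unfolding norm_mult norm_of_real using D[of n] v[of n] by (auto simp: S_def intro!: mult_right_mono)
  qed
  also have "\<dots> = B * (v N - v 1)" unfolding sum_distrib_left[symmetric] tel ..
  also have "B * v N + B * (v N - v 1) \<le> 2 * B * v N"
    using mult_nonneg_nonneg[OF B v1] by (simp add: algebra_simps)
  finally show ?thesis by simp
qed

lemma nonprincipal_characterD:
  assumes "nonprincipal_character m \<psi>"
  shows "completely_multiplicative \<psi>" "zero_mean_periodic m \<psi>" "norm (\<psi> n) \<le> 1"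
    "\<psi> n = 0 \<or> norm (\<psi> n) = 1"
  using assms by (auto simp: nonprincipal_character_def) (metis norm_zero order_refl zero_le_one)

text \<open>Complete periods cancel, and fewer than \<open>m\<close> terms of norm at most 1
  remain.\<close>

lemma norm_sum_nonprincipal_character_le:
  assumes \<psi>: "nonprincipal_character m \<psi>"
  shows "norm (\<Sum>n=1..N. \<psi> n) \<le> real m"
proof -
  note c = nonprincipal_characterD[OF \<psi>]
  have m: "m > 0" using c(2) by (simp add: zero_mean_periodic_def)
  have block: "(\<Sum>n=k * m + 1..k * m + j. \<psi> n) = (\<Sum>i=1..j. \<psi> i)" for k j
  proof (rule sum.reindex_bij_witness[of _ "\<lambda>i. k * m + i" "\<lambda>n. n - k * m"])
    fix n assume "n \<in> {k * m + 1..k * m + j}"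
    then show "\<psi> (n - k * m) = \<psi> n"
      using zero_mean_periodic_mult[OF c(2), of k "n - k * m"] by simp
  qed auto
  have zero: "(\<Sum>n=1..k * m. \<psi> n) = 0" for k
  proof (induction k)
    case (Suc k)
    have "(\<Sum>n=1..Suc k * m. \<psi> n) = (\<Sum>n=1..k * m + m. \<psi> n)" by (simp add: add.commute)
    also have "\<dots> = (\<Sum>n=1..k * m. \<psi> n) + (\<Sum>n=k * m + 1..k * m + m. \<psi> n)"
      by (rule sum.ub_add_nat) simp
    also have "\<dots> = 0" using Suc block[of k m] c(2) by (simp add: zero_mean_periodic_def)
    finally show ?case .
  qed simp
  have "(\<Sum>n=1..N. \<psi> n) = (\<Sum>n=1..(N div m) * m + N mod m. \<psi> n)" by simp
  also have "\<dots> = (\<Sum>n=1..(N div m) * m. \<psi> n) + (\<Sum>n=(N div m) * m + 1..(N div m) * m + N mod m. \<psi> n)"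
    by (rule sum.ub_add_nat) simp
  also have "\<dots> = (\<Sum>i=1..N mod m. \<psi> i)" unfolding zero block by simp
  also have "norm \<dots> \<le> (\<Sum>i=1..N mod m. 1)" by (rule sum_norm_le) (rule c(3))
  also have "\<dots> \<le> real m" using m by (simp add: less_imp_le)
  finally show ?thesis .
qed

lemma norm_sum_character_ln_le:
  assumes \<psi>: "nonprincipal_character m \<psi>" and N: "N \<ge> 1"
  shows "norm (\<Sum>n=1..N. \<psi> n * of_real (ln (real n))) \<le> 2 * real m * ln (real N)"
  by (rule norm_abel_sum_le) (use norm_sum_nonprincipal_character_le[OF \<psi>] N in auto)

text \<open>The hyperbola method with a fixed cut-off $k$: the factors $b \le k$ are handled by the
  mean value of $\mu\psi$, the others by the logarithmic bound for partial sums of $\psi\log$.\<close>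
lemma norm_sum_mangoldt_character_le:
  assumes \<psi>: "nonprincipal_character m \<psi>" and k: "k \<ge> 1" and N: "N \<ge> 1"
  shows "norm (\<Sum>n=1..N. \<psi> n * mangoldt n) \<le>
    (\<Sum>b=1..k. ln (real b) * norm (\<Sum>a=1..N div b. \<psi> a * of_int (moebius a))) + 24 * real m * real N / sqrt (real k)"
proof -
  note c = nonprincipal_characterD[OF \<psi>]
  define u where "u a = \<psi> a * of_int (moebius a)" for a
  define v where "v b = \<psi> b * complex_of_real (ln (real b))" for b
  define B where "B y = (\<Sum>b=1..y. v b)" for y
  have u1: "norm (u a) \<le> 1" for a
    using c(3)[of a] abs_moebius_le_1[of a] by (auto simp: u_def norm_mult abs_le_iff intro!: mult_le_one)
  have Bb: "norm (B y) \<le> 2 * real m * ln (real y)" if "y \<ge> 1" for y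
    unfolding B_def v_def by (rule norm_sum_character_ln_le[OF \<psi> that])
  have "(\<Sum>n=1..N. \<psi> n * mangoldt n) = (\<Sum>n=1..N. dconv u v n)"
    unfolding u_def[abs_def] v_def[abs_def]
    by (intro sum.cong refl mangoldt_character_eq_dconv[symmetric] c(1)) auto
  also have "\<dots> = (\<Sum>a=1..N. u a * B (N div a))"
    unfolding sum_dconv B_def ..
  also have "\<dots> = (\<Sum>a=1..N. u a * B (min k (N div a))) + (\<Sum>a=1..N. u a * (B (N div a) - B (min k (N div a))))"
    by (simp add: sum.distrib[symmetric] algebra_simps)
  finally have eq: "(\<Sum>n=1..N. \<psi> n * mangoldt n) = (\<Sum>a=1..N. u a * B (min k (N div a))) + (\<Sum>a=1..N. u a * (B (N div a) - B (min k (N div a))))" .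
  have "norm (\<Sum>n=1..N. \<psi> n * mangoldt n) \<le> norm (\<Sum>a=1..N. u a * B (min k (N div a))) + norm (\<Sum>a=1..N. u a * (B (N div a) - B (min k (N div a))))"
    unfolding eq by (rule norm_triangle_ineq)
  also have "norm (\<Sum>a=1..N. u a * B (min k (N div a))) \<le> (\<Sum>b=1..k. ln (real b) * norm (\<Sum>a=1..N div b. u a))"
  proof -
    have "(\<Sum>a=1..N. u a * B (min k (N div a))) = (\<Sum>a=1..N. \<Sum>b=1..k. if b \<le> N div a then u a * v b else 0)"
    proof (intro sum.cong refl)
      fix a
      have "{1..min k (N div a)} = {b\<in>{1..k}. b \<le> N div a}" by auto
      then show "u a * B (min k (N div a)) = (\<Sum>b=1..k. if b \<le> N div a then u a * v b else 0)"
        unfolding B_def sum_distrib_left by (simp only:) (rule sum.inter_filter, simp)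
    qed
    also have "\<dots> = (\<Sum>b=1..k. \<Sum>a=1..N. if b \<le> N div a then u a * v b else 0)" by (rule sum.swap)
    also have "\<dots> = (\<Sum>b=1..k. v b * (\<Sum>a=1..N div b. u a))"
    proof (intro sum.cong refl)
      fix b assume b: "b \<in> {1..k}"
      have "{1..N div b} = {a\<in>{1..N}. b \<le> N div a}"
      proof (intro Set.set_eqI iffI)
        fix a assume "a \<in> {1..N div b}"
        then have a: "1 \<le> a" "a * b \<le> N" using b by (auto simp: less_eq_div_iff_mult_less_eq)
        then have "a \<le> N" using b by (metis atLeastAtMost_iff le_trans mult.right_neutral mult_le_mono2)
        then show "a \<in> {a\<in>{1..N}. b \<le> N div a}" using a by (auto simp: less_eq_div_iff_mult_less_eq mult.commute)
      next
        fix a assume "a \<in> {a\<in>{1..N}. b \<le> N div a}"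
        then show "a \<in> {1..N div b}" using b by (auto simp: less_eq_div_iff_mult_less_eq mult.commute)
      qed
      then have "(\<Sum>a=1..N. if b \<le> N div a then u a * v b else 0) = (\<Sum>a=1..N div b. u a * v b)"
        by (simp only:) (rule sum.inter_filter[symmetric], simp)
      then show "(\<Sum>a=1..N. if b \<le> N div a then u a * v b else 0) = v b * (\<Sum>a=1..N div b. u a)"
        by (simp add: sum_distrib_left mult.commute)
    qed
    also have "norm \<dots> \<le> (\<Sum>b=1..k. ln (real b) * norm (\<Sum>a=1..N div b. u a))"
    proof (rule sum_norm_le)
      fix b assume b: "b \<in> {1..k}"
      have "norm (v b) \<le> 1 * ln (real b)" unfolding v_def norm_mult
        using b c(3)[of b] by (intro mult_mono) auto
      then show "norm (v b * (\<Sum>a=1..N div b. u a)) \<le> ln (real b) * norm (\<Sum>a=1..N div b. u a)"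
        by (simp add: norm_mult mult_right_mono)
    qed
    finally show ?thesis .
  qed
  \<comment> \<open>Only \<open>a <= N div k\<close> contributes. Replacing
    \<open>ln (N / a)\<close> by \<open>2 * sqrt (N / a)\<close> makes the sum of order
    \<open>N / sqrt k\<close>, small against \<open>N\<close> once \<open>k\<close> is large. The
    constant 24 is 8, from two bounds \<open>2 * m * 2 * sqrt (N / a)\<close>, times 3, from
    \<open>sum_powr_upto\<close> at \<open>x = 1/2\<close>.\<close>
  also have "norm (\<Sum>a=1..N. u a * (B (N div a) - B (min k (N div a)))) \<le> 24 * real m * real N / sqrt (real k)"
  proof -
    have "(\<Sum>a=1..N. u a * (B (N div a) - B (min k (N div a)))) = (\<Sum>a=1..N div k. u a * (B (N div a) - B (min k (N div a))))"
    proof (rule sum.mono_neutral_right)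
      show "{1..N div k} \<subseteq> {1..N}"
        using div_le_dividend[of N k] by (auto intro: order_trans)
      show "\<forall>a\<in>{1..N} - {1..N div k}. u a * (B (N div a) - B (min k (N div a))) = 0"
      proof
        fix a assume a: "a \<in> {1..N} - {1..N div k}"
        then have "\<not> a * k \<le> N" using k by (auto simp: less_eq_div_iff_mult_less_eq)
        then have "\<not> k \<le> N div a" using a by (auto simp: less_eq_div_iff_mult_less_eq mult.commute)
        then show "u a * (B (N div a) - B (min k (N div a))) = 0" by (simp add: min_def)
      qed
    qed simp
    also have "norm \<dots> \<le> (\<Sum>a=1..N div k. 8 * real m * sqrt (real N) * real a powr (1/2 - 1))"
    proof (rule sum_norm_le)
      fix a assume a: "a \<in> {1..N div k}"
      then have ak: "a * k \<le> N" using k by (auto simp: less_eq_div_iff_mult_less_eq)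
      then have kN: "k \<le> N div a" using a by (auto simp: less_eq_div_iff_mult_less_eq mult.commute)
      then have mk: "min k (N div a) = k" by simp
      have q: "real (N div a) \<le> real N / real a" by (rule real_of_nat_div_le)
      have y: "real N / real a \<ge> 1" using q kN k by linarith
      have "ln (sqrt (real N / real a)) \<le> sqrt (real N / real a) - 1"
        using y by (intro ln_le_minus_one) auto
      then have ln: "ln (real N / real a) \<le> 2 * sqrt (real N / real a)"
        using y by (simp add: ln_sqrt)
      have l1: "ln (real (N div a)) \<le> ln (real N / real a)" "ln (real k) \<le> ln (real N / real a)"
        using q kN k y by (subst ln_le_cancel_iff; linarith)+
      have "norm (B (N div a) - B (min k (N div a))) \<le> norm (B (N div a)) + norm (B k)"
        unfolding mk by (rule norm_triangle_ineq4)
      also have "\<dots> \<le> 2 * real m * ln (real (N div a)) + 2 * real m * ln (real k)"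
        using k kN by (intro add_mono Bb) auto
      also have "\<dots> \<le> 2 * real m * (2 * sqrt (real N / real a)) + 2 * real m * (2 * sqrt (real N / real a))"
        using l1 ln by (intro add_mono mult_left_mono) auto
      also have "\<dots> = 8 * real m * sqrt (real N) * (1 / sqrt (real a))"
        by (simp add: real_sqrt_divide)
      also have "1 / sqrt (real a) = real a powr (1/2 - 1)"
        using a by (simp add: powr_minus_divide powr_half_sqrt)
      finally show "norm (u a * (B (N div a) - B (min k (N div a)))) \<le> 8 * real m * sqrt (real N) * real a powr (1/2 - 1)"
        unfolding norm_mult using u1[of a] by (intro order_trans[OF mult_left_le_one_le]) auto
    qed
    also have "\<dots> = 8 * real m * sqrt (real N) * (\<Sum>a=1..N div k. real a powr (1/2 - 1))"
      by (simp add: sum_distrib_left)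
    also have "\<dots> \<le> 8 * real m * sqrt (real N) * (3 * sqrt (real (N div k)))"
    proof (intro mult_left_mono)
      have "(\<Sum>a=1..N div k. real a powr (1/2 - 1)) \<le> real (N div k) powr (1/2) / (1/2) + real (N div k) powr (1/2 - 1)"
        by (rule sum_powr_upto) simp
      also have "real (N div k) powr (1/2 - 1) \<le> real (N div k) powr (1/2)"
      proof (cases "N div k = 0")
        case False
        then have "real (N div k) \<ge> 1" by (simp add: Suc_le_eq)
        then show ?thesis by (intro powr_mono) auto
      qed simp
      finally show "(\<Sum>a=1..N div k. real a powr (1/2 - 1)) \<le> 3 * sqrt (real (N div k))"
        by (simp add: powr_half_sqrt)
    qed simp
    also have "\<dots> \<le> 8 * real m * sqrt (real N) * (3 * sqrt (real N / real k))"
      by (intro mult_left_mono real_sqrt_le_mono real_of_nat_div_le) auto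
    also have "\<dots> = 24 * real m * (sqrt (real N) * sqrt (real N)) / sqrt (real k)"
      by (simp add: real_sqrt_divide)
    also have "\<dots> = 24 * real m * real N / sqrt (real k)" by simp
    finally show ?thesis .
  qed
  finally show ?thesis unfolding u_def by simp
qed

theorem mangoldt_character_mean_tendsto_0:
  assumes \<psi>: "nonprincipal_character m \<psi>"
  shows "(\<lambda>N. norm (\<Sum>n=1..N. \<psi> n * mangoldt n) / real N) \<longlonglongrightarrow> 0"
proof (rule LIMSEQ_I)
  fix e :: real assume e: "e > 0"
  define M where "M n = norm (\<Sum>a=1..n. \<psi> a * of_int (moebius a))" for n
  have M: "(\<lambda>n. M n / real n) \<longlonglongrightarrow> 0"
    using tendsto_norm[OF moebius_character_mean_tendsto_0[OF \<psi>]] by (simp add: M_def norm_divide)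
  \<comment> \<open>With this cut-off the second term of the hyperbola bound stays below
    \<open>e / 2\<close> for all \<open>N\<close>; the first one is a fixed finite sum of means that
    tend to 0.\<close>
  obtain k0 :: nat where k0: "real k0 > (48 * real m / e)\<^sup>2" using reals_Archimedean2 by blast
  define k where "k = Suc k0"
  have "48 * real m / e < sqrt (real k)"
    using k0 by (intro real_less_rsqrt) (simp add: k_def)
  then have kb: "24 * real m / sqrt (real k) < e / 2"
    using e by (simp add: field_simps k_def)
  have "(\<lambda>N. ln (real b) * (M (N div b) / real N)) \<longlonglongrightarrow> ln (real b) * 0" if b: "b \<in> {1..k}" for b
  proof (intro tendsto_mult tendsto_const)
    have lim: "filterlim (\<lambda>N. N div b) at_top at_top"
    proof (subst filterlim_at_top, intro allI)
      fix Z :: nat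
      show "eventually (\<lambda>N. Z \<le> N div b) at_top"
        using eventually_ge_at_top[of "Z * b"]
        by eventually_elim (use b in \<open>auto simp: less_eq_div_iff_mult_less_eq\<close>)
    qed
    show "(\<lambda>N. M (N div b) / real N) \<longlonglongrightarrow> 0"
    proof (rule tendsto_sandwich[OF _ _ tendsto_const filterlim_compose[OF M lim]])
      show "eventually (\<lambda>N. 0 \<le> M (N div b) / real N) sequentially" by (simp add: M_def)
      show "eventually (\<lambda>N. M (N div b) / real N \<le> M (N div b) / real (N div b)) sequentially"
      proof (intro always_eventually allI)
        fix N
        show "M (N div b) / real N \<le> M (N div b) / real (N div b)"
        proof (cases "N div b = 0")
          case False
          then show ?thesis using div_le_dividend[of N b]
            by (intro divide_left_mono mult_pos_pos) (auto simp: M_def intro!: Nat.gr0I)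
        qed (simp add: M_def)
      qed
    qed
  qed
  then have "(\<lambda>N. \<Sum>b=1..k. ln (real b) * (M (N div b) / real N)) \<longlonglongrightarrow> (\<Sum>b=1..k. ln (real b) * 0)"
    by (intro tendsto_sum)
  then have "(\<lambda>N. \<Sum>b=1..k. ln (real b) * (M (N div b) / real N)) \<longlonglongrightarrow> 0" by simp
  then have "eventually (\<lambda>N. (\<Sum>b=1..k. ln (real b) * (M (N div b) / real N)) < e / 2) sequentially"
    by (rule order_tendstoD) (use e in simp)
  then have "eventually (\<lambda>N. norm (norm (\<Sum>n=1..N. \<psi> n * mangoldt n) / real N - 0) < e) sequentially"
    using eventually_ge_at_top[of 1]
  proof eventually_elim
    case (elim N)
    have "norm (\<Sum>n=1..N. \<psi> n * mangoldt n) / real N \<le>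
        ((\<Sum>b=1..k. ln (real b) * M (N div b)) + 24 * real m * real N / sqrt (real k)) / real N"
      unfolding M_def using elim
      by (intro divide_right_mono norm_sum_mangoldt_character_le[OF \<psi>]) (auto simp: k_def)
    also have "\<dots> = (\<Sum>b=1..k. ln (real b) * (M (N div b) / real N)) + 24 * real m / sqrt (real k)"
      using elim by (simp add: add_divide_distrib sum_divide_distrib)
    also have "\<dots> < e" using elim kb by linarith
    finally show ?case by simp
  qed
  then show "\<exists>no. \<forall>n\<ge>no. norm (norm (\<Sum>n=1..n. \<psi> n * mangoldt n) / real n - 0) < e"
    by (simp only: eventually_sequentially)
qed

text \<open>A proper prime power \<open>p ^ j <= N\<close> has \<open>p <= sqrt N\<close> and
  \<open>j <= log 2 N\<close>, and each contributes at most \<open>ln N\<close>.\<close>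

lemma sum_mangoldt_nonprime_le:
  assumes N: "N \<ge> 1"
  shows "(\<Sum>n=1..N. if prime n then 0 else mangoldt n :: real) \<le> sqrt (real N) * log 2 (real N) * ln (real N)"
proof -
  define S where "S = {n\<in>{1..N}. primepow n \<and> \<not> prime n}"
  define a where "a = nat \<lfloor>sqrt (real N)\<rfloor>"
  define b where "b = nat \<lfloor>log 2 (real N)\<rfloor>"
  have ab: "real a \<le> sqrt (real N)" "real b \<le> log 2 (real N)"
    using N by (auto simp: a_def b_def)
  have "S \<subseteq> (\<lambda>(p, j). p ^ j) ` ({1..a} \<times> {1..b})"
  proof
    fix n assume n: "n \<in> S"
    then obtain p j where pj: "prime p" "j > 0" "n = p ^ j" by (auto simp: S_def primepow_def)
    have "j \<noteq> 1" using n pj by (auto simp: S_def)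
    then have j: "j \<ge> 2" using pj by linarith
    have p2: "p \<ge> 2" using pj by (simp add: prime_ge_2_nat)
    have nN: "n \<le> N" using n by (simp add: S_def)
    have "p ^ 2 \<le> p ^ j" using j p2 by (intro power_increasing) auto
    then have "p\<^sup>2 \<le> N" using nN pj by simp
    then have "real p \<le> sqrt (real N)" by (intro real_le_rsqrt) (simp flip: of_nat_power)
    then have 1: "p \<le> a" by (simp add: a_def le_nat_floor)
    have "(2::nat) ^ j \<le> p ^ j" using p2 by (intro power_mono) auto
    then have "2 ^ j \<le> N" using nN unfolding pj(3) by (rule order_trans)
    then have "(2::real) ^ j \<le> real N" by (metis of_nat_le_iff of_nat_numeral of_nat_power)
    then have "real j \<le> log 2 (real N)" using N by (simp add: le_log_iff powr_realpow)
    then have 2: "j \<le> b" by (simp add: b_def le_nat_floor)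
    show "n \<in> (\<lambda>(p, j). p ^ j) ` ({1..a} \<times> {1..b})"
      using 1 2 p2 j pj by (intro image_eqI[of _ _ "(p, j)"]) auto
  qed
  then have "card S \<le> card ({1..a} \<times> {1..b})"
    by (intro surj_card_le) auto
  then have "real (card S) \<le> real (a * b)" by (simp only: card_cartesian_product card_atLeastAtMost diff_Suc_1 of_nat_le_iff)
  also have "\<dots> \<le> sqrt (real N) * log 2 (real N)"
    unfolding of_nat_mult using ab N by (intro mult_mono) auto
  finally have card: "real (card S) \<le> sqrt (real N) * log 2 (real N)" .
  have "(\<Sum>n=1..N. if prime n then 0 else mangoldt n :: real) = (\<Sum>n\<in>S. mangoldt n)"
    by (intro sum.mono_neutral_cong_right) (auto simp: S_def mangoldt_def)
  also have "\<dots> \<le> (\<Sum>n\<in>S. ln (real N))"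
  proof (rule sum_mono)
    fix n assume n: "n \<in> S"
    have "mangoldt n \<le> (\<Sum>d | d dvd n. mangoldt d :: real)"
      using n by (intro member_le_sum mangoldt_nonneg) (auto simp: S_def)
    also have "\<dots> = ln (real n)" using n mangoldt_sum[of n, where ?'a = real] by (auto simp: S_def)
    also have "\<dots> \<le> ln (real N)" using n by (auto simp: S_def)
    finally show "mangoldt n \<le> ln (real N)" .
  qed
  also have "\<dots> = real (card S) * ln (real N)" by simp
  also have "\<dots> \<le> sqrt (real N) * log 2 (real N) * ln (real N)"
    using N by (intro mult_right_mono card) auto
  finally show ?thesis .
qed

theorem prime_character_mean_tendsto_0:
  assumes \<psi>: "nonprincipal_character m \<psi>"
  shows "(\<lambda>N. norm (\<Sum>n=1..N. if prime n then \<psi> n * of_real (ln (real n)) else 0) / real N) \<longlonglongrightarrow> 0"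
proof (rule tendsto_sandwich[OF _ _ tendsto_const])
  let ?L = "\<lambda>N. norm (\<Sum>n=1..N. \<psi> n * mangoldt n) / real N + sqrt (real N) * log 2 (real N) * ln (real N) / real N"
  show "eventually (\<lambda>N. 0 \<le> norm (\<Sum>n=1..N. if prime n then \<psi> n * of_real (ln (real n)) else 0) / real N) sequentially"
    by simp
  have "(\<lambda>N. sqrt (real N) * log 2 (real N) * ln (real N) / real N) \<longlonglongrightarrow> 0" by real_asymp
  then have "?L \<longlonglongrightarrow> 0 + 0" by (intro tendsto_add mangoldt_character_mean_tendsto_0[OF \<psi>])
  then show "?L \<longlonglongrightarrow> 0" by simp
  show "eventually (\<lambda>N. norm (\<Sum>n=1..N. if prime n then \<psi> n * of_real (ln (real n)) else 0) / real N \<le> ?L N) sequentially"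
    using eventually_ge_at_top[of 1]
  proof eventually_elim
    case (elim N)
    have "(\<Sum>n=1..N. if prime n then \<psi> n * of_real (ln (real n)) else 0)
        = (\<Sum>n=1..N. \<psi> n * mangoldt n - (if prime n then 0 else \<psi> n * mangoldt n))"
      by (intro sum.cong) auto
    also have "\<dots> = (\<Sum>n=1..N. \<psi> n * mangoldt n) - (\<Sum>n=1..N. if prime n then 0 else \<psi> n * mangoldt n)"
      by (rule sum_subtractf)
    finally have eq: "(\<Sum>n=1..N. if prime n then \<psi> n * of_real (ln (real n)) else 0)
        = (\<Sum>n=1..N. \<psi> n * mangoldt n) - (\<Sum>n=1..N. if prime n then 0 else \<psi> n * mangoldt n)" .
    have "norm (\<Sum>n=1..N. if prime n then 0 else \<psi> n * mangoldt n) \<le> (\<Sum>n=1..N. if prime n then 0 else mangoldt n)"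
    proof (rule sum_norm_le)
      fix n
      have "norm (\<psi> n) * \<bar>mangoldt n\<bar> \<le> 1 * mangoldt n"
        using nonprincipal_characterD(3)[OF \<psi>, of n] mangoldt_nonneg[of n] by (intro mult_mono) auto
      moreover have "norm (mangoldt n :: complex) = \<bar>mangoldt n\<bar>"
        by (metis norm_of_real of_real_mangoldt)
      ultimately show "norm (if prime n then 0 else \<psi> n * mangoldt n) \<le> (if prime n then 0 else mangoldt n)"
        by (simp add: norm_mult)
    qed
    also have "\<dots> \<le> sqrt (real N) * log 2 (real N) * ln (real N)" by (rule sum_mangoldt_nonprime_le[OF elim])
    finally have "norm (\<Sum>n=1..N. if prime n then \<psi> n * of_real (ln (real n)) else 0) \<le>
        norm (\<Sum>n=1..N. \<psi> n * mangoldt n) + sqrt (real N) * log 2 (real N) * ln (real N)"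
      unfolding eq by (intro order_trans[OF norm_triangle_ineq4]) simp
    then show ?case by (simp add: divide_right_mono add_divide_distrib[symmetric])
  qed
qed

section \<open>Chebyshev's lower bound\<close>

definition prime_theta :: "nat \<Rightarrow> real" where
  "prime_theta N = (\<Sum>n=1..N. if prime n then ln (real n) else 0)"

text \<open>The logarithm of the central binomial coefficient is at least \<open>n * ln 2\<close>,
  since each ratio \<open>(n + i) / i\<close> is at least 2. In terms of \<open>mangoldt\<close> its
  weights \<open>2 * n div d - 2 * (n div d)\<close> are at most 1.\<close>

lemma sum_mangoldt_ge: "(\<Sum>d=1..2 * n. mangoldt d) \<ge> real n * ln 2"
proof -
  have "real n * ln 2 = (\<Sum>i=1..n. ln (2::real))" by simp
  also have "\<dots> \<le> (\<Sum>i=1..n. ln (real (n + i)) - ln (real i))"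
  proof (rule sum_mono)
    fix i assume i: "i \<in> {1..n}"
    then have "ln (2 * real i) \<le> ln (real (n + i))" by (subst ln_le_cancel_iff) auto
    then show "ln 2 \<le> ln (real (n + i)) - ln (real i)" using i by (simp add: ln_mult)
  qed
  also have "\<dots> = (\<Sum>i=1..n. ln (real (n + i))) - (\<Sum>i=1..n. ln (real i))" by (rule sum_subtractf)
  also have "(\<Sum>i=1..n. ln (real (n + i))) = (\<Sum>i=n+1..n+n. ln (real i))"
    by (rule sum.reindex_bij_witness[of _ "\<lambda>i. i - n" "\<lambda>i. n + i"]) auto
  also have "\<dots> = (\<Sum>i=1..2 * n. ln (real i)) - (\<Sum>i=1..n. ln (real i))"
    using sum.ub_add_nat[of 1 n "\<lambda>i. ln (real i)" n] by (simp add: mult_2)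
  also have "\<dots> - (\<Sum>i=1..n. ln (real i)) = (\<Sum>d=1..2*n. mangoldt d * real (2 * n div d)) - 2 * (\<Sum>d=1..n. mangoldt d * real (n div d))"
    unfolding sum_ln_mangoldt by simp
  also have "(\<Sum>d=1..n. mangoldt d * real (n div d)) = (\<Sum>d=1..2*n. mangoldt d * real (n div d))"
    by (intro sum.mono_neutral_left) (auto simp: not_le)
  also have "(\<Sum>d=1..2*n. mangoldt d * real (2 * n div d)) - 2 * \<dots> = (\<Sum>d=1..2*n. mangoldt d * (real (2 * n div d) - 2 * real (n div d)))"
    by (simp add: sum_distrib_left sum_subtractf[symmetric] algebra_simps)
  also have "\<dots> \<le> (\<Sum>d=1..2*n. mangoldt d * 1)"
  proof (intro sum_mono mult_left_mono mangoldt_nonneg)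
    fix d assume "d \<in> {1..2 * n}"
    then have d: "d > 0" by simp
    have "2 * n div d < 2 * (n div d) + 2"
      using d by (subst less_mult_imp_div_less) (auto simp: add_mult_distrib intro: order_less_le_trans[OF mult_strict_left_mono[OF dividend_less_div_times]])
    then show "real (2 * n div d) - 2 * real (n div d) \<le> 1" by linarith
  qed
  finally show ?thesis by simp
qed

text \<open>\<open>ln 2 / 2\<close> is at least 1/3; the smaller constant 1/4 leaves room for the
  rounding of \<open>N div 2\<close> and for the proper prime powers.\<close>

lemma eventually_prime_theta_ge: "eventually (\<lambda>N. prime_theta N \<ge> real N / 4) sequentially"
proof -
  have "eventually (\<lambda>N. (real N - 1) / 2 * (2 / 3) - sqrt (real N) * log 2 (real N) * ln (real N) \<ge> real N / 4) sequentially"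
    by real_asymp
  then show ?thesis
    using eventually_ge_at_top[of 1]
  proof eventually_elim
    case (elim N)
    have "(real N - 1) / 2 * (2 / 3) \<le> real (N div 2) * ln 2"
    proof (intro mult_mono)
      have "N \<le> 2 * (N div 2) + 1" by simp
      then have "real N \<le> real (2 * (N div 2) + 1)" by (simp only: of_nat_le_iff)
      then show "(real N - 1) / 2 \<le> real (N div 2)" by simp
      show "2 / 3 \<le> ln (2::real)" by (rule ln2_ge_two_thirds)
    qed auto
    also have "\<dots> \<le> (\<Sum>d=1..2 * (N div 2). mangoldt d)" by (rule sum_mangoldt_ge)
    also have "\<dots> \<le> (\<Sum>d=1..N. mangoldt d)"
      by (intro sum_mono2 mangoldt_nonneg) auto
    also have "\<dots> = (\<Sum>n=1..N. (if prime n then ln (real n) else 0) + (if prime n then 0 else mangoldt n))"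
      by (intro sum.cong) auto
    also have "\<dots> \<le> prime_theta N + sqrt (real N) * log 2 (real N) * ln (real N)"
      unfolding sum.distrib prime_theta_def by (intro add_left_mono sum_mangoldt_nonprime_le elim)
    finally show ?case using elim by linarith
  qed
qed

section \<open>Primes congruent to one\<close>

lemma fact_eq_prod_multiples:
  fixes q n :: nat
  assumes q: "q > 0"
  shows "(fact n :: nat) = (\<Prod>j\<in>{j\<in>{1..n}. \<not> q dvd j}. j) * (q ^ (n div q) * fact (n div q))"
proof -
  have "(fact n :: nat) = (\<Prod>j\<in>{1..n}. j)" by (simp add: fact_prod)
  also have "{1..n} = {j\<in>{1..n}. \<not> q dvd j} \<union> (*) q ` {1..n div q}"
    using q by (auto simp: less_eq_div_iff_mult_less_eq mult.commute image_iff elim!: dvdE)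
  also have "(\<Prod>j\<in>\<dots>. j) = (\<Prod>j\<in>{j\<in>{1..n}. \<not> q dvd j}. j) * (\<Prod>j\<in>(*) q ` {1..n div q}. j)"
    by (rule prod.union_disjoint) auto
  also have "(\<Prod>j\<in>(*) q ` {1..n div q}. j) = (\<Prod>j\<in>{1..n div q}. q * j)"
    using q by (subst prod.reindex) (auto simp: inj_on_def)
  also have "\<dots> = q ^ (n div q) * fact (n div q)"
    by (simp add: prod.distrib fact_prod)
  finally show ?thesis .
qed

text \<open>Recursion as in Legendre's formula: the multiples of \<open>q\<close> give
  \<open>n div q\<close> plus the multiplicity for \<open>n div q\<close>, and
  \<open>2 * (n div q) <= n\<close>.\<close>

lemma multiplicity_fact_le:
  assumes q: "prime q"
  shows "multiplicity q (fact n :: nat) \<le> n"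
proof (induction n rule: less_induct)
  case (less n)
  show ?case
  proof (cases "n = 0")
    case False
    have q2: "q \<ge> 2" using q by (simp add: prime_ge_2_nat)
    let ?P = "\<Prod>j\<in>{j\<in>{1..n}. \<not> q dvd j}. j"
    have "\<not> q dvd ?P" using q by (subst prime_dvd_prod_iff) auto
    moreover have "?P \<noteq> 0" by (intro prod_pos[THEN less_imp_neq, symmetric]) auto
    ultimately have "multiplicity q (fact n :: nat) = multiplicity q (q ^ (n div q)) + multiplicity q (fact (n div q) :: nat)"
      using q q2 by (subst fact_eq_prod_multiples[of q n])
        (auto simp: prime_elem_multiplicity_mult_distrib not_dvd_imp_multiplicity_0)
    also have "\<dots> \<le> n div q + n div q"
      using less[of "n div q"] False q q2 by (intro add_mono) auto
    also have "\<dots> = 2 * (n div q)" by simp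
    also have "\<dots> \<le> q * (n div q)" using q2 by (intro mult_right_mono) auto
    also have "\<dots> \<le> n" by simp
    finally show ?thesis .
  qed simp
qed

text \<open>The quotient is a binomial coefficient.\<close>

lemma fact_dvd_prod_shifted:
  fixes u n :: nat
  shows "(fact n :: nat) dvd (\<Prod>j=1..n. u + j)"
proof -
  have "(fact (u + n) :: nat) = fact u * (\<Prod>j=1..n. u + j)"
    by (induction n) (simp_all add: algebra_simps)
  moreover have "fact u * fact n * ((u + n) choose u) = (fact (u + n) :: nat)"
    using binomial_fact_lemma[of u "u + n"] by simp
  ultimately have "fact u * (\<Prod>j=1..n. u + j) = (fact u :: nat) * (fact n * ((u + n) choose u))"
    by (simp add: mult_ac)
  then have "(\<Prod>j=1..n. u + j) = (fact n :: nat) * ((u + n) choose u)" by simp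
  then show ?thesis by simp
qed

text \<open>The product $\prod_{j \le n}(qj+1)$ is, up to a power of $q$, divisible by $n!$, and the
  quotient still contains all primes $p \equiv 1 \pmod q$ in $(n, qn+1]$.\<close>
lemma prod_primes_cong_1_le:
  fixes q n :: nat
  assumes q: "prime q"
  shows "(\<Prod>p | prime p \<and> n < p \<and> p \<le> q * n + 1 \<and> p mod q = 1. p) \<le> q ^ (3 * n)"
proof -
  define S where "S = {p. prime p \<and> n < p \<and> p \<le> q * n + 1 \<and> p mod q = 1}"
  have q2: "q \<ge> 2" using q by (simp add: prime_ge_2_nat)
  have fin: "finite S" by (rule finite_subset[of _ "{..q * n + 1}"]) (auto simp: S_def)
  define P where "P = (\<Prod>j=1..n. q * j + 1)"
  obtain r where r: "(fact n :: nat) = q ^ multiplicity q (fact n :: nat) * r" "\<not> q dvd r"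
    by (rule multiplicity_decompose'[of "fact n :: nat" q]) (use q2 in auto)
  have rpos: "r > 0" using r by (intro Nat.gr0I) auto
  have cop: "coprime q r" using q r(2) by (simp add: prime_imp_coprime)
  have rP: "r dvd P"
  proof -
    \<comment> \<open>With \<open>u\<close> the inverse of \<open>q\<close> modulo \<open>r\<close>,
      each factor \<open>q * j + 1\<close> is congruent to \<open>q * (u + j)\<close>. So
      \<open>P\<close> is congruent to a power of \<open>q\<close> times a product of
      \<open>n\<close> consecutive integers, which \<open>fact n\<close> and hence \<open>r\<close>
      divides.\<close>
    obtain u where u: "[q * u = 1] (mod r)" using cong_solve_coprime_nat[OF cop] by auto
    have "[P = (\<Prod>j=1..n. q * j + q * u)] (mod r)"
      unfolding P_def by (intro cong_prod cong_add cong_refl cong_sym[OF u])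
    also have "(\<Prod>j=1..n. q * j + q * u) = (\<Prod>j=1..n. q * (u + j))"
      by (simp add: algebra_simps)
    also have "\<dots> = q ^ n * (\<Prod>j=1..n. u + j)" by (simp add: prod.distrib)
    finally have c: "[P = q ^ n * (\<Prod>j=1..n. u + j)] (mod r)" .
    have "r dvd (fact n :: nat)" using r(1) by (metis dvd_triv_right)
    then have "r dvd q ^ n * (\<Prod>j=1..n. u + j)"
      using fact_dvd_prod_shifted[of n u] by (meson dvd_mult dvd_trans)
    then show ?thesis using c by (simp add: cong_dvd_iff)
  qed
  have MP: "\<Prod>S dvd P"
  proof -
    have "S \<subseteq> (\<lambda>j. q * j + 1) ` {1..n}"
    proof
      fix p assume p: "p \<in> S"
      have eq: "p = q * (p div q) + 1" using p mult_div_mod_eq[of q p] by (simp add: S_def)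
      moreover have "q * (p div q) + 1 \<le> q * n + 1" using p unfolding eq[symmetric] by (simp add: S_def)
      then have "p div q \<le> n" using q2 by simp
      moreover have "p div q \<noteq> 0" using p eq by (intro notI) (auto simp: S_def)
      ultimately show "p \<in> (\<lambda>j. q * j + 1) ` {1..n}" by (intro image_eqI[of _ _ "p div q"]) auto
    qed
    then have "\<Prod>S dvd \<Prod>((\<lambda>j. q * j + 1) ` {1..n})" by (intro prod_dvd_prod_subset) auto
    also have "\<Prod>((\<lambda>j. q * j + 1) ` {1..n}) = P"
      unfolding P_def using q2 by (subst prod.reindex) (auto simp: inj_on_def)
    finally show ?thesis .
  qed
  have "coprime (\<Prod>S) r"
  proof (rule prod_coprime_left)
    fix p assume p: "p \<in> S"
    have "\<not> p dvd (fact n :: nat)" using p by (auto simp: S_def prime_dvd_fact_iff)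
    then have "\<not> p dvd r" using r(1) by (metis dvd_mult)
    then show "coprime p r" using p by (simp add: S_def prime_imp_coprime)
  qed
  then have "\<Prod>S * r dvd P" using MP rP by (simp add: divides_mult)
  moreover have "P > 0" unfolding P_def by (intro prod_pos) auto
  ultimately have "\<Prod>S * r \<le> P" by (rule dvd_imp_le)
  also have "P \<le> (\<Prod>j=1..n. (q + 1) * j)"
    unfolding P_def by (intro prod_mono) auto
  also have "\<dots> = (\<Prod>j=1..n. q + 1) * (\<Prod>j=1..n. j)" by (rule prod.distrib)
  also have "\<dots> = (q + 1) ^ n * fact n" by (simp add: fact_prod)
  also have "\<dots> = (q + 1) ^ n * q ^ multiplicity q (fact n :: nat) * r"
    by (subst r(1)) simp
  finally have "\<Prod>S \<le> (q + 1) ^ n * q ^ multiplicity q (fact n :: nat)" using rpos by simp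
  also have "\<dots> \<le> (q ^ 2) ^ n * q ^ n"
  proof (intro mult_mono power_mono power_increasing multiplicity_fact_le q)
    have "q + 1 \<le> 2 * q" using q2 by simp
    also have "\<dots> \<le> q * q" using q2 by (intro mult_right_mono) auto
    finally show "q + 1 \<le> q\<^sup>2" by (simp add: power2_eq_square)
  qed (use q2 in auto)
  also have "\<dots> = q ^ (3 * n)" by (simp add: power_mult[symmetric] power_add[symmetric])
  finally show ?thesis unfolding S_def .
qed

text \<open>Put \<open>n = x div q\<close>. The primes above \<open>n\<close> cost
  \<open>3 * n * ln q\<close> by the product bound. Those up to \<open>n\<close> cost by induction
  \<open>6 * n * ln q / q\<close>, again at most \<open>3 * n * ln q\<close> because
  \<open>q >= 2\<close>. The total \<open>6 * n * ln q\<close> is within the claim. The decay in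
  \<open>q\<close> makes the later sum over \<open>q\<close> converge.\<close>

lemma prime_theta_cong_1_le:
  assumes q: "prime q"
  shows "(\<Sum>p | prime p \<and> p \<le> x \<and> p mod q = 1. ln (real p)) \<le> 6 * real x * ln (real q) / real q"
proof (induction x rule: less_induct)
  case (less x)
  define T where "T y = (\<Sum>p | prime p \<and> p \<le> y \<and> p mod q = 1. ln (real p))" for y
  have q2: "q \<ge> 2" using q by (simp add: prime_ge_2_nat)
  show ?case
  proof (cases "x = 0")
    case False
    define n where "n = x div q"
    have nx: "n < x" using False q2 by (simp add: n_def)
    define S where "S = {p. prime p \<and> n < p \<and> p \<le> q * n + 1 \<and> p mod q = 1}"
    have fin: "finite S" by (rule finite_subset[of _ "{..q * n + 1}"]) (auto simp: S_def)
    have fin2: "finite {p. prime p \<and> p \<le> n \<and> p mod q = 1}" by (rule finite_subset[of _ "{..n}"]) auto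
    have "T x \<le> (\<Sum>p\<in>{p. prime p \<and> p \<le> n \<and> p mod q = 1} \<union> S. ln (real p))"
      unfolding T_def
    proof (rule sum_mono2)
      show "{p. prime p \<and> p \<le> x \<and> p mod q = 1} \<subseteq> {p. prime p \<and> p \<le> n \<and> p mod q = 1} \<union> S"
      proof
        fix p assume p: "p \<in> {p. prime p \<and> p \<le> x \<and> p mod q = 1}"
        have "p = q * (p div q) + 1" using p mult_div_mod_eq[of q p] by simp
        also have "\<dots> \<le> q * n + 1" using p by (simp add: n_def div_le_mono)
        finally show "p \<in> {p. prime p \<and> p \<le> n \<and> p mod q = 1} \<union> S" using p by (auto simp: S_def)
      qed
    qed (use fin fin2 in \<open>auto simp: S_def dest: prime_ge_1_nat\<close>)
    also have "\<dots> = T n + (\<Sum>p\<in>S. ln (real p))"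
      unfolding T_def by (rule sum.union_disjoint[OF fin2 fin]) (auto simp: S_def)
    also have "(\<Sum>p\<in>S. ln (real p)) \<le> 3 * real n * ln (real q)"
    proof -
      have pos: "\<And>p. p \<in> S \<Longrightarrow> p > 0" by (auto simp: S_def prime_gt_0_nat)
      then have "(\<Sum>p\<in>S. ln (real p)) = ln (\<Prod>p\<in>S. real p)"
        using fin by (intro ln_prod[symmetric]) auto
      also have "(\<Prod>p\<in>S. real p) = real (\<Prod>S)" by simp
      also have "ln (real (\<Prod>S)) \<le> ln (real (q ^ (3 * n)))"
      proof (subst ln_le_cancel_iff)
        show "real (\<Prod>S) \<le> real (q ^ (3 * n))"
          using prod_primes_cong_1_le[OF q, of n] unfolding S_def of_nat_le_iff .
        show "real (\<Prod>S) > 0" using pos by (simp only: of_nat_0_less_iff) (intro prod_pos, auto)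
      qed (use q2 in auto)
      also have "\<dots> = 3 * real n * ln (real q)" using q2 by (simp add: ln_realpow)
      finally show ?thesis .
    qed
    also have "T n \<le> 6 * real n * ln (real q) / real q" using less[OF nx] by (simp add: T_def)
    also have "\<dots> \<le> 3 * real n * ln (real q)"
    proof -
      have "3 * real n * ln (real q) * (2 / real q) \<le> 3 * real n * ln (real q) * 1"
        using q2 by (intro mult_left_mono) auto
      then show ?thesis by simp
    qed
    also have "3 * real n * ln (real q) + 3 * real n * ln (real q) = 6 * ln (real q) * real n" by simp
    also have "\<dots> \<le> 6 * ln (real q) * (real x / real q)"
      unfolding n_def using q2 by (intro mult_left_mono real_of_nat_div_le) auto
    finally show ?thesis by (simp add: T_def mult_ac)
  qed (simp add: not_prime_0 cong: conj_cong)
qed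

section \<open>Weighted means over the primes\<close>

definition prime_weight :: "nat \<Rightarrow> nat \<Rightarrow> real" where
  "prime_weight k p = real p ^ k * (real p - 1)"

definition weight_total :: "nat \<Rightarrow> nat \<Rightarrow> real" where
  "weight_total k N = (\<Sum>p | prime p \<and> p \<le> N. prime_weight k p)"

text \<open>The mean is over all primes, not only those selected by the restricted sums; the
  selection is put into \<open>f\<close>, and the common normaliser cancels in the final
  quotient.\<close>

definition has_prime_mean :: "nat \<Rightarrow> (nat \<Rightarrow> complex) \<Rightarrow> complex \<Rightarrow> bool" where
  "has_prime_mean k f L \<longleftrightarrow>
     (\<lambda>N. (\<Sum>p | prime p \<and> p \<le> N. f p * of_real (prime_weight k p)) / of_real (weight_total k N)) \<longlonglongrightarrow> L"

lemma finite_primes_le [simp]: "finite {p::nat. prime p \<and> p \<le> N}"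
  by (rule finite_subset[of _ "{..N}"]) auto

lemma sum_primes_le_conv:
  fixes f :: "nat \<Rightarrow> 'a :: comm_monoid_add"
  shows "(\<Sum>p | prime p \<and> p \<le> N. f p) = (\<Sum>n=1..N. if prime n then f n else 0)"
  by (rule sum.mono_neutral_cong_left) (auto dest: prime_ge_1_nat)

lemma prime_weight_nonneg: "p \<ge> 1 \<Longrightarrow> prime_weight k p \<ge> 0"
  by (simp add: prime_weight_def)

lemma prime_theta_eq: "prime_theta N = (\<Sum>p | prime p \<and> p \<le> N. ln (real p))"
  unfolding prime_theta_def sum_primes_le_conv ..

text \<open>All odd primes are congruent to 1 modulo 2, so this is the case \<open>q = 2\<close> of
  the bound for primes congruent to 1.\<close>

lemma prime_theta_le: "prime_theta N \<le> 3 * real N + 1"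
proof -
  have "prime_theta N \<le> (\<Sum>p\<in>insert 2 {p. prime p \<and> p \<le> N \<and> p mod 2 = 1}. ln (real p))"
    unfolding prime_theta_eq
  proof (rule sum_mono2)
    show "{p. prime p \<and> p \<le> N} \<subseteq> insert 2 {p. prime p \<and> p \<le> N \<and> p mod 2 = 1}"
      by (auto simp: prime_odd_nat odd_iff_mod_2_eq_one dest: prime_ge_2_nat
          intro: ccontr[where P = "_ = Suc 0"])
         (metis le_neq_implies_less odd_iff_mod_2_eq_one One_nat_def prime_ge_2_nat prime_odd_nat)
    show "finite (insert 2 {p. prime p \<and> p \<le> N \<and> p mod 2 = 1})"
      by (rule finite.insertI, rule finite_subset[of _ "{..N}"]) auto
  qed (auto dest: prime_ge_1_nat)
  also have "\<dots> = ln 2 + (\<Sum>p | prime p \<and> p \<le> N \<and> p mod 2 = 1. ln (real p))"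
    by (subst sum.insert) (auto intro: finite_subset[of _ "{..N}"])
  also have "\<dots> \<le> ln 2 + 6 * real N * ln 2 / 2"
    using prime_theta_cong_1_le[of 2 N] by simp
  also have "\<dots> \<le> 1 + 6 * real N * 1 / 2"
    using ln_2_less_1 by (intro add_mono divide_right_mono mult_left_mono) auto
  finally show ?thesis by simp
qed

lemma eventually_weight_total_ge:
  obtains c where "c > 0" "eventually (\<lambda>N. weight_total k N \<ge> c * real N ^ (k + 2) / ln (real N)) sequentially"
proof
  \<comment> \<open>\<open>1 / 16\<close> bounds the logarithmic mass of the primes in
    \<open>(y, N]\<close> relative to \<open>N\<close>, and \<open>1 / 48 ^ (k + 1)\<close> comes
    from their weights, as \<open>y >= N / 48\<close>.\<close>
  define c :: real where "c = 1 / (48 ^ (k + 1) * 16)"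
  show "c > 0" by (simp add: c_def)
  have "eventually (\<lambda>N. N \<ge> (48::nat)) sequentially" by (rule eventually_ge_at_top)
  moreover have "eventually (\<lambda>N. real N / 8 - 1 \<ge> real N / 16) sequentially" by real_asymp
  ultimately show "eventually (\<lambda>N. weight_total k N \<ge> c * real N ^ (k + 2) / ln (real N)) sequentially"
    using eventually_prime_theta_ge
  proof eventually_elim
    case (elim N)
    \<comment> \<open>The divisor 24 makes the upper bound \<open>3 * y + 1\<close> for the primes
      up to \<open>y\<close> at most \<open>N / 8 + 1\<close>, half of the lower bound
      \<open>N / 4\<close> up to a constant.\<close>
    define y where "y = N div 24"
    have yN: "y \<le> N" by (simp add: y_def)
    have "N < 24 * y + 24" by (simp add: y_def dividend_less_times_div mult.commute)
    then have y1: "real y \<ge> real N / 48" "real y \<le> real N / 24"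
      using elim(1) real_of_nat_div_le[of N 24] by (auto simp: y_def)
    have lnN: "ln (real N) > 0" using elim(1) by simp
    have split: "{p. prime p \<and> p \<le> N} = {p. prime p \<and> p \<le> y} \<union> {p. prime p \<and> y < p \<and> p \<le> N}"
      using yN by auto
    have fin: "finite {p::nat. prime p \<and> y < p \<and> p \<le> N}" by (rule finite_subset[of _ "{..N}"]) auto
    have "prime_theta N = prime_theta y + (\<Sum>p | prime p \<and> y < p \<and> p \<le> N. ln (real p))"
      unfolding prime_theta_eq split by (rule sum.union_disjoint) (use fin in auto)
    then have th: "(\<Sum>p | prime p \<and> y < p \<and> p \<le> N. ln (real p)) \<ge> real N / 16"
      using elim prime_theta_le[of y] y1(2) by linarith
    have "c * real N ^ (k + 2) / ln (real N) = (real N / 48) ^ (k + 1) / ln (real N) * (real N / 16)"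
      by (simp add: c_def power_divide field_simps)
    also have "\<dots> \<le> real y ^ (k + 1) / ln (real N) * (\<Sum>p | prime p \<and> y < p \<and> p \<le> N. ln (real p))"
      using y1 lnN by (intro mult_mono th divide_right_mono power_mono) auto
    also have "\<dots> = (\<Sum>p | prime p \<and> y < p \<and> p \<le> N. real y ^ (k + 1) / ln (real N) * ln (real p))"
      by (rule sum_distrib_left)
    also have "\<dots> \<le> (\<Sum>p | prime p \<and> y < p \<and> p \<le> N. prime_weight k p)"
    proof (rule sum_mono)
      fix p assume p: "p \<in> {p. prime p \<and> y < p \<and> p \<le> N}"
      have "ln (real p) \<le> ln (real N)" using p by (auto simp: prime_gt_0_nat)
      then have "real y ^ (k + 1) / ln (real N) * ln (real p) \<le> real y ^ (k + 1) / ln (real N) * ln (real N)"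
        using lnN by (intro mult_left_mono) auto
      also have "\<dots> = real y ^ k * real y" using lnN by simp
      also have "\<dots> \<le> real p ^ k * (real p - 1)"
        using p by (intro mult_mono power_mono) auto
      finally show "real y ^ (k + 1) / ln (real N) * ln (real p) \<le> prime_weight k p"
        by (simp add: prime_weight_def)
    qed
    also have "\<dots> \<le> weight_total k N"
      unfolding weight_total_def by (intro sum_mono2 prime_weight_nonneg) (auto dest: prime_ge_1_nat)
    finally show ?case .
  qed
qed

lemma weight_total_at_top: "filterlim (weight_total k) at_top sequentially"
proof -
  obtain c where c: "c > 0" "eventually (\<lambda>N. weight_total k N \<ge> c * real N ^ (k + 2) / ln (real N)) sequentially"
    by (rule eventually_weight_total_ge)
  have "filterlim (\<lambda>N. c * real N / ln (real N)) at_top sequentially"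
    using c(1) by real_asymp
  moreover have "eventually (\<lambda>N. c * real N / ln (real N) \<le> weight_total k N) sequentially"
    using c(2) eventually_ge_at_top[of 2]
  proof eventually_elim
    case (elim N)
    have "c * real N ^ 1 / ln (real N) \<le> c * real N ^ (k + 2) / ln (real N)"
      using elim(2) c(1) by (intro divide_right_mono mult_left_mono power_increasing) auto
    then show ?case using elim(1) by simp
  qed
  ultimately show ?thesis by (rule filterlim_at_top_mono)
qed

lemma eventually_weight_total_pos: "eventually (\<lambda>N. weight_total k N > 0) sequentially"
  using weight_total_at_top[of k] by (auto simp: filterlim_at_top_dense)

text \<open>Monotonicity permits Abel summation from the weights \<open>ln p\<close> to
  \<open>prime_weight\<close>. The derivative of \<open>(y - 1) / ln y\<close> has the right sign by
  \<open>ln (1 / y) <= 1 / y - 1\<close>. At \<open>n = 1\<close> the quotient is 0 by the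
  convention for division by zero.\<close>

lemma weight_quotient_mono:
  assumes "1 \<le> n"
  shows "prime_weight k n / ln (real n) \<le> prime_weight k (Suc n) / ln (real (Suc n))"
proof (cases "n = 1")
  case False
  then have n: "real n > 1" using assms by simp
  have "(real n - 1) / ln (real n) \<le> (real (Suc n) - 1) / ln (real (Suc n))"
  proof (rule DERIV_nonneg_imp_nondecreasing[where f = "\<lambda>y. (y - 1) / ln y"])
    fix y assume y: "real n \<le> y" "y \<le> real (Suc n)"
    then have y1: "y > 1" using n by simp
    have "ln (1 / y) \<le> 1 / y - 1" using y1 by (intro ln_le_minus_one) auto
    then have "0 \<le> ln y - (y - 1) / y" using y1 by (simp add: ln_div diff_divide_distrib)
    then have "0 \<le> (ln y - (y - 1) / y) / (ln y)\<^sup>2" by (intro divide_nonneg_nonneg) auto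
    moreover have "((\<lambda>y. (y - 1) / ln y) has_real_derivative (ln y - (y - 1) / y) / (ln y)\<^sup>2) (at y)"
      using y1 ln_gt_zero[OF y1] by (auto intro!: derivative_eq_intros simp: power2_eq_square field_simps)
    ultimately show "\<exists>y'. ((\<lambda>y. (y - 1) / ln y) has_real_derivative y') (at y) \<and> 0 \<le> y'" by blast
  qed simp
  then have "real n ^ k * ((real n - 1) / ln (real n)) \<le> real (Suc n) ^ k * ((real (Suc n) - 1) / ln (real (Suc n)))"
    using n by (intro mult_mono power_mono divide_nonneg_nonneg) auto
  then show ?thesis by (simp add: prime_weight_def)
qed (simp add: prime_weight_def)

text \<open>By Abel summation the weighted sum is at most \<open>N powr (k + 1) / ln N\<close> times
  a bound for the logarithmic sums that is small against \<open>N\<close>. This is small against the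
  Chebyshev lower bound of order \<open>N powr (k + 2) / ln N\<close> for the total weight.\<close>

theorem nonprincipal_character_prime_mean:
  assumes \<psi>: "nonprincipal_character m \<psi>"
  shows "has_prime_mean k \<psi> 0"
  unfolding has_prime_mean_def
proof (rule LIMSEQ_I)
  fix e :: real assume e: "e > 0"
  obtain c where c: "c > 0" "eventually (\<lambda>N. weight_total k N \<ge> c * real N ^ (k + 2) / ln (real N)) sequentially"
    by (rule eventually_weight_total_ge)
  define S where "S n = (\<Sum>n=1..n. if prime n then \<psi> n * of_real (ln (real n)) else 0)" for n
  \<comment> \<open>The factor 2 of Abel summation and the division by \<open>c\<close> turn this
    into \<open>e / 2\<close>.\<close>
  define \<delta> where "\<delta> = e * c / 4"
  have \<delta>: "\<delta> > 0" using e c by (simp add: \<delta>_def)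
  obtain M where M: "\<And>n. n \<ge> M \<Longrightarrow> norm (S n) / real n < \<delta>"
    using LIMSEQ_D[OF prime_character_mean_tendsto_0[OF \<psi>] \<delta>] by (auto simp: S_def)
  define C where "C = (\<Sum>n<Suc M. norm (S n))"
  have C: "C \<ge> 0" unfolding C_def by (intro sum_nonneg) auto
  have Sb: "norm (S n) \<le> \<delta> * real N + C" if "n \<le> N" for n N
  proof (cases "n < Suc M")
    case True
    then have "norm (S n) \<le> C" unfolding C_def by (intro member_le_sum) auto
    then show ?thesis using \<delta> by (simp add: add_increasing)
  next
    case False
    then have "norm (S n) \<le> \<delta> * real n" using M[of n] by (simp add: field_simps)
    also have "\<dots> \<le> \<delta> * real N" using that \<delta> by simp
    finally show ?thesis using C by simp
  qed
  have "(\<lambda>N. 2 * (\<delta> + C / real N) / c) \<longlonglongrightarrow> 2 * (\<delta> + 0) / c"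
    by (intro tendsto_intros) (use c in \<open>auto intro!: real_tendsto_divide_at_top filterlim_real_sequentially\<close>)
  moreover have "2 * (\<delta> + 0) / c < e" using e c by (simp add: \<delta>_def)
  ultimately have "eventually (\<lambda>N. 2 * (\<delta> + C / real N) / c < e) sequentially" by (rule order_tendstoD)
  then have "eventually (\<lambda>N. norm ((\<Sum>p | prime p \<and> p \<le> N. \<psi> p * of_real (prime_weight k p)) / of_real (weight_total k N) - 0) < e) sequentially"
    using c(2) eventually_ge_at_top[of 2] eventually_weight_total_pos[of k]
  proof eventually_elim
    case (elim N)
    have lnN: "ln (real N) > 0" using elim(3) by simp
    have "(\<Sum>p | prime p \<and> p \<le> N. \<psi> p * of_real (prime_weight k p))
        = (\<Sum>n=1..N. (if prime n then \<psi> n * of_real (ln (real n)) else 0) * of_real (prime_weight k n / ln (real n)))"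
      unfolding sum_primes_le_conv
    proof (intro sum.cong refl)
      fix n
      show "(if prime n then \<psi> n * of_real (prime_weight k n) else 0) =
         (if prime n then \<psi> n * of_real (ln (real n)) else 0) * of_real (prime_weight k n / ln (real n))"
        using prime_gt_1_nat[of n] by auto
    qed
    also have "norm \<dots> \<le> 2 * (\<delta> * real N + C) * (prime_weight k N / ln (real N))"
      by (rule norm_abel_sum_le)
        (use weight_quotient_mono Sb C \<delta> elim in \<open>auto simp: S_def prime_weight_def\<close>)
    also have "\<dots> \<le> 2 * (\<delta> * real N + C) * (real N ^ k * real N / ln (real N))"
      using C \<delta> lnN unfolding prime_weight_def by (intro mult_left_mono divide_right_mono) auto
    also have "\<dots> = 2 * (\<delta> + C / real N) / c * (c * real N ^ (k + 2) / ln (real N))"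
      using c elim(3) by (simp add: field_simps power2_eq_square)
    also have "\<dots> \<le> 2 * (\<delta> + C / real N) / c * weight_total k N"
      using elim(2) C \<delta> c by (intro mult_left_mono) auto
    also have "\<dots> < e * weight_total k N"
      using elim by (intro mult_strict_right_mono) auto
    finally show ?case using elim(4) by (simp add: norm_divide divide_less_eq)
  qed
  then show "\<exists>no. \<forall>n\<ge>no. norm ((\<Sum>p | prime p \<and> p \<le> n. \<psi> p * of_real (prime_weight k p)) / of_real (weight_total k n) - 0) < e"
    by (simp only: eventually_sequentially)
qed

section \<open>Rules for prime means\<close>

lemma has_prime_mean_const: "has_prime_mean k (\<lambda>_. a) a"
proof -
  have "eventually (\<lambda>N. (\<Sum>p | prime p \<and> p \<le> N. a * of_real (prime_weight k p)) / of_real (weight_total k N) = a) sequentially"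
    using eventually_weight_total_pos[of k]
  proof eventually_elim
    case (elim N)
    have "(\<Sum>p | prime p \<and> p \<le> N. a * of_real (prime_weight k p)) = a * of_real (weight_total k N)"
      by (simp add: weight_total_def sum_distrib_left)
    then show ?case using elim by simp
  qed
  then show ?thesis unfolding has_prime_mean_def by (rule tendsto_eventually)
qed

lemma has_prime_mean_add:
  "has_prime_mean k f a \<Longrightarrow> has_prime_mean k g b \<Longrightarrow> has_prime_mean k (\<lambda>n. f n + g n) (a + b)"
  unfolding has_prime_mean_def by (drule (1) tendsto_add) (simp add: sum.distrib ring_distribs add_divide_distrib)

lemma has_prime_mean_cmult:
  "has_prime_mean k f a \<Longrightarrow> has_prime_mean k (\<lambda>n. c * f n) (c * a)"
  unfolding has_prime_mean_def by (drule tendsto_mult_left[of _ _ _ c]) (simp add: sum_distrib_left mult.assoc)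

lemma has_prime_mean_sum:
  assumes "\<And>i. i \<in> I \<Longrightarrow> has_prime_mean k (f i) (a i)"
  shows "has_prime_mean k (\<lambda>n. \<Sum>i\<in>I. f i n) (\<Sum>i\<in>I. a i)"
  using assms
  by (induction I rule: infinite_finite_induct) (auto intro: has_prime_mean_add has_prime_mean_const)

text \<open>Finitely many primes contribute a fixed amount \<open>D\<close>, while the total weight
  tends to infinity.\<close>

lemma has_prime_mean_cong_large:
  assumes f: "has_prime_mean k f a" and eq: "\<And>p. prime p \<Longrightarrow> p > M \<Longrightarrow> f p = g p"
  shows "has_prime_mean k g a"
proof -
  define D where "D = (\<Sum>p | prime p \<and> p \<le> M. (g p - f p) * of_real (prime_weight k p))"
  have "(\<lambda>N. D / of_real (weight_total k N)) \<longlonglongrightarrow> 0"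
  proof (rule tendsto_norm_zero_cancel)
    have "(\<lambda>N. norm D / weight_total k N) \<longlonglongrightarrow> 0"
      by (rule real_tendsto_divide_at_top[OF tendsto_const weight_total_at_top])
    then have "(\<lambda>N. \<bar>norm D / weight_total k N\<bar>) \<longlonglongrightarrow> 0" by (rule tendsto_rabs_zero)
    then show "(\<lambda>N. norm (D / of_real (weight_total k N))) \<longlonglongrightarrow> 0" by (simp add: norm_divide)
  qed
  then have "(\<lambda>N. (\<Sum>p | prime p \<and> p \<le> N. f p * of_real (prime_weight k p)) / of_real (weight_total k N) + D / of_real (weight_total k N)) \<longlonglongrightarrow> a + 0"
    using f unfolding has_prime_mean_def by (intro tendsto_add)
  moreover have "eventually (\<lambda>N. (\<Sum>p | prime p \<and> p \<le> N. f p * of_real (prime_weight k p)) / of_real (weight_total k N) + D / of_real (weight_total k N)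
      = (\<Sum>p | prime p \<and> p \<le> N. g p * of_real (prime_weight k p)) / of_real (weight_total k N)) sequentially"
    using eventually_ge_at_top[of M]
  proof eventually_elim
    case (elim N)
    have "D = (\<Sum>p | prime p \<and> p \<le> N. (g p - f p) * of_real (prime_weight k p))"
      unfolding D_def using elim eq by (intro sum.mono_neutral_left) (auto simp: not_le)
    then show ?case by (simp add: add_divide_distrib[symmetric] sum.distrib[symmetric] ring_distribs)
  qed
  ultimately show ?thesis
    unfolding has_prime_mean_def by (simp add: Lim_transform_eventually)
qed

section \<open>Truncation of the totient quotient\<close>

definition totient_trunc :: "nat \<Rightarrow> nat \<Rightarrow> real" where
  "totient_trunc Q n = (\<Prod>q | prime q \<and> q \<le> Q \<and> q dvd n. 1 - 1 / real q)"

definition large_prime_divisor_sum :: "nat \<Rightarrow> nat \<Rightarrow> real" where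
  "large_prime_divisor_sum Q n = (\<Sum>q | prime q \<and> Q < q \<and> q dvd n. 1 / real q)"

text \<open>The omitted factor is a product of \<open>1 - 1 / q\<close> over large primes, which
  lies between \<open>1 - large_prime_divisor_sum Q n\<close> and 1 by Weierstrass' product
  inequality.\<close>

lemma totient_trunc_bounds:
  assumes n: "n > 0"
  shows "real (totient n) / real n \<le> totient_trunc Q n"
    "totient_trunc Q n - real (totient n) / real n \<le> large_prime_divisor_sum Q n"
    "0 \<le> totient_trunc Q n" "totient_trunc Q n \<le> 1"
proof -
  define A where "A = {q. prime q \<and> q \<le> Q \<and> q dvd n}"
  define B where "B = {q. prime q \<and> Q < q \<and> q dvd n}"
  have fin: "finite A" "finite B"
    using n by (auto simp: A_def B_def intro: finite_subset[of _ "{..n}"] dest: dvd_imp_le)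
  have un: "prime_factors n = A \<union> B" using n by (auto simp: prime_factors_dvd A_def B_def)
  have "real (totient n) / real n = (\<Prod>q\<in>prime_factors n. 1 - 1 / real q)"
    using totient_formula2[of n] n by simp
  also have "\<dots> = (\<Prod>q\<in>A. 1 - 1 / real q) * (\<Prod>q\<in>B. 1 - 1 / real q)"
    unfolding un using fin by (intro prod.union_disjoint) (auto simp: A_def B_def)
  finally have eq: "real (totient n) / real n = totient_trunc Q n * (\<Prod>q\<in>B. 1 - 1 / real q)"
    by (simp add: totient_trunc_def A_def)
  have u: "0 \<le> 1 - 1 / real q \<and> 1 - 1 / real q \<le> 1" if "q \<in> A \<union> B" for q
    using that by (auto simp: A_def B_def dest!: prime_gt_0_nat)
  show t: "0 \<le> totient_trunc Q n" "totient_trunc Q n \<le> 1"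
    unfolding totient_trunc_def A_def[symmetric] using u by (auto intro!: prod_nonneg prod_le_1)
  have b: "(\<Prod>q\<in>B. 1 - 1 / real q) \<le> 1" using u by (intro prod_le_1) auto
  show "real (totient n) / real n \<le> totient_trunc Q n"
    unfolding eq using mult_left_mono[OF b t(1)] by simp
  have "1 - large_prime_divisor_sum Q n \<le> (\<Prod>q\<in>B. 1 - 1 / real q)"
    unfolding large_prime_divisor_sum_def B_def[symmetric]
    by (rule Weierstrass_prod_ineq) (use u in fastforce)
  then have l: "1 - (\<Prod>q\<in>B. 1 - 1 / real q) \<le> large_prime_divisor_sum Q n" by simp
  have "totient_trunc Q n - real (totient n) / real n = totient_trunc Q n * (1 - (\<Prod>q\<in>B. 1 - 1 / real q))"
    unfolding eq by (simp add: algebra_simps)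
  also have "\<dots> \<le> 1 * (1 - (\<Prod>q\<in>B. 1 - 1 / real q))"
    using t b by (intro mult_right_mono) auto
  finally show "totient_trunc Q n - real (totient n) / real n \<le> large_prime_divisor_sum Q n"
    using l by simp
qed

lemma prime_mod_eq_1_iff_dvd:
  fixes p q :: nat
  assumes "prime p" "prime q"
  shows "q dvd p - 1 \<longleftrightarrow> p mod q = 1"
proof -
  have "p \<ge> 1" "q > 1" using prime_ge_1_nat[OF assms(1)] prime_gt_1_nat[OF assms(2)] by auto
  moreover from this have "[p = 1] (mod q) \<longleftrightarrow> q dvd p - 1" by (intro cong_altdef_nat)
  ultimately show ?thesis by (simp add: cong_def)
qed

text \<open>After exchanging the sums, a prime \<open>q\<close> contributes at most
  \<open>6 * N * ln q / q^2\<close>. With \<open>ln q <= 2 * sqrt q\<close> this is at most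
  \<open>12 * N * q powr (-3/2)\<close>, whose sum over \<open>q > Q\<close> converges uniformly in
  \<open>N\<close>.\<close>

lemma sum_ln_large_prime_divisor_sum_le:
  assumes Q: "Q > 0"
  shows "(\<Sum>p | prime p \<and> p \<le> N. ln (real p) * large_prime_divisor_sum Q (p - 1)) \<le> 24 * real N / sqrt (real Q)"
proof -
  let ?P = "{p. prime p \<and> p \<le> N}"
  define R where "R = {q. prime q \<and> Q < q \<and> q \<le> N}"
  have finR: "finite R" by (rule finite_subset[of _ "{..N}"]) (auto simp: R_def)
  have "(\<Sum>p\<in>?P. ln (real p) * large_prime_divisor_sum Q (p - 1)) = (\<Sum>p\<in>?P. \<Sum>q\<in>R. if p mod q = 1 then ln (real p) / real q else 0)"
  proof (rule sum.cong[OF refl])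
    fix p assume p: "p \<in> ?P"
    have p1: "p - 1 > 0" using p by (auto dest: prime_gt_1_nat)
    have "{q. prime q \<and> Q < q \<and> q dvd p - 1} = {q\<in>R. p mod q = 1}"
    proof (intro Set.set_eqI iffI)
      fix q assume q: "q \<in> {q. prime q \<and> Q < q \<and> q dvd p - 1}"
      then have "q \<le> p - 1" using p1 by (auto dest: dvd_imp_le)
      then have "q \<le> N" using p by auto
      then show "q \<in> {q\<in>R. p mod q = 1}" using q p prime_mod_eq_1_iff_dvd[of p q] by (auto simp: R_def)
    next
      fix q assume "q \<in> {q\<in>R. p mod q = 1}"
      then show "q \<in> {q. prime q \<and> Q < q \<and> q dvd p - 1}" using p prime_mod_eq_1_iff_dvd[of p q] by (auto simp: R_def)
    qed
    then have "ln (real p) * large_prime_divisor_sum Q (p - 1) = (\<Sum>q\<in>{q\<in>R. p mod q = 1}. ln (real p) / real q)"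
      by (simp add: large_prime_divisor_sum_def sum_distrib_left)
    also have "\<dots> = (\<Sum>q\<in>R. if p mod q = 1 then ln (real p) / real q else 0)"
      by (rule sum.inter_filter[OF finR])
    finally show "ln (real p) * large_prime_divisor_sum Q (p - 1) = (\<Sum>q\<in>R. if p mod q = 1 then ln (real p) / real q else 0)" .
  qed
  also have "\<dots> = (\<Sum>q\<in>R. \<Sum>p\<in>?P. if p mod q = 1 then ln (real p) / real q else 0)" by (rule sum.swap)
  also have "\<dots> \<le> (\<Sum>q\<in>R. 12 * real N * real q powr (-1 - 1/2))"
  proof (rule sum_mono)
    fix q assume q: "q \<in> R"
    then have q1: "real q > 1" and pq: "prime q" by (auto simp: R_def dest: prime_gt_1_nat)
    have "(\<Sum>p\<in>?P. if p mod q = 1 then ln (real p) / real q else 0) = (\<Sum>p | p \<in> ?P \<and> p mod q = 1. ln (real p) / real q)"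
      by (rule sum.inter_filter[symmetric]) simp
    also have "\<dots> = (\<Sum>p | prime p \<and> p \<le> N \<and> p mod q = 1. ln (real p)) / real q"
      by (simp add: sum_divide_distrib conj_assoc)
    also have "\<dots> \<le> (6 * real N * ln (real q) / real q) / real q"
      using prime_theta_cong_1_le[OF pq, of N] by (intro divide_right_mono) auto
    also have "\<dots> \<le> (6 * real N * (2 * sqrt (real q)) / real q) / real q"
    proof (intro divide_right_mono mult_left_mono)
      have "ln (sqrt (real q)) \<le> sqrt (real q) - 1" using q1 by (intro ln_le_minus_one) auto
      then show "ln (real q) \<le> 2 * sqrt (real q)" using q1 by (simp add: ln_sqrt)
    qed auto
    also have "\<dots> = 12 * real N * (real q powr (1/2) * real q powr (-2))"
      using q1 by (simp add: powr_half_sqrt powr_minus_divide power2_eq_square)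
    also have "real q powr (1/2) * real q powr (-2) = real q powr (-1 - 1/2)"
      by (simp only: powr_add[symmetric]) simp
    finally show "(\<Sum>p\<in>?P. if p mod q = 1 then ln (real p) / real q else 0) \<le> 12 * real N * real q powr (-1 - 1/2)" .
  qed
  also have "\<dots> = 12 * real N * (\<Sum>q\<in>R. real q powr (-1 - 1/2))" by (simp add: sum_distrib_left)
  also have "(\<Sum>q\<in>R. real q powr (-1 - 1/2)) \<le> real Q powr (-(1/2)) / (1/2)"
  proof -
    have "(\<Sum>q\<in>R. real q powr (-1 - 1/2)) \<le> (\<Sum>q\<in>{Suc Q..<Suc Q + N}. real q powr (-1 - 1/2))"
      by (rule sum_mono2) (auto simp: R_def)
    also have "\<dots> = (\<Sum>n<N. real (n + Suc Q) powr (-1 - 1/2))"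
      by (rule sum.reindex_bij_witness[of _ "\<lambda>n. n + Suc Q" "\<lambda>q. q - Suc Q"]) auto
    also have "\<dots> \<le> (\<Sum>n. real (n + Suc Q) powr (-1 - 1/2))"
      by (rule sum_le_suminf) (use sum_powr_tail[of "1/2" Q] Q in auto)
    also have "\<dots> \<le> real Q powr (-(1/2)) / (1/2)" by (rule sum_powr_tail) (use Q in auto)
    finally show ?thesis .
  qed
  also have "real Q powr (-(1/2)) / (1/2) = 2 / sqrt (real Q)"
    by (simp add: powr_minus_divide powr_half_sqrt)
  finally show ?thesis by (simp add: mult_left_mono)
qed

text \<open>The bound for the error and the lower bound for \<open>weight_total\<close> have the
  same order in \<open>N\<close>, so their quotient is a constant times \<open>1 / sqrt Q\<close>,
  and \<open>Q0\<close> can be chosen before \<open>N\<close>.\<close>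

lemma eventually_large_prime_divisor_mean_less:
  assumes e: "e > 0"
  obtains Q0 where "\<And>Q. Q \<ge> Q0 \<Longrightarrow> eventually (\<lambda>N. (\<Sum>p | prime p \<and> p \<le> N. large_prime_divisor_sum Q (p - 1) * prime_weight k p) < e * weight_total k N) sequentially"
proof -
  obtain c where c: "c > 0" "eventually (\<lambda>N. weight_total k N \<ge> c * real N ^ (k + 2) / ln (real N)) sequentially"
    by (rule eventually_weight_total_ge)
  have "(\<lambda>Q. 24 / sqrt (real Q) / c) \<longlonglongrightarrow> 0" using c(1) by real_asymp
  then have "eventually (\<lambda>Q. 24 / sqrt (real Q) / c < e) sequentially" by (rule order_tendstoD) (rule e)
  then obtain Q0 where Q0: "\<And>Q. Q \<ge> Q0 \<Longrightarrow> 24 / sqrt (real Q) / c < e" by (auto simp: eventually_sequentially)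
  show ?thesis
  proof (rule that[of "Suc Q0"])
    fix Q assume Q: "Q \<ge> Suc Q0"
    show "eventually (\<lambda>N. (\<Sum>p | prime p \<and> p \<le> N. large_prime_divisor_sum Q (p - 1) * prime_weight k p) < e * weight_total k N) sequentially"
      using c(2) eventually_ge_at_top[of 2] eventually_weight_total_pos[of k]
    proof eventually_elim
      case (elim N)
      define v where "v n = prime_weight k n / ln (real n)" for n
      have vmono: "v p \<le> v N" if "1 \<le> p" "p \<le> N" for p
        using that(2,1)
      proof (induction N rule: dec_induct)
        case (step n)
        then show ?case using weight_quotient_mono[of n k] by (simp add: v_def)
      qed simp
      have lnN: "ln (real N) > 0" using elim(2) by simp
      have v0: "v N \<ge> 0" unfolding v_def using elim(2) by (intro divide_nonneg_nonneg prime_weight_nonneg) auto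
      have E0: "large_prime_divisor_sum Q n \<ge> 0" for n
        unfolding large_prime_divisor_sum_def by (intro sum_nonneg) auto
      have "(\<Sum>p | prime p \<and> p \<le> N. large_prime_divisor_sum Q (p - 1) * prime_weight k p)
          \<le> (\<Sum>p | prime p \<and> p \<le> N. v N * (ln (real p) * large_prime_divisor_sum Q (p - 1)))"
      proof (rule sum_mono)
        fix p assume p: "p \<in> {p. prime p \<and> p \<le> N}"
        then have lp: "ln (real p) > 0" by (auto dest: prime_gt_1_nat)
        have "prime_weight k p = v p * ln (real p)" using lp by (simp add: v_def)
        also have "\<dots> \<le> v N * ln (real p)"
          using vmono[of p] p lp by (intro mult_right_mono) (auto dest: prime_ge_1_nat)
        finally have "large_prime_divisor_sum Q (p - 1) * prime_weight k p \<le> large_prime_divisor_sum Q (p - 1) * (v N * ln (real p))"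
          using E0 by (intro mult_left_mono)
        then show "large_prime_divisor_sum Q (p - 1) * prime_weight k p \<le> v N * (ln (real p) * large_prime_divisor_sum Q (p - 1))"
          by (simp add: mult_ac)
      qed
      also have "\<dots> = v N * (\<Sum>p | prime p \<and> p \<le> N. ln (real p) * large_prime_divisor_sum Q (p - 1))"
        by (rule sum_distrib_left[symmetric])
      also have "\<dots> \<le> v N * (24 * real N / sqrt (real Q))"
        using v0 Q by (intro mult_left_mono sum_ln_large_prime_divisor_sum_le) auto
      also have "\<dots> \<le> (real N ^ k * real N / ln (real N)) * (24 * real N / sqrt (real Q))"
        unfolding v_def prime_weight_def using lnN
        by (intro mult_right_mono divide_right_mono mult_left_mono) auto
      also have "\<dots> = 24 / sqrt (real Q) / c * (c * real N ^ (k + 2) / ln (real N))"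
        using c(1) by (simp add: power2_eq_square mult_ac)
      also have "\<dots> \<le> 24 / sqrt (real Q) / c * weight_total k N"
        using elim(1) c(1) by (intro mult_left_mono) auto
      also have "\<dots> < e * weight_total k N"
        using Q0[of Q] Q elim(3) by (intro mult_strict_right_mono) auto
      finally show ?case .
    qed
  qed
qed

text \<open>Justifies exchanging the limits in \<open>Q\<close> and \<open>N\<close>: the truncation
  error is small for large \<open>Q\<close> uniformly in all large \<open>N\<close>. Each of the
  three approximations takes a share \<open>e / 3\<close>.\<close>

theorem has_prime_mean_totient:
  assumes g: "\<And>p. prime p \<Longrightarrow> norm (g p) \<le> 1"
    and mean: "\<And>Q. has_prime_mean k (\<lambda>p. g p * of_real (totient_trunc Q (p - 1))) (a Q)"
    and lim: "a \<longlonglongrightarrow> L"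
  shows "has_prime_mean k (\<lambda>p. g p * of_real (real (totient (p - 1)) / real (p - 1))) L"
  unfolding has_prime_mean_def
proof (rule LIMSEQ_I)
  fix e :: real assume e: "e > 0"
  define t where "t p = real (totient (p - 1)) / real (p - 1)" for p
  define M where "M f N = (\<Sum>p | prime p \<and> p \<le> N. f p * of_real (prime_weight k p)) / of_real (weight_total k N)" for f :: "nat \<Rightarrow> complex" and N
  obtain Q0 where Q0: "\<And>Q. Q \<ge> Q0 \<Longrightarrow> eventually (\<lambda>N. (\<Sum>p | prime p \<and> p \<le> N. large_prime_divisor_sum Q (p - 1) * prime_weight k p) < (e / 3) * weight_total k N) sequentially"
    using eventually_large_prime_divisor_mean_less[of "e / 3" k] e by auto
  obtain Q1 where Q1: "\<And>Q. Q \<ge> Q1 \<Longrightarrow> norm (a Q - L) < e / 3"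
    using LIMSEQ_D[OF lim, of "e / 3"] e by auto
  define Q where "Q = max Q0 Q1"
  have "eventually (\<lambda>N. norm (M (\<lambda>p. g p * of_real (totient_trunc Q (p - 1))) N - a Q) < e / 3) sequentially"
    using LIMSEQ_D[OF mean[of Q, unfolded has_prime_mean_def], of "e / 3"] e
    unfolding M_def by (auto simp: eventually_sequentially)
  then have "eventually (\<lambda>N. norm (M (\<lambda>p. g p * of_real (t p)) N - L) < e) sequentially"
    using Q0[of Q, unfolded Q_def, OF max.cobounded1, folded Q_def] eventually_weight_total_pos[of k]
  proof eventually_elim
    case (elim N)
    have W: "norm (complex_of_real (weight_total k N)) = weight_total k N" using elim(3) by simp
    have "M (\<lambda>p. g p * of_real (t p)) N - M (\<lambda>p. g p * of_real (totient_trunc Q (p - 1))) N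
        = (\<Sum>p | prime p \<and> p \<le> N. g p * of_real (t p - totient_trunc Q (p - 1)) * of_real (prime_weight k p)) / of_real (weight_total k N)"
      unfolding M_def diff_divide_distrib[symmetric] sum_subtractf[symmetric] by (simp add: algebra_simps)
    also have "norm \<dots> = norm (\<Sum>p | prime p \<and> p \<le> N. g p * of_real (t p - totient_trunc Q (p - 1)) * of_real (prime_weight k p)) / weight_total k N"
      by (simp only: norm_divide W)
    also have "\<dots> \<le> (\<Sum>p | prime p \<and> p \<le> N. large_prime_divisor_sum Q (p - 1) * prime_weight k p) / weight_total k N"
    proof (intro divide_right_mono sum_norm_le)
      fix p assume p: "p \<in> {p. prime p \<and> p \<le> N}"
      then have p1: "p > 1" "norm (g p) \<le> 1" using g by (auto dest: prime_gt_1_nat)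
      have "\<bar>t p - totient_trunc Q (p - 1)\<bar> \<le> large_prime_divisor_sum Q (p - 1)"
        using totient_trunc_bounds(1,2)[of "p - 1" Q] p1 unfolding t_def by linarith
      then have "norm (g p) * \<bar>t p - totient_trunc Q (p - 1)\<bar> \<le> 1 * large_prime_divisor_sum Q (p - 1)"
        using p1 by (intro mult_mono) auto
      then show "norm (g p * of_real (t p - totient_trunc Q (p - 1)) * of_real (prime_weight k p)) \<le> large_prime_divisor_sum Q (p - 1) * prime_weight k p"
        unfolding norm_mult norm_of_real using prime_weight_nonneg[of p k] p1 by (simp add: mult_right_mono)
    qed (use elim(3) in simp)
    also have "\<dots> < e / 3" using elim(2,3) by (simp add: divide_less_eq)
    finally have "norm (M (\<lambda>p. g p * of_real (t p)) N - M (\<lambda>p. g p * of_real (totient_trunc Q (p - 1))) N) < e / 3" .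
    moreover have "norm (a Q - L) < e / 3" by (rule Q1) (simp add: Q_def)
    ultimately show ?case using elim(1)
      norm_triangle_ineq[of "M (\<lambda>p. g p * of_real (t p)) N - M (\<lambda>p. g p * of_real (totient_trunc Q (p - 1))) N" "M (\<lambda>p. g p * of_real (totient_trunc Q (p - 1))) N - a Q"]
      norm_triangle_ineq[of "M (\<lambda>p. g p * of_real (t p)) N - a Q" "a Q - L"] by simp
  qed
  then show "\<exists>no. \<forall>n\<ge>no. norm ((\<Sum>p | prime p \<and> p \<le> n. g p * of_real (real (totient (p - 1)) / real (p - 1)) * of_real (prime_weight k p)) / of_real (weight_total k n) - L) < e"
    unfolding M_def t_def by (simp only: eventually_sequentially)
qed

section \<open>Characters modulo coprime moduli\<close>

definition dirichlet_character :: "nat \<Rightarrow> (nat \<Rightarrow> complex) \<Rightarrow> bool" where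
  "dirichlet_character M \<psi> \<longleftrightarrow> M > 0 \<and> completely_multiplicative \<psi> \<and> (\<forall>n. \<psi> (n + M) = \<psi> n) \<and>
     (\<forall>n. coprime n M \<longrightarrow> norm (\<psi> n) = 1) \<and> (\<forall>n. \<not> coprime n M \<longrightarrow> \<psi> n = 0)"

definition principal_character :: "nat \<Rightarrow> (nat \<Rightarrow> complex) \<Rightarrow> bool" where
  "principal_character M \<psi> \<longleftrightarrow> (\<forall>n. coprime n M \<longrightarrow> \<psi> n = 1)"

lemma dirichlet_characterD:
  assumes "dirichlet_character M \<psi>"
  shows "M > 0" "completely_multiplicative \<psi>" "\<psi> (n + M) = \<psi> n"
    "coprime n M \<Longrightarrow> norm (\<psi> n) = 1" "\<not> coprime n M \<Longrightarrow> \<psi> n = 0"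
    "\<psi> (a * b) = \<psi> a * \<psi> b" "\<psi> (Suc 0) = 1"
  using assms by (auto simp: dirichlet_character_def completely_multiplicative_def)

lemma dirichlet_character_mod:
  assumes "dirichlet_character M \<psi>"
  shows "\<psi> (n mod M) = \<psi> n"
proof -
  have "\<psi> (n mod M + k * M) = \<psi> (n mod M)" for k
  proof (induction k)
    case (Suc k)
    have "\<psi> (n mod M + Suc k * M) = \<psi> ((n mod M + k * M) + M)" by (simp add: add_ac)
    then show ?case using Suc dirichlet_characterD(3)[OF assms] by simp
  qed simp
  from this[of "n div M"] show ?thesis by simp
qed

lemma dirichlet_character_cong:
  assumes "dirichlet_character M \<psi>" "[a = b] (mod M)"
  shows "\<psi> a = \<psi> b"
  using dirichlet_character_mod[OF assms(1), of a] dirichlet_character_mod[OF assms(1), of b] assms(2)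
  by (simp add: cong_def)

text \<open>Multiplication by a unit \<open>a\<close> permutes the residues, so the sum over a
  period is fixed under multiplication by \<open>\<psi> a\<close>; with \<open>\<psi> a\<close>
  different from 1 it vanishes.\<close>

lemma nonprincipal_characterI:
  assumes \<psi>: "dirichlet_character M \<psi>" and np: "\<not> principal_character M \<psi>"
  shows "nonprincipal_character M \<psi>"
proof -
  note d = dirichlet_characterD[OF \<psi>]
  obtain a where a: "coprime a M" "\<psi> a \<noteq> 1" using np by (auto simp: principal_character_def)
  have inj: "inj_on (\<lambda>n. a * n mod M) {..<M}"
  proof (rule inj_onI)
    fix x y assume xy: "x \<in> {..<M}" "y \<in> {..<M}" "a * x mod M = a * y mod M"
    then have "[a * x = a * y] (mod M)" by (simp add: cong_def)
    then have "[x = y] (mod M)" using a(1) by (simp add: cong_mult_lcancel_nat)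
    then show "x = y" using xy by (simp add: cong_def)
  qed
  have "(\<lambda>n. a * n mod M) ` {..<M} = {..<M}"
    by (rule endo_inj_surj[OF _ _ inj]) (use d(1) in auto)
  then have "(\<Sum>n<M. \<psi> n) = (\<Sum>n<M. \<psi> (a * n mod M))"
    using sum.reindex[OF inj, of \<psi>] by (simp add: o_def)
  also have "\<dots> = \<psi> a * (\<Sum>n<M. \<psi> n)"
    by (simp add: dirichlet_character_mod[OF \<psi>] d(6) sum_distrib_left)
  finally have "(\<Sum>n<M. \<psi> n) = 0" using a(2) by simp
  moreover have "(\<Sum>n\<in>{1..M}. \<psi> n) = (\<Sum>n<M. \<psi> n)"
    by (rule sum.reindex_bij_witness[of _ "\<lambda>n. if n = 0 then M else n" "\<lambda>n. if n = M then 0 else n"])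
      (use d(1) d(3)[of 0] in auto)
  ultimately have "zero_mean_periodic M \<psi>" using d(1,3) by (simp add: zero_mean_periodic_def)
  then show ?thesis unfolding nonprincipal_character_def using d(2,4,5) by blast
qed

lemma dirichlet_character_prime_mean:
  assumes \<psi>: "dirichlet_character M \<psi>"
  shows "has_prime_mean k \<psi> (if principal_character M \<psi> then 1 else 0)"
proof (cases "principal_character M \<psi>")
  case True
  have "has_prime_mean k \<psi> 1"
  proof (rule has_prime_mean_cong_large[OF has_prime_mean_const])
    fix p assume p: "prime p" "p > M"
    then have "\<not> p dvd M" using dirichlet_characterD(1)[OF \<psi>] by (auto dest: dvd_imp_le)
    then have "coprime p M" using p by (simp add: prime_imp_coprime)
    then show "1 = \<psi> p" using True by (simp add: principal_character_def)
  qed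
  then show ?thesis using True by simp
next
  case False
  then show ?thesis using nonprincipal_character_prime_mean[OF nonprincipal_characterI[OF \<psi> False]] by simp
qed

lemma dirichlet_character_mult:
  assumes "dirichlet_character M \<psi>" "dirichlet_character N \<phi>"
  shows "dirichlet_character (M * N) (\<lambda>n. \<psi> n * \<phi> n)"
proof -
  note d = dirichlet_characterD[OF assms(1)] and e = dirichlet_characterD[OF assms(2)]
  have "\<psi> (n + M * N) = \<psi> n" "\<phi> (n + M * N) = \<phi> n" for n
    by (rule dirichlet_character_cong[OF assms(1)], simp add: cong_def)
       (rule dirichlet_character_cong[OF assms(2)], simp add: cong_def)
  then show ?thesis
    using d e unfolding dirichlet_character_def
    by (auto simp: completely_multiplicative_mult norm_mult coprime_mult_right_iff)
qed

text \<open>A primitive root identifies the units modulo \<open>q\<close> with the exponents modulo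
  \<open>q - 1\<close>; the characters are the powers of a root of unity in that exponent.
  \<open>c u\<close> is the discrete Fourier transform of \<open>u\<close>, so its entry at 0 is the
  mean of \<open>u\<close>.\<close>

lemma prime_character_family:
  assumes q: "prime q"
  obtains \<chi>0 :: "nat \<Rightarrow> nat \<Rightarrow> complex" and c :: "(nat \<Rightarrow> complex) \<Rightarrow> nat \<Rightarrow> complex"
  where "\<And>j. dirichlet_character q (\<chi>0 j)"
    "\<And>j. j < q - 1 \<Longrightarrow> principal_character q (\<chi>0 j) \<longleftrightarrow> j = 0"
    "\<And>u n. coprime n q \<Longrightarrow> u (n mod q) = (\<Sum>j<q - 1. c u j * \<chi>0 j n)"
    "\<And>u. c u 0 = (\<Sum>a\<in>{1..<q}. u a) / of_nat (q - 1)"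
proof -
  have q1: "q > 1" using q by (rule prime_gt_1_nat)
  have tq: "totient q = q - 1" using q by (simp add: totient_prime)
  obtain g where g: "residue_primroot q g" using prime_primitive_root_exists[OF q1 q] by blast
  have gc: "coprime q g" "ord q g = q - 1" using g tq by (auto simp: residue_primroot_def)
  have bij: "bij_betw (\<lambda>i. g ^ i mod q) {..<q - 1} (totatives q)"
    using residue_primroot_is_generator[OF q1 g] tq by simp
  have tot: "totatives q = {1..<q}"
    using q by (auto simp: totatives_prime)
  have mem: "n mod q \<in> totatives q" if "coprime n q" for n
  proof -
    have "n mod q \<noteq> 0"
    proof
      assume "n mod q = 0"
      then have "q dvd n" by (simp add: dvd_eq_mod_eq_0)
      then show False using that q1 by (metis coprime_common_divisor_nat dvd_refl less_irrefl)
    qed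
    then show ?thesis using q1 by (simp add: tot)
  qed
  \<comment> \<open>A discrete logarithm, determined only modulo \<open>q - 1\<close>; any choice
    works because \<open>w\<close> has period \<open>q - 1\<close>.\<close>
  define ind where "ind n = (SOME i. [g ^ i = n] (mod q))" for n
  have ind: "[g ^ ind n = n] (mod q)" if n: "coprime n q" for n
  proof -
    have "n mod q \<in> (\<lambda>i. g ^ i mod q) ` {..<q - 1}"
      unfolding bij_betw_imp_surj_on[OF bij] by (rule mem[OF n])
    then obtain i where "n mod q = g ^ i mod q" by (rule imageE)
    then have "[g ^ i = n] (mod q)" unfolding cong_def by (rule sym)
    then show ?thesis unfolding ind_def by (rule someI)
  qed
  have expo: "[g ^ i = g ^ i'] (mod q) \<longleftrightarrow> [i = i'] (mod (q - 1))" for i i'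
    using order_divides_expdiff[OF gc(1)] gc(2) by simp
  define w where "w = cis (2 * pi / real (q - 1))"
  have r0: "real (q - 1) \<noteq> 0" using q1 by simp
  have wq: "w ^ (q - 1) = 1"
    by (simp only: w_def Complex.DeMoivre times_divide_eq_right nonzero_mult_div_cancel_left[OF r0] cis_2pi)
  have w_cong: "w ^ a = w ^ b" if "[a = b] (mod (q - 1))" for a b
  proof -
    have *: "w ^ a = w ^ (a mod (q - 1))" for a
    proof -
      have "w ^ a = w ^ ((q - 1) * (a div (q - 1)) + a mod (q - 1))" by simp
      also have "\<dots> = w ^ (a mod (q - 1))" unfolding power_add power_mult wq by simp
      finally show ?thesis .
    qed
    show ?thesis using *[of a] *[of b] that by (simp add: cong_def)
  qed
  have w_neq: "w ^ j \<noteq> 1" if "0 < j" "j < q - 1" for j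
  proof
    assume "w ^ j = 1"
    then have "cis (real j * (2 * pi / real (q - 1))) = 1" by (simp add: w_def Complex.DeMoivre)
    then have "cos (real j * (2 * pi / real (q - 1))) = 1" by (simp add: complex_eq_iff)
    then obtain x :: int where "real j * (2 * pi / real (q - 1)) = of_int x * 2 * pi"
      by (auto simp: cos_one_2pi_int)
    moreover have "a = b * r" if "a * (2 * pi / r) = b * 2 * pi" "r \<noteq> 0" for a b r :: real
      using that by (simp add: field_simps)
    ultimately have "real j = of_int x * real (q - 1)" using r0 by blast
    then have "int j = x * int (q - 1)" by (metis of_int_eq_iff of_int_mult of_int_of_nat_eq)
    then have "(q - 1) dvd j" by (metis dvd_triv_right int_dvd_int_iff)
    then show False using that by (auto dest: dvd_imp_le)
  qed
  have wnorm: "norm w = 1" by (simp add: w_def)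
  have w0: "w \<noteq> 0" using wnorm by auto
  define X where "X j n = (if coprime n q then w ^ (j * ind n) else 0)" for j n
  have ind_unique: "X j n = w ^ (j * i)" if "coprime n q" "[g ^ i = n] (mod q)" for j n i
  proof -
    have "[g ^ ind n = g ^ i] (mod q)" using ind[OF that(1)] that(2) by (simp add: cong_def)
    then have "[j * ind n = j * i] (mod (q - 1))" by (simp add: expo cong_scalar_left)
    then show ?thesis using that(1) by (simp add: X_def w_cong)
  qed
  have char: "dirichlet_character q (X j)" for j
    unfolding dirichlet_character_def completely_multiplicative_def
  proof (intro conjI allI impI)
    show "X j 1 = 1" using ind_unique[of 1 0 j] by simp
    show "X j (a * b) = X j a * X j b" for a b
    proof (cases "coprime a q \<and> coprime b q")
      case True
      have "[g ^ (ind a + ind b) = a * b] (mod q)"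
        unfolding power_add using True by (intro cong_mult ind) auto
      then have "X j (a * b) = w ^ (j * (ind a + ind b))"
        using True by (intro ind_unique) auto
      then show ?thesis using True by (simp add: X_def power_add distrib_left)
    next
      case False
      then have "\<not> coprime (a * b) q" using coprime_mult_left_iff by blast
      then have "X j (a * b) = 0" by (simp only: X_def if_False)
      moreover have "X j a * X j b = 0" using False by (metis X_def mult_zero_left mult_zero_right)
      ultimately show ?thesis by simp
    qed
    show "X j (n + q) = X j n" for n
    proof (cases "coprime n q")
      case True
      then have "coprime (n + q) q" by (metis coprime_iff_gcd_eq_1 gcd_add1)
      then have "X j (n + q) = w ^ (j * ind n)"
        using ind[OF True] by (intro ind_unique) (auto simp: cong_def)
      then show ?thesis using True by (simp add: X_def)
    next
      case False
      then have "\<not> coprime (n + q) q" by (metis coprime_iff_gcd_eq_1 gcd_add1)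
      then show ?thesis using False by (simp add: X_def)
    qed
  qed (use q1 wnorm in \<open>auto simp: X_def norm_power\<close>)
  have princ: "principal_character q (X j) \<longleftrightarrow> j = 0" if j: "j < q - 1" for j
  proof
    assume p: "principal_character q (X j)"
    have cg: "coprime g q" using gc(1) by (simp add: coprime_commute)
    have "X j g = w ^ (j * 1)" by (rule ind_unique[OF cg]) simp
    then have "w ^ j = 1" using p cg by (simp add: principal_character_def)
    then show "j = 0" using w_neq[of j] j by auto
  qed (simp add: principal_character_def X_def)
  \<comment> \<open>The conjugate of \<open>w ^ (i * j)\<close> is written with the exponent
    \<open>q - 1 - i\<close> in place of \<open>-i\<close>, to stay within natural powers.\<close>
  define c where "c u j = (\<Sum>i<q - 1. u (g ^ i mod q) * w ^ ((q - 1 - i) * j)) / of_nat (q - 1)" for u :: "nat \<Rightarrow> complex" and j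
  have expand: "u (n mod q) = (\<Sum>j<q - 1. c u j * X j n)" if n: "coprime n q" for u n
  proof -
    have "n mod q \<in> (\<lambda>i. g ^ i mod q) ` {..<q - 1}"
      unfolding bij_betw_imp_surj_on[OF bij] by (rule mem[OF n])
    then obtain i0 where i0: "n mod q = g ^ i0 mod q" "i0 \<in> {..<q - 1}" by (rule imageE)
    have Xn: "X j n = w ^ (j * i0)" for j
      by (rule ind_unique[OF n]) (simp only: cong_def i0(1))
    have orth: "(\<Sum>j<q - 1. w ^ ((q - 1 - i) * j) * w ^ (j * i0)) = (if i = i0 then of_nat (q - 1) else 0)"
      if i: "i < q - 1" for i
    proof -
      define z where "z = w ^ (q - 1 - i + i0)"
      have eq: "w ^ ((q - 1 - i) * j) * w ^ (j * i0) = z ^ j" for j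
        unfolding z_def by (simp add: power_add[symmetric] power_mult[symmetric] algebra_simps)
      have sumeq: "(\<Sum>j<q - 1. w ^ ((q - 1 - i) * j) * w ^ (j * i0)) = (\<Sum>j<q - 1. z ^ j)"
        by (simp only: eq)
      have zq: "z ^ (q - 1) = 1" unfolding z_def by (metis mult.commute power_mult power_one wq)
      show ?thesis
      proof (cases "i = i0")
        case True
        then have "z = 1" using i wq by (simp add: z_def)
        then show ?thesis unfolding sumeq using True by simp
      next
        case False
        have "z \<noteq> 1"
        proof (cases "i < i0")
          case True
          then have "z = w ^ (q - 1) * w ^ (i0 - i)" using i by (simp add: z_def power_add[symmetric])
          then show ?thesis using w_neq[of "i0 - i"] True i0 wq by simp
        next
          case f: False
          then show ?thesis using w_neq[of "q - 1 - i + i0"] False i by (simp add: z_def)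
        qed
        then have "(\<Sum>j<q - 1. z ^ j) = 0" using zq by (simp add: geometric_sum)
        then show ?thesis unfolding sumeq using False by simp
      qed
    qed
    have "(\<Sum>j<q - 1. c u j * X j n) =
        (\<Sum>j<q - 1. \<Sum>i<q - 1. u (g ^ i mod q) * (w ^ ((q - 1 - i) * j) * w ^ (j * i0)) / of_nat (q - 1))"
      unfolding c_def Xn by (simp only: sum_divide_distrib sum_distrib_right mult.assoc times_divide_eq_left)
    also have "\<dots> = (\<Sum>i<q - 1. \<Sum>j<q - 1. u (g ^ i mod q) * (w ^ ((q - 1 - i) * j) * w ^ (j * i0)) / of_nat (q - 1))"
      by (rule sum.swap)
    also have "\<dots> = (\<Sum>i<q - 1. u (g ^ i mod q) * (if i = i0 then of_nat (q - 1) else 0) / of_nat (q - 1))"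
    proof (intro sum.cong refl)
      fix i assume "i \<in> {..<q - 1}"
      then show "(\<Sum>j<q - 1. u (g ^ i mod q) * (w ^ ((q - 1 - i) * j) * w ^ (j * i0)) / of_nat (q - 1))
          = u (g ^ i mod q) * (if i = i0 then of_nat (q - 1) else 0) / of_nat (q - 1)"
        using orth[of i] by (simp only: sum_divide_distrib[symmetric] sum_distrib_left[symmetric] lessThan_iff)
    qed
    also have "\<dots> = (\<Sum>i<q - 1. if i = i0 then u (g ^ i mod q) else 0)"
      using q1 by (intro sum.cong) auto
    also have "\<dots> = u (n mod q)" unfolding i0(1) using i0(2) by simp
    finally show ?thesis ..
  qed
  have c0: "c u 0 = (\<Sum>a\<in>{1..<q}. u a) / of_nat (q - 1)" for u
    using sum.reindex_bij_betw[OF bij, of u] by (simp add: c_def tot)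
  show ?thesis using that[of X c] char princ expand c0 by blast
qed

text \<open>Averages over primes factor over coprime moduli; expand each factor $u_q$ into characters
  modulo $q$, all but the principal one giving mean value zero.\<close>
theorem has_prime_mean_prod:
  assumes "finite S" "\<And>q. q \<in> S \<Longrightarrow> prime q" "dirichlet_character M \<psi>" "\<And>q. q \<in> S \<Longrightarrow> \<not> q dvd M"
  shows "has_prime_mean k (\<lambda>p. \<psi> p * (\<Prod>q\<in>S. u q (p mod q)))
    ((if principal_character M \<psi> then 1 else 0) * (\<Prod>q\<in>S. (\<Sum>a\<in>{1..<q}. u q a) / of_nat (q - 1)))"
  using assms
\<comment> \<open>Each step moves one prime from the product into the character, so modulus and
  character have to vary.\<close>
proof (induction S arbitrary: M \<psi> rule: finite_induct)
  case empty
  then show ?case using dirichlet_character_prime_mean by simp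
next
  case (insert q S)
  have q: "prime q" and \<psi>: "dirichlet_character M \<psi>" using insert.prems by auto
  have q1: "q > 1" using q by (rule prime_gt_1_nat)
  have cop: "coprime q M" using q insert.prems(3)[of q] by (simp add: prime_imp_coprime)
  obtain X c where X: "\<And>j. dirichlet_character q (X j)"
    "\<And>j. j < q - 1 \<Longrightarrow> principal_character q (X j) \<longleftrightarrow> j = 0"
    "\<And>u n. coprime n q \<Longrightarrow> u (n mod q) = (\<Sum>j<q - 1. c u j * X j n)"
    "\<And>u. c u 0 = (\<Sum>a\<in>{1..<q}. u a) / of_nat (q - 1)"
    using prime_character_family[OF q] by blast
  define E where "E = (\<Prod>q\<in>S. (\<Sum>a\<in>{1..<q}. u q a) / of_nat (q - 1))"
  have princ: "principal_character (M * q) (\<lambda>n. \<psi> n * X j n) \<longleftrightarrow> principal_character M \<psi> \<and> j = 0" if j: "j < q - 1" for j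
  proof
    assume p: "principal_character (M * q) (\<lambda>n. \<psi> n * X j n)"
    have a: "\<psi> n = 1" if n: "coprime n M" for n
    proof -
      \<comment> \<open>By the Chinese remainder theorem an argument exists at which the factor
        modulo \<open>q\<close> is 1, which isolates \<open>\<psi> n\<close>.\<close>
      obtain x where x: "[x = n] (mod M)" "[x = 1] (mod q)"
        using binary_chinese_remainder_nat[of M q n 1] cop by (auto simp: coprime_commute)
      have "coprime x M" "coprime x q"
        using x n by (metis cong_imp_coprime cong_sym, metis cong_imp_coprime cong_sym coprime_1_left)
      then have "\<psi> x * X j x = 1" using p by (simp add: principal_character_def)
      moreover have "\<psi> x = \<psi> n" "X j x = X j 1"
        using dirichlet_character_cong[OF \<psi> x(1)] dirichlet_character_cong[OF X(1) x(2)] by auto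
      ultimately show ?thesis using dirichlet_characterD(7)[OF X(1)] by simp
    qed
    have b: "X j n = 1" if n: "coprime n q" for n
    proof -
      obtain x where x: "[x = 1] (mod M)" "[x = n] (mod q)"
        using binary_chinese_remainder_nat[of M q 1 n] cop by (auto simp: coprime_commute)
      have "coprime x M" "coprime x q"
        using x n by (metis cong_imp_coprime cong_sym coprime_1_left, metis cong_imp_coprime cong_sym)
      then have "\<psi> x * X j x = 1" using p by (simp add: principal_character_def)
      moreover have "\<psi> x = \<psi> 1" "X j x = X j n"
        using dirichlet_character_cong[OF \<psi> x(1)] dirichlet_character_cong[OF X(1) x(2)] by auto
      ultimately show ?thesis using dirichlet_characterD(7)[OF \<psi>] by simp
    qed
    show "principal_character M \<psi> \<and> j = 0"
      using a b X(2)[OF j] by (auto simp: principal_character_def)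
  next
    assume "principal_character M \<psi> \<and> j = 0"
    then show "principal_character (M * q) (\<lambda>n. \<psi> n * X j n)"
      using X(2)[of 0] j by (auto simp: principal_character_def)
  qed
  have "has_prime_mean k (\<lambda>p. \<Sum>j<q - 1. c (u q) j * ((\<psi> p * X j p) * (\<Prod>q\<in>S. u q (p mod q))))
      (\<Sum>j<q - 1. c (u q) j * ((if principal_character (M * q) (\<lambda>n. \<psi> n * X j n) then 1 else 0) * E))"
    unfolding E_def
  proof (intro has_prime_mean_sum has_prime_mean_cmult insert.IH)
    show "dirichlet_character (M * q) (\<lambda>n. \<psi> n * X j n)" for j
      by (intro dirichlet_character_mult \<psi> X(1))
    show "\<not> q' dvd M * q" if "q' \<in> S" for q'
      using that insert.prems insert.hyps q primes_dvd_imp_eq[of q' q] by (auto simp: prime_dvd_mult_iff)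
  qed (use insert.prems in auto)
  moreover have "(\<Sum>j<q - 1. c (u q) j * ((if principal_character (M * q) (\<lambda>n. \<psi> n * X j n) then 1 else 0) * E))
      = (if principal_character M \<psi> then 1 else 0) * (c (u q) 0 * E)"
  proof -
    have "(\<Sum>j<q - 1. c (u q) j * ((if principal_character (M * q) (\<lambda>n. \<psi> n * X j n) then 1 else 0) * E))
        = (\<Sum>j<q - 1. if j = 0 then (if principal_character M \<psi> then 1 else 0) * (c (u q) 0 * E) else 0)"
      by (intro sum.cong) (auto simp: princ)
    also have "\<dots> = (if principal_character M \<psi> then 1 else 0) * (c (u q) 0 * E)"
      using q1 by (subst sum.delta) auto
    finally show ?thesis .
  qed
  ultimately have "has_prime_mean k (\<lambda>p. \<Sum>j<q - 1. c (u q) j * ((\<psi> p * X j p) * (\<Prod>q\<in>S. u q (p mod q))))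
      ((if principal_character M \<psi> then 1 else 0) * (c (u q) 0 * E))" by simp
  then have "has_prime_mean k (\<lambda>p. \<psi> p * (\<Prod>q\<in>insert q S. u q (p mod q)))
      ((if principal_character M \<psi> then 1 else 0) * (c (u q) 0 * E))"
  \<comment> \<open>The expansion into characters holds only at arguments coprime to
    \<open>q\<close>; the primes up to \<open>q\<close> do not affect the mean.\<close>
  proof (rule has_prime_mean_cong_large)
    fix p assume p: "prime p" "p > q"
    then have "coprime p q" using q by (simp add: primes_coprime)
    then have "(\<Prod>q\<in>insert q S. u q (p mod q)) = (\<Sum>j<q - 1. c (u q) j * X j p) * (\<Prod>q\<in>S. u q (p mod q))"
      using insert.hyps X(3)[of p "u q"] by simp
    then show "(\<Sum>j<q - 1. c (u q) j * ((\<psi> p * X j p) * (\<Prod>q\<in>S. u q (p mod q)))) = \<psi> p * (\<Prod>q\<in>insert q S. u q (p mod q))"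
      by (simp add: sum_distrib_left sum_distrib_right mult_ac)
  qed
  then show ?case using insert.hyps X(4)[of "u q"] by (simp add: E_def)
qed

section \<open>The Legendre symbol of a squarefree integer\<close>

definition chi4 :: "nat \<Rightarrow> int" where
  "chi4 n = (if even n then 0 else if n mod 4 = 1 then 1 else -1)"

definition chi8 :: "nat \<Rightarrow> int" where
  "chi8 n = (if even n then 0 else if n mod 8 = 1 \<or> n mod 8 = 7 then 1 else -1)"

lemma Legendre_values: "Legendre a p = 0 \<or> Legendre a p = 1 \<or> Legendre a p = -1"
  by (simp add: Legendre_def)

text \<open>Both values lie in {-1, 0, 1}, so they differ by at most 2, less than \<open>p\<close>;
  congruence then forces equality.\<close>

lemma Legendre_eqI:
  assumes p: "p > 2" and c: "[Legendre a p = x] (mod p)" and x: "x = 0 \<or> x = 1 \<or> x = -1"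
  shows "Legendre a p = x"
proof -
  have "p dvd Legendre a p - x" using c by (simp add: cong_iff_dvd_diff)
  moreover have "\<bar>Legendre a p - x\<bar> < p" using Legendre_values[of a p] x p by auto
  ultimately show ?thesis using dvd_imp_le_int[of "Legendre a p - x" p] p by force
qed

lemma Legendre_mult:
  assumes p: "prime (p::nat)" "p > 2"
  shows "Legendre (a * b) (int p) = Legendre a (int p) * Legendre b (int p)"
proof (rule Legendre_eqI)
  have "[Legendre (a * b) (int p) = (a * b) ^ ((p - 1) div 2)] (mod int p)" by (rule euler_criterion[OF p])
  moreover have "[Legendre a (int p) * Legendre b (int p) = a ^ ((p - 1) div 2) * b ^ ((p - 1) div 2)] (mod int p)"
    by (intro cong_mult euler_criterion[OF p])
  ultimately show "[Legendre (a * b) (int p) = Legendre a (int p) * Legendre b (int p)] (mod int p)"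
    unfolding power_mult_distrib by (meson cong_sym cong_trans)
  show "Legendre a (int p) * Legendre b (int p) = 0 \<or> Legendre a (int p) * Legendre b (int p) = 1 \<or> Legendre a (int p) * Legendre b (int p) = -1"
    using Legendre_values[of a "int p"] Legendre_values[of b "int p"] by auto
qed (use p in auto)

lemma Legendre_eq_0_iff: "Legendre a p = 0 \<longleftrightarrow> p dvd a"
  by (auto simp: Legendre_def cong_0_iff)

lemma Legendre_1: "p > 2 \<Longrightarrow> Legendre 1 p = 1"
proof -
  assume p: "p > 2"
  have "QuadRes p 1" unfolding QuadRes_def by (rule exI[of _ 1]) simp
  moreover have "\<not> [1 = 0] (mod p)" using p by (simp add: cong_0_iff)
  ultimately show ?thesis by (simp add: Legendre_def)
qed

lemma Legendre_mod: "Legendre (a mod p) p = Legendre a p"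
proof -
  have "[a mod p = 0] (mod p) \<longleftrightarrow> [a = 0] (mod p)" by (simp add: cong_def)
  moreover have "QuadRes p (a mod p) \<longleftrightarrow> QuadRes p a" by (simp add: QuadRes_def cong_def)
  ultimately show ?thesis by (simp add: Legendre_def)
qed

lemma Legendre_minus_1:
  assumes p: "prime (p::nat)" "p > 2"
  shows "Legendre (-1) (int p) = chi4 p"
proof (rule Legendre_eqI)
  have odd: "odd p" using p by (simp add: prime_odd_nat)
  have "(-1 :: int) ^ ((p - 1) div 2) = chi4 p"
  proof -
    have "p mod 4 = 1 \<or> p mod 4 = 3" using odd by presburger
    then show ?thesis
    proof
      assume "p mod 4 = 1"
      moreover from this have "even ((p - 1) div 2)" by presburger
      ultimately show ?thesis using odd by (simp add: chi4_def)
    next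
      assume "p mod 4 = 3"
      moreover from this have "odd ((p - 1) div 2)" by presburger
      ultimately show ?thesis using odd by (simp add: chi4_def)
    qed
  qed
  then show "[Legendre (-1) (int p) = chi4 p] (mod int p)" using euler_criterion[OF p, of "-1"] by simp
qed (use p in \<open>auto simp: chi4_def\<close>)

lemma Legendre_2:
  assumes p: "prime (p::nat)" "p > 2"
  shows "Legendre 2 (int p) = chi8 p"
proof -
  interpret GAUSS p 2
    using p by unfold_locales (auto simp: cong_0_iff dest: zdvd_imp_le)
  have odd: "odd p" using p by (simp add: prime_odd_nat)
  \<comment> \<open>Gauss' lemma counts the even residues \<open>2 * x\<close> with
    \<open>x <= m\<close> that exceed \<open>m\<close>. This means \<open>x > m div 2\<close>, so
    there are \<open>m - m div 2\<close> of them.\<close>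
  define m where "m = (int p - 1) div 2"
  have m: "int p = 2 * m + 1" using odd unfolding m_def by presburger
  have m0: "m \<ge> 0" using p m by simp
  have "E = (*) 2 ` {m div 2<..m}"
  proof -
    have "C = (*) 2 ` {0<..m}"
      unfolding C_def B_def A_def m_def[symmetric] image_image
    proof (intro image_cong refl)
      fix x assume "x \<in> {0<..m}"
      then show "x * 2 mod int p = 2 * x" using m by (subst mod_pos_pos_trivial) auto
    qed
    then show ?thesis
      unfolding E_def m_def[symmetric] using m0 by (auto simp: image_iff)
  qed
  then have "card E = card {m div 2<..m}" by (simp add: card_image inj_on_def)
  also have "\<dots> = nat (m - m div 2)" by simp
  finally have card: "card E = nat (m - m div 2)" .
  have eo: "(-1::int) ^ nat z = (if even z then 1 else -1)" if "z \<ge> 0" for z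
    using that by (simp add: even_nat_iff)
  have "Legendre 2 (int p) = (if even (m - m div 2) then 1 else -1)"
    unfolding gauss_lemma card using m0 by (intro eo) simp
  also have "\<dots> = chi8 p"
  proof -
    have "p mod 8 = 1 \<or> p mod 8 = 3 \<or> p mod 8 = 5 \<or> p mod 8 = 7" using odd by presburger
    then have "(p mod 8 = 1 \<or> p mod 8 = 7) \<longleftrightarrow> even (m - m div 2)" using m by presburger
    then show ?thesis using odd by (simp add: chi8_def)
  qed
  finally show ?thesis .
qed

text \<open>The sign in quadratic reciprocity, as a character of \<open>p\<close> attached to an odd
  \<open>t\<close>. For negative \<open>t\<close> the residue is that of the signed number, so
  \<open>t = -1\<close> yields \<open>chi4\<close> and the first supplementary law is
  covered.\<close>

definition kappa4 :: "int \<Rightarrow> nat \<Rightarrow> int" where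
  "kappa4 t p = (if t mod 4 = 3 then chi4 p else 1)"

lemma kappa4_mult:
  assumes "odd t" "odd u" "odd p"
  shows "kappa4 (t * u) p = kappa4 t p * kappa4 u p"
proof -
  have t: "t mod 4 = 1 \<or> t mod 4 = 3" and u: "u mod 4 = 1 \<or> u mod 4 = 3" using assms by presburger+
  have "(t * u) mod 4 = (t mod 4) * (u mod 4) mod 4" by (simp add: mod_mult_eq)
  moreover have "chi4 p * chi4 p = 1" using assms(3) by (simp add: chi4_def)
  ultimately show ?thesis using t u by (auto simp: kappa4_def)
qed

lemma Legendre_reciprocity:
  assumes p: "prime p" "p > 2" and q: "prime q" "q > 2" and pq: "p \<noteq> q"
  shows "Legendre (int q) (int p) = kappa4 (int q) p * Legendre (int p) (int q)"
proof -
  have op: "odd p" "odd q" using p q by (auto simp: prime_odd_nat)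
  have rec: "Legendre (int p) (int q) * Legendre (int q) (int p) = (-1::int) ^ ((p - 1) div 2 * ((q - 1) div 2))"
    by (rule Quadratic_Reciprocity[OF p q pq])
  have "(-1::int) ^ ((p - 1) div 2 * ((q - 1) div 2)) = kappa4 (int q) p"
  proof -
    have "p mod 4 = 1 \<or> p mod 4 = 3" "q mod 4 = 1 \<or> q mod 4 = 3" using op by presburger+
    moreover have "even ((n - 1) div 2)" if "n mod 4 = 1" for n :: nat using that by presburger
    moreover have "odd ((n - 1) div 2)" if "n mod 4 = 3" for n :: nat using that by presburger
    moreover have "int q mod 4 = int (q mod 4)" by (simp add: zmod_int)
    ultimately show ?thesis using op by (auto simp: kappa4_def chi4_def)
  qed
  moreover have "Legendre (int p) (int q) * Legendre (int p) (int q) = 1"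
    using Legendre_values[of "int p" "int q"] Legendre_eq_0_iff[of "int p" "int q"] p q pq
    by (auto dest: primes_dvd_imp_eq)
  ultimately show ?thesis using rec
    by (metis mult.assoc mult.commute mult.left_neutral)
qed

text \<open>Reciprocity for each prime, multiplied together. Oddness of the product is carried
  through the induction because \<open>kappa4_mult\<close> asks for odd arguments.\<close>

lemma Legendre_prod_primes:
  assumes "finite S" "\<And>q. q \<in> S \<Longrightarrow> prime q \<and> q > 2" "prime p" "p > 2" "p \<notin> S"
  shows "Legendre (\<Prod>q\<in>S. int q) (int p) = kappa4 (\<Prod>q\<in>S. int q) p * (\<Prod>q\<in>S. Legendre (int p) (int q)) \<and> odd (\<Prod>q\<in>S. int q)"
  using assms
proof (induction S rule: finite_induct)
  case empty
  then show ?case by (simp add: Legendre_1 kappa4_def)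
next
  case (insert q S)
  have q: "prime q" "q > 2" "odd q" using insert.prems(1)[of q] by (auto simp: prime_odd_nat)
  have p: "odd p" using insert.prems by (simp add: prime_odd_nat)
  have IH: "Legendre (\<Prod>q\<in>S. int q) (int p) = kappa4 (\<Prod>q\<in>S. int q) p * (\<Prod>q\<in>S. Legendre (int p) (int q))"
    "odd (\<Prod>q\<in>S. int q)" using insert by auto
  have "Legendre (int q * (\<Prod>q\<in>S. int q)) (int p)
      = (kappa4 (int q) p * Legendre (int p) (int q)) * (kappa4 (\<Prod>q\<in>S. int q) p * (\<Prod>q\<in>S. Legendre (int p) (int q)))"
    unfolding Legendre_mult[OF insert.prems(2,3)] IH(1)
    by (subst Legendre_reciprocity) (use insert.prems q in auto)
  then show ?case using insert.hyps q p IH(2) by (simp add: kappa4_mult mult_ac)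
qed

definition odd_prime_divisors :: "int \<Rightarrow> nat set" where
  "odd_prime_divisors s = {q. prime q \<and> odd q \<and> int q dvd s}"

lemma finite_odd_prime_divisors: "s \<noteq> 0 \<Longrightarrow> finite (odd_prime_divisors s)"
  by (rule finite_subset[of _ "{..nat \<bar>s\<bar>}"])
    (auto simp: odd_prime_divisors_def dest!: dvd_imp_le_int)

lemma squarefree_int_decompose:
  fixes s :: int
  assumes s: "squarefree s"
  shows "s = (if s < 0 then -1 else 1) * (if even s then 2 else 1) * (\<Prod>q\<in>odd_prime_divisors s. int q)"
proof -
  define n where "n = nat \<bar>s\<bar>"
  have s0: "s \<noteq> 0" using s by auto
  have n0: "n > 0" using s0 by (simp add: n_def)
  have sq: "squarefree n"
  proof (rule squarefreeI)
    fix x assume "x\<^sup>2 dvd n"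
    then have "(int x)\<^sup>2 dvd s" by (simp add: n_def nat_abs_dvd_iff flip: of_nat_power)
    then have "int x dvd 1" using s by (rule squarefreeD[rotated])
    then show "x dvd 1" by simp
  qed
  have dv: "int q dvd s \<longleftrightarrow> q dvd n" for q by (simp add: n_def dvd_nat_abs_iff)
  have "n = (\<Prod>q\<in>prime_factors n. q ^ multiplicity q n)"
    using n0 by (simp add: prime_factorization_nat)
  also have "\<dots> = (\<Prod>q\<in>prime_factors n. q)"
  proof (rule prod.cong[OF refl])
    fix q assume q: "q \<in> prime_factors n"
    then have "multiplicity q n = 1" using sq n0
      by (metis in_prime_factors_iff squarefree_factorial_semiring' le_antisym One_nat_def Suc_leI prime_factors_multiplicity mem_Collect_eq less_numeral_extra(1) not_less0)
    then show "q ^ multiplicity q n = q" by simp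
  qed
  also have "prime_factors n = (if even n then {2} else {}) \<union> odd_prime_divisors s"
  proof -
    have "x = 2" if "prime x" "even x" for x :: nat using primes_dvd_imp_eq[of 2 x] that by auto
    then show ?thesis using n0 by (auto simp: odd_prime_divisors_def dv prime_factors_dvd)
  qed
  also have "(\<Prod>q\<in>\<dots>. q) = (if even n then 2 else 1) * (\<Prod>q\<in>odd_prime_divisors s. q)"
    using finite_odd_prime_divisors[OF s0] by (subst prod.union_disjoint) (auto simp: odd_prime_divisors_def)
  finally have "n = (if even n then 2 else 1) * (\<Prod>q\<in>odd_prime_divisors s. q)" .
  from arg_cong[OF this, of int]
  have "int n = int ((if even n then 2 else 1) * (\<Prod>q\<in>odd_prime_divisors s. q))" .
  also have "\<dots> = (if even n then 2 else 1) * (\<Prod>q\<in>odd_prime_divisors s. int q)" by simp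
  also have "even n \<longleftrightarrow> even s" by (simp add: n_def even_nat_iff)
  finally have n: "int n = (if even s then 2 else 1) * (\<Prod>q\<in>odd_prime_divisors s. int q)" .
  have "s = (if s < 0 then -1 else 1) * int n" by (simp add: n_def)
  then show ?thesis unfolding n mult.assoc .
qed

text \<open>Collects all that is decided modulo 8: the sign of \<open>s\<close>, a factor 2, and the
  reciprocity signs of the odd primes. The value 0 at even arguments makes it a Dirichlet
  character.\<close>

definition two_part_character :: "int \<Rightarrow> nat \<Rightarrow> int" where
  "two_part_character s p =
     (if even p then 0 else kappa4 (if even s then s div 2 else s) p * (if even s then chi8 p else 1))"

lemma Legendre_squarefree:
  assumes s: "squarefree s" and p: "prime p" "p > 2" "\<not> int p dvd s"
  shows "Legendre s (int p) = two_part_character s p * (\<Prod>q\<in>odd_prime_divisors s. Legendre (int p) (int q))"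
proof -
  define P where "P = (\<Prod>q\<in>odd_prime_divisors s. int q)"
  define e :: int where "e = (if s < 0 then -1 else 1)"
  have s0: "s \<noteq> 0" using s by auto
  have op: "odd p" using p by (simp add: prime_odd_nat)
  have g2: "q > 2" if "prime q" "odd q" for q :: nat
    using that prime_ge_2_nat[of q] by (cases "q = 2") auto
  have L: "Legendre P (int p) = kappa4 P p * (\<Prod>q\<in>odd_prime_divisors s. Legendre (int p) (int q))" "odd P"
    unfolding P_def using Legendre_prod_primes[OF finite_odd_prime_divisors[OF s0], of p] p g2
    by (auto simp: odd_prime_divisors_def)
  have dec: "s = e * (if even s then 2 else 1) * P"
    using squarefree_int_decompose[OF s] by (simp add: e_def P_def)
  have Le: "Legendre e (int p) = kappa4 e p"
    using Legendre_minus_1[OF p(1,2)] Legendre_1[of "int p"] p(2) by (auto simp: e_def kappa4_def)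
  have oe: "odd e" by (simp add: e_def)
  have part: "(if even s then s div 2 else s) = e * P"
  proof (cases "even s")
    case True
    then have "s = e * 2 * P" using dec by metis
    then have "s = 2 * (e * P)" by simp
    then have "s div 2 = e * P" by simp
    then show ?thesis using True by simp
  next
    case False
    then have "s = e * 1 * P" using dec by metis
    then show ?thesis using False by simp
  qed
  have "Legendre s (int p) = Legendre (e * (if even s then 2 else 1) * P) (int p)" using dec by simp
  also have "\<dots> = kappa4 e p * (if even s then chi8 p else 1) * (kappa4 P p * (\<Prod>q\<in>odd_prime_divisors s. Legendre (int p) (int q)))"
    using p(2) by (simp add: Legendre_mult[OF p(1,2)] Le L(1) Legendre_2[OF p(1,2)] Legendre_1)
  also have "\<dots> = two_part_character s p * (\<Prod>q\<in>odd_prime_divisors s. Legendre (int p) (int q))"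
    unfolding two_part_character_def part using op by (simp add: kappa4_mult[OF oe L(2) op])
  finally show ?thesis .
qed

lemma chi4_mult: "chi4 (a * b) = chi4 a * chi4 b"
proof (cases "even a \<or> even b")
  case False
  then have "a mod 4 = 1 \<or> a mod 4 = 3" "b mod 4 = 1 \<or> b mod 4 = 3" by presburger+
  moreover have "(a * b) mod 4 = (a mod 4) * (b mod 4) mod 4" by (simp add: mod_mult_eq)
  ultimately show ?thesis using False by (auto simp: chi4_def)
qed (auto simp: chi4_def)

lemma chi8_mult: "chi8 (a * b) = chi8 a * chi8 b"
proof (cases "even a \<or> even b")
  case False
  then have "a mod 8 = 1 \<or> a mod 8 = 3 \<or> a mod 8 = 5 \<or> a mod 8 = 7"
    "b mod 8 = 1 \<or> b mod 8 = 3 \<or> b mod 8 = 5 \<or> b mod 8 = 7" by presburger+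
  moreover have "(a * b) mod 8 = (a mod 8) * (b mod 8) mod 8" by (simp add: mod_mult_eq)
  ultimately show ?thesis using False by (elim disjE) (simp_all add: chi8_def)
qed (auto simp: chi8_def)

lemma two_part_character_dirichlet: "dirichlet_character 8 (\<lambda>n. of_int (two_part_character s n))"
proof -
  have mult: "two_part_character s (a * b) = two_part_character s a * two_part_character s b" for a b
    by (auto simp: two_part_character_def kappa4_def chi4_mult chi8_mult)
  have one: "two_part_character s (Suc 0) = 1"
    by (auto simp: two_part_character_def kappa4_def chi4_def chi8_def)
  have per: "two_part_character s (n + 8) = two_part_character s n" for n
  proof -
    have "(n + 8) mod 4 = n mod 4" "even (n + 8) \<longleftrightarrow> even n" by presburger+
    then show ?thesis by (simp add: two_part_character_def kappa4_def chi4_def chi8_def)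
  qed
  have cop: "coprime n 8 \<longleftrightarrow> odd n" for n :: nat
    using coprime_power_right_iff[of n 2 3] by simp
  have vals: "\<bar>two_part_character s n\<bar> = 1" if "odd n" for n
    using that by (auto simp: two_part_character_def kappa4_def chi4_def chi8_def)
  have z: "two_part_character s n = 0" if "even n" for n
    using that by (simp add: two_part_character_def)
  show ?thesis
    unfolding dirichlet_character_def completely_multiplicative_def cop
    using mult one per vals z by (auto simp: norm_of_int simp flip: of_int_abs)
qed

lemma principal_two_part_character_iff:
  assumes "\<not> 4 dvd s"
  shows "principal_character 8 (\<lambda>n. of_int (two_part_character s n)) \<longleftrightarrow> s mod 4 = 1"
proof -
  have cop: "coprime n 8 \<longleftrightarrow> odd n" for n :: nat
    using coprime_power_right_iff[of n 2 3] by simp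
  show ?thesis
  proof
    assume p: "principal_character 8 (\<lambda>n. of_int (two_part_character s n))"
    then have 1: "two_part_character s n = 1" if "odd n" for n
      using that unfolding principal_character_def cop by (metis of_int_eq_1_iff)
    \<comment> \<open>Two test values suffice: at 5 an even \<open>s\<close> gives -1, since
      \<open>chi4 5 = 1\<close> and \<open>chi8 5 = -1\<close>; at 3 an odd \<open>s\<close>
      congruent to 3 modulo 4 gives -1.\<close>
    have "two_part_character s 5 = 1" "two_part_character s 3 = 1" using 1 by auto
    then have "odd s" "s mod 4 \<noteq> 3"
      by (auto simp: two_part_character_def kappa4_def chi4_def chi8_def split: if_splits)
    then show "s mod 4 = 1" by presburger
  next
    assume s: "s mod 4 = 1"
    then have "odd s" by presburger
    then show "principal_character 8 (\<lambda>n. of_int (two_part_character s n))"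
      using s by (simp add: principal_character_def cop two_part_character_def kappa4_def)
  qed
qed

text \<open>A primitive root is a nonresidue by Euler's criterion, and multiplication by it permutes
  the nonzero residues while reversing every sign.\<close>

lemma sum_Legendre_eq_0:
  assumes q: "prime q" "q > 2"
  shows "(\<Sum>a\<in>{1..<q}. Legendre (int a) (int q)) = 0"
proof -
  obtain g where g: "residue_primroot q g" using prime_primitive_root_exists[of q] q by auto
  have q1: "q > 1" using q by simp
  have gc: "coprime q g" "ord q g = q - 1" using g q by (auto simp: residue_primroot_def totient_prime)
  have "\<not> q dvd g" using gc(1) q1 by (metis coprime_common_divisor_nat dvd_refl less_irrefl)
  then have g0: "\<not> int q dvd int g" by simp
  have "Legendre (int g) (int q) \<noteq> 1"
  proof
    assume L: "Legendre (int g) (int q) = 1"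
    have "[1 = int g ^ ((q - 1) div 2)] (mod int q)"
      using euler_criterion[OF q, of "int g"] L by simp
    then have "[g ^ ((q - 1) div 2) = 1] (mod q)"
      by (metis cong_int_iff cong_sym of_nat_1 of_nat_power)
    then have "ord q g dvd (q - 1) div 2" by (simp only: ord_divides)
    then have "q - 1 \<le> (q - 1) div 2" using gc(2) q by (intro dvd_imp_le) auto
    then show False using q by linarith
  qed
  then have Lg: "Legendre (int g) (int q) = -1"
    using Legendre_values[of "int g" "int q"] Legendre_eq_0_iff[of "int g" "int q"] g0 by auto
  have inj: "inj_on (\<lambda>a. g * a mod q) {1..<q}"
  proof (rule inj_onI)
    fix x y assume xy: "x \<in> {1..<q}" "y \<in> {1..<q}" "g * x mod q = g * y mod q"
    then have "[g * x = g * y] (mod q)" by (simp add: cong_def)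
    then have "[x = y] (mod q)" using gc(1) by (simp add: cong_mult_lcancel_nat coprime_commute)
    then show "x = y" using xy by (simp add: cong_def)
  qed
  have "(\<lambda>a. g * a mod q) ` {1..<q} \<subseteq> {1..<q}"
  proof
    fix y assume "y \<in> (\<lambda>a. g * a mod q) ` {1..<q}"
    then obtain x where x: "x \<in> {1..<q}" "y = g * x mod q" by auto
    have "\<not> q dvd x" using x(1) by (auto dest: dvd_imp_le)
    then have "\<not> q dvd g * x" using \<open>\<not> q dvd g\<close> q(1) by (simp add: prime_dvd_mult_iff)
    then show "y \<in> {1..<q}" using x q1 by (simp add: dvd_eq_mod_eq_0 Suc_le_eq)
  qed
  then have "(\<lambda>a. g * a mod q) ` {1..<q} = {1..<q}" by (intro endo_inj_surj inj) auto
  then have "(\<Sum>a\<in>{1..<q}. Legendre (int a) (int q)) = (\<Sum>a\<in>{1..<q}. Legendre (int (g * a mod q)) (int q))"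
    using sum.reindex[OF inj, of "\<lambda>a. Legendre (int a) (int q)"] by (simp add: o_def)
  also have "\<dots> = (\<Sum>a\<in>{1..<q}. - Legendre (int a) (int q))"
    by (intro sum.cong refl) (simp add: zmod_int Legendre_mod Legendre_mult[OF q] Lg)
  finally show ?thesis by (simp add: sum_negf)
qed

section \<open>The discriminant of a quadratic field\<close>

lemma rat_as_fraction:
  obtains p q :: int where "c = of_int p / (of_int q :: rat)" "q > 0" "coprime p q"
  using quotient_of_div[of c] quotient_of_coprime[of c] quotient_of_denom_pos[of c]
  by (metis surj_pair)

text \<open>In lowest terms the \<open>k\<close>-th power has the denominator \<open>q ^ k\<close>.
  All of these divide \<open>D\<close>, so \<open>q = 1\<close>. This is the integrality criterion
  applied to norms below.\<close>

lemma rat_int_if_bounded_denominators: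
  fixes \<nu> :: rat and D :: int
  assumes D: "D \<noteq> 0" and pw: "\<And>k. of_int D * \<nu> ^ k \<in> \<int>"
  shows "\<nu> \<in> \<int>"
proof -
  obtain p q where pq: "\<nu> = of_int p / of_int q" "q > 0" "coprime p q" by (rule rat_as_fraction)
  have dv: "q ^ k dvd D" for k
  proof -
    obtain w where w: "of_int D * \<nu> ^ k = (of_int w :: rat)" using pw[of k] by (elim Ints_cases)
    then have "of_int (D * p ^ k) = (of_int (w * q ^ k) :: rat)"
      using pq(2) by (simp add: pq(1) power_divide field_simps)
    then have "D * p ^ k = w * q ^ k" by (simp only: of_int_eq_iff)
    then have "q ^ k dvd D * p ^ k" by simp
    moreover have "coprime (q ^ k) (p ^ k)" using pq(3) by (simp add: coprime_commute)
    ultimately show ?thesis by (simp add: coprime_dvd_mult_left_iff)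
  qed
  have "q = 1"
  proof (rule ccontr)
    assume "q \<noteq> 1"
    then have q2: "q \<ge> 2" using pq(2) by simp
    define k where "k = nat \<bar>D\<bar>"
    have "int k < 2 ^ k" by (rule of_nat_less_two_power)
    also have "(2::int) ^ k \<le> q ^ k" using q2 by (intro power_mono) auto
    also have "q ^ k \<le> \<bar>D\<bar>" using dvd_imp_le_int[OF D dv[of k]] pq(2) by simp
    finally show False by (simp add: k_def)
  qed
  then show ?thesis using pq by simp
qed

lemma rat_int_if_squarefree_mult_square:
  fixes c :: rat and s :: int
  assumes s: "squarefree s" and i: "of_int s * c\<^sup>2 \<in> \<int>"
  shows "c \<in> \<int>"
proof -
  obtain p q where pq: "c = of_int p / of_int q" "q > 0" "coprime p q" by (rule rat_as_fraction)
  obtain w where w: "of_int s * c\<^sup>2 = (of_int w :: rat)" using i by (elim Ints_cases)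
  then have "of_int (s * p\<^sup>2) = (of_int (w * q\<^sup>2) :: rat)"
    using pq(2) by (simp add: pq(1) power_divide field_simps)
  then have "s * p\<^sup>2 = w * q\<^sup>2" by (simp only: of_int_eq_iff)
  then have "q\<^sup>2 dvd s * p\<^sup>2" by simp
  moreover have "coprime (q\<^sup>2) (p\<^sup>2)" using pq(3) by (simp add: coprime_commute)
  ultimately have "q\<^sup>2 dvd s" by (simp add: coprime_dvd_mult_left_iff)
  then have "q dvd 1" using s by (rule squarefreeD[rotated])
  then show ?thesis using pq by simp
qed

section \<open>The ring of integers of a quadratic field\<close>

locale quadratic_root =
  fixes s :: int and R :: complex
  assumes s: "squarefree s" "s \<noteq> 1" and R: "R\<^sup>2 = of_int s"
begin

lemma lin_indep:
  fixes a b :: rat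
  assumes "of_rat a + of_rat b * R = 0"
  shows "a = 0 \<and> b = 0"
proof -
  have "b = 0"
  proof (rule ccontr)
    assume b: "b \<noteq> 0"
    define c where "c = - a / b"
    have "R = of_rat c"
      using assms b by (simp add: c_def of_rat_divide of_rat_minus field_simps add_eq_0_iff)
    then have "(of_rat (c\<^sup>2) :: complex) = of_rat (of_int s)" using R by (simp add: of_rat_power)
    then have c: "c\<^sup>2 = of_int s" by (simp only: of_rat_eq_iff)
    have "c \<in> \<int>"
      by (rule rat_int_if_squarefree_mult_square[of 1]) (simp_all add: c)
    then obtain z where z: "c = of_int z" by (elim Ints_cases)
    then have "z\<^sup>2 = s" using c by (metis of_int_eq_iff of_int_power)
    then have "z\<^sup>2 dvd s" by simp
    then have "z dvd 1" using s(1) by (rule squarefreeD[rotated])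
    then have "\<bar>z\<bar> = 1" by simp
    then have "z\<^sup>2 = 1" by (metis power2_abs one_power2)
    then show False using \<open>z\<^sup>2 = s\<close> s(2) by simp
  qed
  then show ?thesis using assms by simp
qed

lemma rep_unique:
  fixes a b a' b' :: rat
  assumes "of_rat a + of_rat b * R = of_rat a' + of_rat b' * R"
  shows "a = a' \<and> b = b'"
  using lin_indep[of "a - a'" "b - b'"] assms by (simp add: of_rat_diff algebra_simps)

text \<open>For nonzero \<open>D\<close> this is the lattice spanned by \<open>1 / D\<close> and
  \<open>R / D\<close>. An algebraic integer of the field has all its powers in one such
  lattice.\<close>

definition lattice :: "int \<Rightarrow> complex set" where
  "lattice D = {z. \<exists>u v :: int. of_int D * z = of_int u + of_int v * R}"

lemma lattice_add: "z \<in> lattice D \<Longrightarrow> z' \<in> lattice D \<Longrightarrow> z + z' \<in> lattice D"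
proof -
  assume "z \<in> lattice D" "z' \<in> lattice D"
  then obtain u v u' v' :: int where "of_int D * z = of_int u + of_int v * R"
    "of_int D * z' = of_int u' + of_int v' * R" by (auto simp: lattice_def)
  then have "of_int D * (z + z') = of_int (u + u') + of_int (v + v') * R" by (simp add: algebra_simps)
  then show ?thesis unfolding lattice_def by blast
qed

lemma lattice_mult_int: "z \<in> lattice D \<Longrightarrow> of_int m * z \<in> lattice D"
proof -
  assume "z \<in> lattice D"
  then obtain u v :: int where "of_int D * z = of_int u + of_int v * R" by (auto simp: lattice_def)
  then have "of_int m * (of_int D * z) = of_int m * (of_int u + of_int v * R)" by (rule arg_cong)
  then have "of_int D * (of_int m * z) = of_int (m * u) + of_int (m * v) * R" by (simp add: algebra_simps)
  then show ?thesis unfolding lattice_def by blast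
qed

lemma lattice_0: "0 \<in> lattice D"
  unfolding lattice_def by (auto intro!: exI[of _ 0])

lemma lattice_sum: "(\<And>i. i \<in> I \<Longrightarrow> f i \<in> lattice D) \<Longrightarrow> sum f I \<in> lattice D"
  by (induction I rule: infinite_finite_induct) (auto intro: lattice_0 lattice_add)

lemma power_in_ZR: "\<exists>u v :: int. (of_int \<alpha> + of_int \<beta> * R) ^ k = of_int u + of_int v * R"
proof (induction k)
  case 0
  show ?case by (intro exI[of _ 1] exI[of _ 0]) simp
next
  case (Suc k)
  then obtain u v :: int where uv: "(of_int \<alpha> + of_int \<beta> * R) ^ k = of_int u + of_int v * R" by blast
  have "R * R = of_int s" using R by (simp add: power2_eq_square)
  then have "(of_int \<alpha> + of_int \<beta> * R) ^ Suc k = of_int (\<alpha> * u + \<beta> * v * s) + of_int (\<alpha> * v + \<beta> * u) * R"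
    unfolding power_Suc uv by (simp add: algebra_simps)
  then show ?case by blast
qed

text \<open>If \<open>e\<close> clears the denominators of \<open>x\<close> and \<open>n\<close> is
  the degree of a monic integral equation for \<open>x\<close>, then \<open>D = e ^ n\<close> serves
  for the powers up to \<open>n\<close> directly, and for higher powers by the recursion that the
  equation provides.\<close>

lemma powers_in_lattice:
  assumes x: "algebraic_int (of_rat a + of_rat b * R)"
  obtains D where "D \<noteq> 0" "\<And>k. (of_rat a + of_rat b * R) ^ k \<in> lattice D"
proof -
  define x where "x = of_rat a + of_rat b * R"
  obtain p where p: "lead_coeff p = 1" "\<And>i. Polynomial.coeff p i \<in> \<int>" "poly p x = 0"
    using assms unfolding x_def[symmetric] by (auto elim: algebraic_int.cases)
  define n where "n = degree p"
  obtain a1 a2 where a: "a = of_int a1 / of_int a2" "a2 > 0" by (rule rat_as_fraction)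
  obtain b1 b2 where b: "b = of_int b1 / of_int b2" "b2 > 0" by (rule rat_as_fraction)
  define e where "e = a2 * b2"
  have e: "e \<noteq> 0" using a b by (simp add: e_def)
  have ex: "of_int e * x = of_int (a1 * b2) + of_int (b1 * a2) * R"
    using a(2) b(2) by (simp add: x_def a(1) b(1) e_def of_rat_divide field_simps)
  have base: "x ^ k \<in> lattice (e ^ n)" if "k \<le> n" for k
  proof -
    obtain u v :: int where uv: "(of_int (a1 * b2) + of_int (b1 * a2) * R) ^ k = of_int u + of_int v * R"
      using power_in_ZR by blast
    have "of_int (e ^ n) * x ^ k = of_int (e ^ (n - k)) * (of_int e * x) ^ k"
      using that by (simp add: power_mult_distrib power_add[symmetric] flip: mult.assoc)
    also have "\<dots> = of_int (e ^ (n - k) * u) + of_int (e ^ (n - k) * v) * R"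
      unfolding ex uv by (simp add: algebra_simps)
    finally show ?thesis unfolding lattice_def by blast
  qed
  have rec: "x ^ n = - (\<Sum>i<n. Polynomial.coeff p i * x ^ i)"
  proof -
    have "0 = (\<Sum>i\<le>n. Polynomial.coeff p i * x ^ i)" using p(3) by (simp add: poly_altdef n_def)
    also have "\<dots> = (\<Sum>i<n. Polynomial.coeff p i * x ^ i) + x ^ n"
      using p(1) by (simp add: n_def lessThan_Suc_atMost[symmetric])
    finally show ?thesis by (simp add: eq_neg_iff_add_eq_0 add.commute)
  qed
  have all: "x ^ k \<in> lattice (e ^ n)" for k
  proof (induction k rule: less_induct)
    case (less k)
    show ?case
    proof (cases "k \<le> n")
      case False
      have "x ^ k = x ^ (k - n) * x ^ n" using False by (simp add: power_add[symmetric])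
      also have "\<dots> = (\<Sum>i<n. - Polynomial.coeff p i * x ^ (k - n + i))"
        unfolding rec by (simp add: sum_distrib_left sum_negf power_add algebra_simps)
      also have "\<dots> \<in> lattice (e ^ n)"
      proof (rule lattice_sum)
        fix i assume i: "i \<in> {..<n}"
        obtain z where "- Polynomial.coeff p i = of_int z" using p(2)[of i] by (metis Ints_cases Ints_minus)
        moreover have "x ^ (k - n + i) \<in> lattice (e ^ n)" using i False by (intro less) auto
        ultimately show "- Polynomial.coeff p i * x ^ (k - n + i) \<in> lattice (e ^ n)" by (simp add: lattice_mult_int)
      qed
      finally show ?thesis .
    qed (rule base)
  qed
  show ?thesis
    by (rule that[of "e ^ n"]) (use e all in \<open>auto simp: x_def\<close>)
qed

text \<open>The norm is multiplicative, so its powers are the norms of the powers of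
  \<open>x\<close>. Norms of elements of \<open>lattice D\<close> become integers after
  multiplication by \<open>D^2\<close>, and the criterion of bounded denominators applies.\<close>

lemma norm_int_if_powers_in_lattice:
  assumes D: "D \<noteq> 0" and pw: "\<And>k. (of_rat a + of_rat b * R) ^ k \<in> lattice D"
  shows "a\<^sup>2 - of_int s * b\<^sup>2 \<in> \<int>"
proof (rule rat_int_if_bounded_denominators[of "D\<^sup>2"])
  fix k
  have "\<exists>c d :: rat. (of_rat a + of_rat b * R) ^ k = of_rat c + of_rat d * R \<and>
          c\<^sup>2 - of_int s * d\<^sup>2 = (a\<^sup>2 - of_int s * b\<^sup>2) ^ k"
  proof (induction k)
    case 0
    show ?case by (intro exI[of _ 1] exI[of _ 0]) simp
  next
    case (Suc k)
    then obtain c d :: rat where cd: "(of_rat a + of_rat b * R) ^ k = of_rat c + of_rat d * R"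
      "c\<^sup>2 - of_int s * d\<^sup>2 = (a\<^sup>2 - of_int s * b\<^sup>2) ^ k" by blast
    have RR: "R * R = of_int s" using R by (simp add: power2_eq_square)
    have "(of_rat a + of_rat b * R) ^ Suc k = of_rat (a * c + b * d * of_int s) + of_rat (a * d + b * c) * R"
      unfolding power_Suc cd(1) by (simp add: of_rat_add of_rat_mult algebra_simps flip: RR)
    moreover have "(a * c + b * d * of_int s)\<^sup>2 - of_int s * (a * d + b * c)\<^sup>2
        = (a\<^sup>2 - of_int s * b\<^sup>2) * (c\<^sup>2 - of_int s * d\<^sup>2)"
      by (simp add: power2_eq_square algebra_simps)
    ultimately show ?case using cd(2) by (metis power_Suc)
  qed
  then obtain c d :: rat where cd: "(of_rat a + of_rat b * R) ^ k = of_rat c + of_rat d * R"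
    "c\<^sup>2 - of_int s * d\<^sup>2 = (a\<^sup>2 - of_int s * b\<^sup>2) ^ k" by blast
  obtain u v :: int where "of_int D * (of_rat c + of_rat d * R) = of_int u + of_int v * R"
    using pw[of k] unfolding cd(1) by (auto simp: lattice_def)
  then have "of_rat (of_int D * c) + of_rat (of_int D * d) * R = of_rat (of_int u) + of_rat (of_int v) * R"
    by (simp add: of_rat_mult algebra_simps)
  then have uv: "of_int D * c = of_int u" "of_int D * d = of_int v" using rep_unique by blast+
  have "of_int (D\<^sup>2) * (a\<^sup>2 - of_int s * b\<^sup>2) ^ k = (of_int D * c)\<^sup>2 - of_int s * (of_int D * d)\<^sup>2"
    unfolding cd(2)[symmetric] by (simp add: power2_eq_square algebra_simps)
  also have "\<dots> = of_int (u\<^sup>2 - s * v\<^sup>2)" unfolding uv by simp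
  finally show "of_int (D\<^sup>2) * (a\<^sup>2 - of_int s * b\<^sup>2) ^ k \<in> \<int>" by simp
qed (use D in simp)

text \<open>The norms of $x$ and of $x+1$ determine the trace.\<close>
lemma algebraic_int_iff:
  "algebraic_int (of_rat a + of_rat b * R) \<longleftrightarrow> 2 * a \<in> \<int> \<and> a\<^sup>2 - of_int s * b\<^sup>2 \<in> \<int>"
proof
  assume x: "algebraic_int (of_rat a + of_rat b * R)"
  obtain D where D: "D \<noteq> 0" "\<And>k. (of_rat a + of_rat b * R) ^ k \<in> lattice D"
    using powers_in_lattice[OF x] by blast
  have 1: "a\<^sup>2 - of_int s * b\<^sup>2 \<in> \<int>" by (rule norm_int_if_powers_in_lattice[OF D])
  have "(of_rat (a + 1) + of_rat b * R) ^ k \<in> lattice D" for k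
  proof -
    have "(of_rat (a + 1) + of_rat b * R) ^ k = ((of_rat a + of_rat b * R) + 1) ^ k"
      by (simp add: of_rat_add add_ac)
    also have "\<dots> = (\<Sum>i\<le>k. of_int (int (k choose i)) * (of_rat a + of_rat b * R) ^ i)"
      by (subst binomial_ring) simp
    also have "\<dots> \<in> lattice D" by (intro lattice_sum lattice_mult_int D)
    finally show ?thesis .
  qed
  then have "(a + 1)\<^sup>2 - of_int s * b\<^sup>2 \<in> \<int>" by (rule norm_int_if_powers_in_lattice[OF D(1)])
  then have "((a + 1)\<^sup>2 - of_int s * b\<^sup>2) - (a\<^sup>2 - of_int s * b\<^sup>2) - 1 \<in> \<int>" by (rule Ints_diff[OF Ints_diff[OF _ 1] Ints_1])
  also have "((a + 1)\<^sup>2 - of_int s * b\<^sup>2) - (a\<^sup>2 - of_int s * b\<^sup>2) - 1 = 2 * a" by (simp add: power2_eq_square algebra_simps)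
  finally show "2 * a \<in> \<int> \<and> a\<^sup>2 - of_int s * b\<^sup>2 \<in> \<int>" using 1 by simp
next
  assume i: "2 * a \<in> \<int> \<and> a\<^sup>2 - of_int s * b\<^sup>2 \<in> \<int>"
  then obtain t n where t: "2 * a = of_int t" and n: "a\<^sup>2 - of_int s * b\<^sup>2 = of_int n" by (elim conjE Ints_cases)
  define x where "x = of_rat a + of_rat b * R"
  have "of_int n = (of_rat (a\<^sup>2 - of_int s * b\<^sup>2) :: complex)" unfolding n by simp
  also have "\<dots> = (of_rat a)\<^sup>2 - R\<^sup>2 * (of_rat b)\<^sup>2" by (simp add: R of_rat_diff of_rat_mult of_rat_power)
  finally have n': "of_int n = (of_rat a)\<^sup>2 - R\<^sup>2 * (of_rat b)\<^sup>2" .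
  have "of_int t = (of_rat (2 * a) :: complex)" unfolding t by simp
  then have t': "of_int t = 2 * (of_rat a :: complex)" by (simp add: of_rat_mult)
  show "algebraic_int (of_rat a + of_rat b * R)"
  proof (rule algebraic_int.intros[of "[:of_int n, - of_int t, 1:]"])
    show "\<forall>i. Polynomial.coeff [:of_int n, - of_int t, 1:] i \<in> (\<int> :: complex set)"
      by (auto simp: coeff_pCons split: nat.splits)
    show "poly [:of_int n, - of_int t, 1:] (of_rat a + of_rat b * R) = 0"
      unfolding n' t' by (simp add: power2_eq_square algebra_simps)
  qed simp
qed

text \<open>From trace and norm, \<open>s * (2 * b)^2\<close> is an integer; as \<open>s\<close> is
  squarefree, its prime factors cannot cancel a squared denominator, so \<open>2 * b\<close> is an
  integer as well.\<close>

lemma algebraic_int_half: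
  assumes "algebraic_int (of_rat a + of_rat b * R)"
  obtains t w :: int where "a = of_int t / 2" "b = of_int w / 2" "4 dvd t\<^sup>2 - s * w\<^sup>2"
proof -
  obtain t n where t: "2 * a = of_int t" and n: "a\<^sup>2 - of_int s * b\<^sup>2 = of_int n"
    using assms unfolding algebraic_int_iff by (elim conjE Ints_cases)
  have sb: "of_int s * (2 * b)\<^sup>2 = of_int (t\<^sup>2 - 4 * n)"
    using n unfolding of_int_diff of_int_power t[symmetric] by (simp add: n[symmetric] power2_eq_square algebra_simps)
  then have "of_int s * (2 * b)\<^sup>2 \<in> \<int>" by (metis Ints_of_int)
  then have "2 * b \<in> \<int>" by (rule rat_int_if_squarefree_mult_square[OF s(1)])
  then obtain w where w: "2 * b = of_int w" by (elim Ints_cases)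
  have "(of_int (s * w\<^sup>2) :: rat) = of_int (t\<^sup>2 - 4 * n)" using sb unfolding w by simp
  then have "s * w\<^sup>2 = t\<^sup>2 - 4 * n" by (simp only: of_int_eq_iff)
  then have "4 dvd t\<^sup>2 - s * w\<^sup>2" by simp
  then show ?thesis using that[of t w] t w by (metis nonzero_mult_div_cancel_left zero_neq_numeral)
qed

definition omega :: complex where
  "omega = (if s mod 4 = 1 then (1 + R) / 2 else R)"

lemma ring_of_integers:
  "{x. (\<exists>a b. x = of_rat a + of_rat b * R) \<and> algebraic_int x} = {of_int m * 1 + of_int n * omega | m n. True}"
proof (intro Set.set_eqI iffI)
  fix x assume "x \<in> {x. (\<exists>a b. x = of_rat a + of_rat b * R) \<and> algebraic_int x}"
  then obtain a b where x: "x = of_rat a + of_rat b * R" "algebraic_int x" by blast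
  obtain t w where tw: "a = of_int t / 2" "b = of_int w / 2" "4 dvd t\<^sup>2 - s * w\<^sup>2"
    using algebraic_int_half[of a b] x by blast
  have x': "x = (of_int t + of_int w * R) / 2"
    by (simp add: x(1) tw(1,2) of_rat_divide add_divide_distrib)
  have sn4: "\<not> 4 dvd s"
  proof
    assume "4 dvd s"
    then have "2\<^sup>2 dvd s" by simp
    then have "2 dvd (1::int)" using s(1) by (rule squarefreeD[rotated])
    then show False by simp
  qed
  \<comment> \<open>Squares modulo 4 decide the shape of the ring: for \<open>s mod 4 = 1\<close>
    divisibility by 4 forces \<open>t\<close> and \<open>w\<close> to have equal parity, for the
    residues 2 and 3 it forces both to be even.\<close>
  have sqmod: "z\<^sup>2 mod 4 = (if even z then 0 else 1)" for z :: int
  proof (cases "even z")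
    case True
    then obtain y where "z = 2 * y" by auto
    then show ?thesis by (simp add: power2_eq_square)
  next
    case False
    then obtain y where "z = 2 * y + 1" by (auto elim: oddE)
    define c where "c = y * y + y"
    have "z\<^sup>2 = 4 * c + 1" using \<open>z = 2 * y + 1\<close> by (simp add: c_def power2_eq_square algebra_simps)
    then have "z\<^sup>2 mod 4 = 1" by simp
    then show ?thesis using False by simp
  qed
  have "(t\<^sup>2 - s * w\<^sup>2) mod 4 = 0" using tw(3) by simp
  moreover have "[t\<^sup>2 - s * w\<^sup>2 = t\<^sup>2 mod 4 - (s mod 4) * (w\<^sup>2 mod 4)] (mod 4)"
    by (intro cong_diff cong_mult) (simp_all add: cong_def)
  ultimately have modeq: "(t\<^sup>2 mod 4 - (s mod 4) * (w\<^sup>2 mod 4)) mod 4 = 0" by (simp add: cong_def)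
  show "x \<in> {of_int m * 1 + of_int n * omega | m n. True}"
  proof (cases "s mod 4 = 1")
    case True
    then have "even (t - w)" using modeq unfolding sqmod by (auto split: if_splits)
    then obtain z where "t = 2 * z + w" by (metis diff_add_cancel dvdE)
    then have "x = of_int z * 1 + of_int w * omega"
      unfolding x' omega_def using True by (simp add: field_simps)
    then show ?thesis by blast
  next
    case False
    then have s23: "s mod 4 = 2 \<or> s mod 4 = 3" using sn4 by presburger
    then have "even t \<and> even w" using modeq unfolding sqmod by (auto split: if_splits)
    then obtain y z where "t = 2 * y" "w = 2 * z" by (metis evenE)
    then have "x = of_int y * 1 + of_int z * omega"
      unfolding x' omega_def using False by (simp add: field_simps)
    then show ?thesis by blast
  qed
next
  fix x assume "x \<in> {of_int m * 1 + of_int n * omega | m n. True}"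
  then obtain m n where x: "x = of_int m + of_int n * omega" by auto
  show "x \<in> {x. (\<exists>a b. x = of_rat a + of_rat b * R) \<and> algebraic_int x}"
  proof (cases "s mod 4 = 1")
    case True
    define a b :: rat where "a = of_int (2 * m + n) / 2" and "b = of_int n / 2"
    have x': "x = of_rat a + of_rat b * R"
      unfolding x omega_def a_def b_def using True by (simp add: of_rat_divide of_rat_add of_rat_mult field_simps)
    obtain z where z: "s = 4 * z + 1" using True by (metis add.commute mult_div_mod_eq add.commute)
    have "2 * a = of_int (2 * m + n)" by (simp add: a_def)
    moreover have "a\<^sup>2 - of_int s * b\<^sup>2 = of_int (m\<^sup>2 + m * n - z * n\<^sup>2)"
      by (simp add: a_def b_def z power2_eq_square field_simps)
    ultimately show ?thesis using x' algebraic_int_iff[of a b] by (metis (mono_tags, lifting) Ints_of_int mem_Collect_eq)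
  next
    case False
    have x': "x = of_rat (of_int m) + of_rat (of_int n) * R" unfolding x omega_def using False by simp
    have "algebraic_int (of_rat (of_int m) + of_rat (of_int n) * R)"
      unfolding algebraic_int_iff by (auto intro!: Ints_diff Ints_mult Ints_power)
    then show ?thesis using x' by blast
  qed
qed

lemma omega_indep:
  assumes "of_int m * 1 + of_int n * omega = 0"
  shows "m = 0 \<and> n = 0"
proof (cases "s mod 4 = 1")
  case True
  have "of_rat (of_int (2 * m + n)) + of_rat (of_int n) * R = 2 * (of_int m * 1 + of_int n * omega)"
    unfolding omega_def using True by (simp add: of_rat_add of_rat_mult field_simps)
  also have "\<dots> = 0" by (simp only: assms mult_zero_right)
  finally have "(of_int (2 * m + n) :: rat) = 0 \<and> (of_int n :: rat) = 0" by (rule lin_indep)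
  then show ?thesis by simp
next
  case False
  then have "of_rat (of_int m) + of_rat (of_int n) * R = 0" using assms by (simp add: omega_def)
  then have "(of_int m :: rat) = 0 \<and> (of_int n :: rat) = 0" by (rule lin_indep)
  then show ?thesis by simp
qed

end

section \<open>Conjugation and the discriminant\<close>

locale quadratic_field_root = quadratic_root +
  fixes g y :: int
  assumes y: "y \<noteq> 0" and g: "csqrt (of_int g) = of_int y * R"
begin

lemma root_conv: "of_rat a + of_rat b * csqrt (of_int g) = of_rat a + of_rat (b * of_int y) * R"
  by (simp add: g of_rat_mult mult_ac)

lemma quadratic_field_eq: "quadratic_field g = {x. \<exists>a b. x = of_rat a + of_rat b * R}"
proof (intro Set.set_eqI iffI)
  fix x assume "x \<in> quadratic_field g"
  then show "x \<in> {x. \<exists>a b. x = of_rat a + of_rat b * R}" by (auto simp: quadratic_field_def root_conv)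
next
  fix x assume "x \<in> {x. \<exists>a b. x = of_rat a + of_rat b * R}"
  then obtain a b where "x = of_rat a + of_rat b * R" by auto
  then have "x = of_rat a + of_rat (b / of_int y) * csqrt (of_int g)" unfolding root_conv using y by simp
  then show "x \<in> quadratic_field g" unfolding quadratic_field_def by blast
qed

lemma quadratic_integers_eq: "quadratic_integers g = {of_int m * 1 + of_int n * omega | m n. True}"
  using ring_of_integers by (simp add: quadratic_integers_def quadratic_field_eq)

lemma quadratic_conj_eq: "quadratic_conj g (of_rat a + of_rat b * R) = of_rat a - of_rat b * R"
  unfolding quadratic_conj_def
proof (rule the_equality)
  have "of_rat b * R = of_rat (b / of_int y) * csqrt (of_int g)"
    using y by (simp add: g of_rat_divide)
  then show "\<exists>a' b'. of_rat a + of_rat b * R = of_rat a' + of_rat b' * csqrt (of_int g) \<and>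
      of_rat a - of_rat b * R = of_rat a' - of_rat b' * csqrt (of_int g)" by metis
next
  fix z assume "\<exists>a' b'. of_rat a + of_rat b * R = of_rat a' + of_rat b' * csqrt (of_int g) \<and>
      z = of_rat a' - of_rat b' * csqrt (of_int g)"
  then obtain a' b' where ab: "of_rat a + of_rat b * R = of_rat a' + of_rat b' * csqrt (of_int g)"
    "z = of_rat a' - of_rat b' * csqrt (of_int g)" by blast
  have "a = a' \<and> b = b' * of_int y" using ab(1) unfolding root_conv by (rule rep_unique)
  then show "z = of_rat a - of_rat b * R" using ab(2) by (simp add: g of_rat_mult mult_ac)
qed

definition omega' :: complex where
  "omega' = (if s mod 4 = 1 then (1 - R) / 2 else - R)"

lemma quadratic_conj_integer: "quadratic_conj g (of_int m * 1 + of_int n * omega) = of_int m + of_int n * omega'"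
proof (cases "s mod 4 = 1")
  case True
  define a b :: rat where "a = of_int (2 * m + n) / 2" and "b = of_int n / 2"
  have "of_int m * 1 + of_int n * omega = of_rat a + of_rat b * R"
    unfolding omega_def a_def b_def using True by (simp add: of_rat_divide of_rat_add of_rat_mult field_simps)
  then have "quadratic_conj g (of_int m * 1 + of_int n * omega) = of_rat a - of_rat b * R"
    by (simp only: quadratic_conj_eq)
  also have "\<dots> = of_int m + of_int n * omega'"
    unfolding omega'_def a_def b_def using True by (simp add: of_rat_divide of_rat_add of_rat_mult field_simps)
  finally show ?thesis .
next
  case False
  have "of_int m * 1 + of_int n * omega = of_rat (of_int m) + of_rat (of_int n) * R"
    unfolding omega_def using False by simp
  then have "quadratic_conj g (of_int m * 1 + of_int n * omega) = of_rat (of_int m) - of_rat (of_int n) * R"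
    by (simp only: quadratic_conj_eq)
  then show ?thesis unfolding omega'_def using False by simp
qed

definition disc :: int where "disc = (if s mod 4 = 1 then s else 4 * s)"

lemma omega_disc: "(omega' - omega)\<^sup>2 = of_int disc"
proof (cases "s mod 4 = 1")
  case True
  then have "omega' - omega = - R" by (simp add: omega_def omega'_def diff_divide_distrib[symmetric])
  then show ?thesis using True by (simp add: disc_def R)
next
  case False
  then have "omega' - omega = - (2 * R)" by (simp add: omega_def omega'_def)
  then show ?thesis using False by (simp add: disc_def R power_mult_distrib)
qed

lemma integral_basis_1_omega: "is_integral_basis g 1 omega"
  unfolding is_integral_basis_def quadratic_integers_eq using omega_indep by blast

text \<open>Two integral bases are related by integer matrices inverse to each other, so the
  determinant is 1 or -1 and disappears on squaring. This makes the description in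
  \<open>quadratic_disc\<close> unique.\<close>

lemma disc_of_basis:
  assumes "is_integral_basis g u v"
  shows "(u * quadratic_conj g v - v * quadratic_conj g u)\<^sup>2 = of_int disc"
proof -
  have Z: "quadratic_integers g = {of_int m * u + of_int n * v | m n. True}"
    and ind: "\<And>m n :: int. of_int m * u + of_int n * v = 0 \<Longrightarrow> m = 0 \<and> n = 0"
    using assms by (auto simp: is_integral_basis_def)
  have "of_int 1 * u + of_int 0 * v \<in> quadratic_integers g" "of_int 0 * u + of_int 1 * v \<in> quadratic_integers g"
    unfolding Z by blast+
  then obtain a b c d where u: "u = of_int a * 1 + of_int b * omega" and v: "v = of_int c * 1 + of_int d * omega"
    unfolding quadratic_integers_eq by auto
  have "of_int 1 * 1 + of_int 0 * omega \<in> quadratic_integers g" "of_int 0 * 1 + of_int 1 * omega \<in> quadratic_integers g"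
    unfolding quadratic_integers_eq by blast+
  then obtain a' b' c' d' where w: "1 = of_int a' * u + of_int b' * v" "omega = of_int c' * u + of_int d' * v"
    unfolding Z by auto
  have "of_int (a' * a + b' * c - 1) * 1 + of_int (a' * b + b' * d) * omega = (of_int a' * u + of_int b' * v) - 1"
    unfolding u v by (simp add: algebra_simps)
  then have "of_int (a' * a + b' * c - 1) * 1 + of_int (a' * b + b' * d) * omega = 0" using w(1) by simp
  from omega_indep[OF this] have e1: "a' * a + b' * c = 1" "a' * b + b' * d = 0" by auto
  have "of_int (c' * a + d' * c) * 1 + of_int (c' * b + d' * d - 1) * omega = (of_int c' * u + of_int d' * v) - omega"
    unfolding u v by (simp add: algebra_simps)
  then have "of_int (c' * a + d' * c) * 1 + of_int (c' * b + d' * d - 1) * omega = 0" using w(2) by simp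
  from omega_indep[OF this] have e2: "c' * a + d' * c = 0" "c' * b + d' * d = 1" by auto
  have "(a' * d' - b' * c') * (a * d - b * c) =
      (a' * a + b' * c) * (c' * b + d' * d) - (a' * b + b' * d) * (c' * a + d' * c)"
    by (simp add: algebra_simps)
  also have "\<dots> = 1" unfolding e1 e2 by simp
  finally have "(a * d - b * c) dvd 1" by (metis dvd_triv_right)
  then have "\<bar>a * d - b * c\<bar> = 1" by simp
  then have det: "(a * d - b * c)\<^sup>2 = 1" by (metis power2_abs one_power2)
  have "u * quadratic_conj g v - v * quadratic_conj g u = of_int (a * d - b * c) * (omega' - omega)"
    unfolding u v quadratic_conj_integer by (simp add: algebra_simps)
  then have "(u * quadratic_conj g v - v * quadratic_conj g u)\<^sup>2 = of_int ((a * d - b * c)\<^sup>2) * (omega' - omega)\<^sup>2"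
    by (simp add: power_mult_distrib)
  then show ?thesis unfolding det omega_disc by simp
qed

lemma quadratic_disc_eq: "quadratic_disc g = disc"
  unfolding quadratic_disc_def
proof (rule the_equality)
  show "\<exists>u v. is_integral_basis g u v \<and> of_int disc = (u * quadratic_conj g v - v * quadratic_conj g u)\<^sup>2"
    using integral_basis_1_omega disc_of_basis by metis
  fix d :: int assume "\<exists>u v. is_integral_basis g u v \<and> of_int d = (u * quadratic_conj g v - v * quadratic_conj g u)\<^sup>2"
  then show "d = disc" using disc_of_basis by (metis of_int_eq_iff)
qed

end

lemma quadratic_disc_squarefree:
  assumes s: "squarefree s" "s \<noteq> 1" and y: "y \<noteq> 0"
  shows "quadratic_disc (s * y\<^sup>2) = (if s mod 4 = 1 then s else 4 * s)"
proof -
  \<comment> \<open>Dividing the fixed root of \<open>g\<close> by \<open>y\<close>, in place of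
    taking \<open>csqrt s\<close>, makes \<open>csqrt g = y * R\<close> hold for either sign of
    \<open>y\<close>.\<close>
  define R where "R = csqrt (of_int (s * y\<^sup>2)) / of_int y"
  have "R\<^sup>2 = of_int s" using y by (simp add: R_def power_divide)
  then interpret quadratic_field_root s R "s * y\<^sup>2" y
    using s y by unfold_locales (simp_all add: R_def)
  show ?thesis using quadratic_disc_eq by (simp add: disc_def)
qed

section \<open>Local factors\<close>

text \<open>The condition \<open>p mod q = 1\<close> stands for \<open>q dvd p - 1\<close>. The
  value \<open>c q = 1 / q\<close> gives the totient factor, and \<open>c q = 1\<close> excludes
  \<open>p\<close> altogether.\<close>

definition sieve_factor :: "(nat \<Rightarrow> real) \<Rightarrow> nat set \<Rightarrow> nat \<Rightarrow> real" where
  "sieve_factor c T p = (\<Prod>q\<in>T. 1 - c q * (if p mod q = 1 then 1 else 0))"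

definition sieve_mean :: "(nat \<Rightarrow> real) \<Rightarrow> nat set \<Rightarrow> real" where
  "sieve_mean c T = (\<Prod>q\<in>T. 1 - c q / (real q - 1))"

text \<open>The ratio of the mean of the sieve factor twisted by the Legendre symbol of $s$ to the untwisted
  mean. For $s \not\equiv 1 \pmod 4$ the symbol involves a nonprincipal character modulo 8, which
  the sieve factor at odd primes cannot compensate.\<close>
definition disc_correction :: "(nat \<Rightarrow> real) \<Rightarrow> int \<Rightarrow> real" where
  "disc_correction c s =
     (if s mod 4 = 1 then \<Prod>q\<in>odd_prime_divisors s. - c q / (real q - 1 - c q) else 0)"

lemma odd_prime_gt_2: "prime q \<Longrightarrow> odd q \<Longrightarrow> q > (2::nat)"
  using prime_ge_2_nat[of q] by (cases "q = 2") auto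

lemma sum_indicator_1:
  assumes "q > (1::nat)"
  shows "(\<Sum>a\<in>{1..<q}. f a * (1 - c * (if a = 1 then 1 else 0))) = (\<Sum>a\<in>{1..<q}. f a) - c * (f 1 :: complex)"
proof -
  have "(\<Sum>a\<in>{1..<q}. f a * (1 - c * (if a = 1 then 1 else 0))) = (\<Sum>a\<in>{1..<q}. f a - (if a = 1 then c * f 1 else 0))"
    by (intro sum.cong) (auto simp: algebra_simps)
  also have "\<dots> = (\<Sum>a\<in>{1..<q}. f a) - c * f 1"
    unfolding sum_subtractf using assms by simp
  finally show ?thesis .
qed

lemma has_prime_mean_sieve:
  assumes T: "finite T" "\<And>q. q \<in> T \<Longrightarrow> prime q"
  shows "has_prime_mean k (\<lambda>p. of_real (sieve_factor c T p)) (of_real (sieve_mean c T))"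
proof -
  define u where "u q a = 1 * (1 - complex_of_real (c q) * (if a = 1 then 1 else 0))" for q a :: nat
  have char: "dirichlet_character 1 (\<lambda>_. 1)"
    by (simp add: dirichlet_character_def completely_multiplicative_def)
  have princ: "principal_character 1 (\<lambda>_. 1)" by (simp add: principal_character_def)
  have "has_prime_mean k (\<lambda>p. 1 * (\<Prod>q\<in>T. u q (p mod q)))
      ((if principal_character 1 (\<lambda>_. 1) then 1 else 0) * (\<Prod>q\<in>T. (\<Sum>a\<in>{1..<q}. u q a) / of_nat (q - 1)))"
  proof (rule has_prime_mean_prod[OF T char])
    show "\<not> q dvd 1" if "q \<in> T" for q using T(2)[OF that] by (metis not_prime_unit)
  qed
  moreover have "(\<Sum>a\<in>{1..<q}. u q a) / of_nat (q - 1) = of_real (1 - c q / (real q - 1))" if "q \<in> T" for q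
  proof -
    have q1: "q > 1" using T(2)[OF that] by (rule prime_gt_1_nat)
    then show ?thesis
      unfolding u_def sum_indicator_1[OF q1] by (simp add: of_nat_diff divide_simps)
  qed
  then have "(\<Prod>q\<in>T. (\<Sum>a\<in>{1..<q}. u q a) / of_nat (q - 1)) = of_real (sieve_mean c T)"
    unfolding sieve_mean_def of_real_prod by (intro prod.cong) auto
  moreover have "(\<Prod>q\<in>T. u q (p mod q)) = of_real (sieve_factor c T p)" for p
    unfolding sieve_factor_def u_def of_real_prod by (intro prod.cong) auto
  ultimately show ?thesis using princ by simp
qed

lemma Legendre_mult_square:
  assumes p: "prime (p::nat)" "p > 2" "\<not> int p dvd y"
  shows "Legendre (s * y\<^sup>2) (int p) = Legendre s (int p)"
proof -
  have "Legendre y (int p) * Legendre y (int p) = 1"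
    using Legendre_values[of y "int p"] p(3) by (auto simp: Legendre_eq_0_iff)
  then show ?thesis by (simp add: Legendre_mult[OF p(1,2)] power2_eq_square)
qed

text \<open>At a prime \<open>q\<close> of \<open>s\<close> the Legendre factor sums to zero over
  the nonzero classes, so only the term removed at the class 1 survives and the local mean is
  \<open>- c q / (q - 1)\<close>. Divided by the untwisted \<open>1 - c q / (q - 1)\<close>, this is
  the factor in \<open>disc_correction\<close>. A prime of \<open>s\<close> outside \<open>T\<close>
  has local mean 0, and modulo 8 the mean is 0 unless \<open>s mod 4 = 1\<close>.\<close>

lemma has_prime_mean_Legendre_sieve:
  assumes s: "squarefree s" and y: "y \<noteq> 0"
    and T: "finite T" "\<And>q. q \<in> T \<Longrightarrow> prime q \<and> odd q"
    and c: "\<And>q. q \<in> T \<Longrightarrow> 0 \<le> c q \<and> c q \<le> 1"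
  shows "has_prime_mean k (\<lambda>p. of_int (Legendre (s * y\<^sup>2) (int p)) * of_real (sieve_factor c T p))
    (of_real (if odd_prime_divisors s \<subseteq> T then sieve_mean c T * disc_correction c s else 0))"
proof -
  define S where "S = odd_prime_divisors s"
  have s0: "s \<noteq> 0" using s by auto
  have finS: "finite S" unfolding S_def by (rule finite_odd_prime_divisors[OF s0])
  have S: "prime q \<and> odd q" if "q \<in> S" for q using that by (simp add: S_def odd_prime_divisors_def)
  have sn4: "\<not> 4 dvd s"
  proof
    assume "4 dvd s"
    then have "2\<^sup>2 dvd s" by simp
    then have "2 dvd (1::int)" using s by (rule squarefreeD[rotated])
    then show False by simp
  qed
  define L where "L q a = (if q \<in> S then of_int (Legendre (int a) (int q)) else 1 :: complex)" for q a :: nat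
  \<comment> \<open>Extended by 0 outside \<open>T\<close>, so that the Legendre factors over
    \<open>S\<close> and the sieve factors over \<open>T\<close> share one index set.\<close>
  define c' where "c' q = (if q \<in> T then complex_of_real (c q) else 0)" for q
  define u where "u q a = L q a * (1 - c' q * (if a = 1 then 1 else 0))" for q a
  define e where "e q = (if q \<in> S then - c' q / (of_nat q - 1) else 1 - c' q / (of_nat q - 1))" for q
  have pr: "prime q \<and> odd q" if "q \<in> S \<union> T" for q using that S T(2) by blast
  have mean: "has_prime_mean k (\<lambda>p. of_int (two_part_character s p) * (\<Prod>q\<in>S \<union> T. u q (p mod q)))
      ((if principal_character 8 (\<lambda>n. of_int (two_part_character s n)) then 1 else 0) *
       (\<Prod>q\<in>S \<union> T. (\<Sum>a\<in>{1..<q}. u q a) / of_nat (q - 1)))"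
  proof (rule has_prime_mean_prod[OF _ _ two_part_character_dirichlet])
    fix q assume "q \<in> S \<union> T"
    then have q: "prime q" "odd q" using pr by auto
    then show "prime q" by simp
    show "\<not> q dvd 8"
    proof
      assume "q dvd 8"
      then have "q dvd 2 ^ 3" by simp
      then have "q dvd 2" using q(1) prime_dvd_power by blast
      then show False using odd_prime_gt_2[OF q] by (auto dest: dvd_imp_le)
    qed
  qed (use finS T in auto)
  have loc: "(\<Sum>a\<in>{1..<q}. u q a) / of_nat (q - 1) = e q" if "q \<in> S \<union> T" for q
  proof -
    have q: "prime q" "odd q" using pr[OF that] by auto
    have q2: "q > 2" by (rule odd_prime_gt_2[OF q])
    then have q1: "q > 1" by simp
    have n: "(of_nat (q - 1) :: complex) = of_nat q - 1" using q1 by (simp add: of_nat_diff)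
    have n0: "(of_nat q - 1 :: complex) \<noteq> 0" using q1 by simp
    have "(\<Sum>a\<in>{1..<q}. u q a) = (\<Sum>a\<in>{1..<q}. L q a) - c' q * L q 1"
      unfolding u_def by (rule sum_indicator_1[OF q1])
    also have "L q 1 = 1" using q2 by (simp add: L_def Legendre_1)
    also have "(\<Sum>a\<in>{1..<q}. L q a) = (if q \<in> S then 0 else of_nat q - 1)"
    proof (cases "q \<in> S")
      case True
      have "(\<Sum>a\<in>{1..<q}. L q a) = of_int (\<Sum>a\<in>{1..<q}. Legendre (int a) (int q))"
        using True by (simp add: L_def)
      then show ?thesis unfolding sum_Legendre_eq_0[OF q(1) q2] using True by simp
    next
      case False
      then show ?thesis using n by (simp add: L_def)
    qed
    finally show ?thesis unfolding n e_def using n0 by (simp add: diff_divide_distrib)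
  qed
  have val: "(if principal_character 8 (\<lambda>n. of_int (two_part_character s n)) then 1 else 0) *
       (\<Prod>q\<in>S \<union> T. (\<Sum>a\<in>{1..<q}. u q a) / of_nat (q - 1))
     = of_real (if S \<subseteq> T then sieve_mean c T * disc_correction c s else 0)"
  proof (cases "s mod 4 = 1")
    case False
    then show ?thesis by (simp add: principal_two_part_character_iff[OF sn4] disc_correction_def)
  next
    case True
    have "(\<Prod>q\<in>S \<union> T. (\<Sum>a\<in>{1..<q}. u q a) / of_nat (q - 1)) = (\<Prod>q\<in>S \<union> T. e q)"
      by (intro prod.cong refl loc)
    also have "\<dots> = of_real (if S \<subseteq> T then sieve_mean c T * disc_correction c s else 0)"
    proof (cases "S \<subseteq> T")
      case False
      then obtain q where "q \<in> S" "q \<notin> T" by blast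
      then have "q \<in> S \<union> T" "e q = 0" by (auto simp: e_def c'_def)
      then have "(\<Prod>q\<in>S \<union> T. e q) = 0" using finS T(1) by (intro prod_zero) auto
      then show ?thesis using False by simp
    next
      case ST: True
      have "(\<Prod>q\<in>S \<union> T. e q) = (\<Prod>q\<in>T. of_real (1 - c q / (real q - 1)) * (if q \<in> S then of_real (- c q / (real q - 1 - c q)) else 1))"
      proof (rule prod.cong)
        fix q assume q: "q \<in> T"
        have "real q > 2" using T(2)[OF q] odd_prime_gt_2[of q] by simp
        then have "real q - 1 \<noteq> 0" "real q - 1 - c q \<noteq> 0" using c[OF q] by auto
        then have "(1 - c q / (real q - 1)) * (- c q / (real q - 1 - c q)) = - c q / (real q - 1)"
          by (simp add: divide_simps)
        then have "(complex_of_real (1 - c q / (real q - 1))) * of_real (- c q / (real q - 1 - c q)) = of_real (- c q / (real q - 1))"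
          by (simp only: of_real_mult[symmetric])
        then show "e q = of_real (1 - c q / (real q - 1)) * (if q \<in> S then of_real (- c q / (real q - 1 - c q)) else 1)"
          using q by (auto simp: e_def c'_def)
      qed (use ST in auto)
      also have "\<dots> = of_real (sieve_mean c T) * (\<Prod>q\<in>T. if q \<in> S then of_real (- c q / (real q - 1 - c q)) else 1)"
        unfolding prod.distrib sieve_mean_def by simp
      also have "(\<Prod>q\<in>T. if q \<in> S then complex_of_real (- c q / (real q - 1 - c q)) else 1) = (\<Prod>q\<in>S. of_real (- c q / (real q - 1 - c q)))"
        using ST T(1) by (intro prod.mono_neutral_cong_right) auto
      also have "\<dots> = of_real (disc_correction c s)"
        using True by (simp add: disc_correction_def S_def)
      finally show ?thesis using ST by simp
    qed
    finally show ?thesis using True by (simp add: principal_two_part_character_iff[OF sn4])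
  qed
  have "has_prime_mean k (\<lambda>p. of_int (Legendre (s * y\<^sup>2) (int p)) * of_real (sieve_factor c T p))
      ((if principal_character 8 (\<lambda>n. of_int (two_part_character s n)) then 1 else 0) *
       (\<Prod>q\<in>S \<union> T. (\<Sum>a\<in>{1..<q}. u q a) / of_nat (q - 1)))"
  proof (rule has_prime_mean_cong_large[OF mean])
    fix p assume p: "prime p" "p > max 2 (nat (\<bar>s\<bar> + \<bar>y\<bar>))"
    then have p2: "p > 2" by simp
    have "\<bar>s\<bar> + \<bar>y\<bar> < int p" using p(2) by linarith
    then have ns: "\<not> int p dvd s" and ny: "\<not> int p dvd y"
      using s0 y by (auto dest!: dvd_imp_le_int)
    have "Legendre (s * y\<^sup>2) (int p) = two_part_character s p * (\<Prod>q\<in>S. Legendre (int p) (int q))"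
      unfolding Legendre_mult_square[OF p(1) p2 ny] S_def by (rule Legendre_squarefree[OF s p(1) p2 ns])
    then have leg: "complex_of_int (Legendre (s * y\<^sup>2) (int p)) = of_int (two_part_character s p) * (\<Prod>q\<in>S. of_int (Legendre (int p) (int q)))"
      by simp
    have "(\<Prod>q\<in>S. complex_of_int (Legendre (int p) (int q))) = (\<Prod>q\<in>S \<union> T. L q (p mod q))"
      using finS T(1) by (intro prod.mono_neutral_cong_left) (auto simp: L_def zmod_int Legendre_mod)
    moreover have "of_real (sieve_factor c T p) = (\<Prod>q\<in>S \<union> T. 1 - c' q * (if p mod q = 1 then 1 else 0))"
      unfolding sieve_factor_def of_real_prod using finS T(1)
      by (intro prod.mono_neutral_cong_left) (auto simp: c'_def)
    ultimately show "of_int (two_part_character s p) * (\<Prod>q\<in>S \<union> T. u q (p mod q)) =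
        of_int (Legendre (s * y\<^sup>2) (int p)) * of_real (sieve_factor c T p)"
      unfolding leg u_def prod.distrib by simp
  qed
  then show ?thesis unfolding val unfolding S_def .
qed

definition nonresidue :: "int \<Rightarrow> nat \<Rightarrow> real" where
  "nonresidue g p = (if p \<noteq> 2 \<and> Legendre g (int p) = -1 then 1 else 0)"

text \<open>For primes not dividing \<open>g = s * y^2\<close> the indicator of the symbol being -1
  is half of 1 minus the symbol; the two halves are the two means computed before.\<close>

lemma has_prime_mean_nonresidue_sieve:
  assumes s: "squarefree s" and y: "y \<noteq> 0"
    and T: "finite T" "\<And>q. q \<in> T \<Longrightarrow> prime q \<and> odd q"
    and c: "\<And>q. q \<in> T \<Longrightarrow> 0 \<le> c q \<and> c q \<le> 1"
  shows "has_prime_mean k (\<lambda>p. of_real (nonresidue (s * y\<^sup>2) p * sieve_factor c T p))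
    (of_real (1 / 2 * sieve_mean c T * (1 - (if odd_prime_divisors s \<subseteq> T then disc_correction c s else 0))))"
proof -
  have s0: "s \<noteq> 0" using s by auto
  have "has_prime_mean k (\<lambda>p. (1 / 2) * of_real (sieve_factor c T p) +
      (- 1 / 2) * (of_int (Legendre (s * y\<^sup>2) (int p)) * of_real (sieve_factor c T p)))
     ((1 / 2) * of_real (sieve_mean c T) +
      (- 1 / 2) * (of_real (if odd_prime_divisors s \<subseteq> T then sieve_mean c T * disc_correction c s else 0)))"
    by (intro has_prime_mean_add has_prime_mean_cmult has_prime_mean_sieve has_prime_mean_Legendre_sieve s y T c)
      (use T(2) in auto)
  then have "has_prime_mean k (\<lambda>p. of_real (nonresidue (s * y\<^sup>2) p * sieve_factor c T p))
     ((1 / 2) * of_real (sieve_mean c T) +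
      (- 1 / 2) * (of_real (if odd_prime_divisors s \<subseteq> T then sieve_mean c T * disc_correction c s else 0)))"
  proof (rule has_prime_mean_cong_large)
    fix p assume p: "prime p" "p > max 2 (nat \<bar>s * y\<^sup>2\<bar>)"
    have g0: "s * y\<^sup>2 \<noteq> 0" using s0 y by simp
    have "\<bar>s * y\<^sup>2\<bar> < int p" using p(2) by linarith
    then have "\<not> int p dvd s * y\<^sup>2" using dvd_imp_le_int[OF g0, of "int p"] by auto
    then have "Legendre (s * y\<^sup>2) (int p) = 1 \<or> Legendre (s * y\<^sup>2) (int p) = -1"
      using Legendre_values[of "s * y\<^sup>2" "int p"] by (simp add: Legendre_eq_0_iff)
    then show "(1 / 2) * of_real (sieve_factor c T p) + (- 1 / 2) * (of_int (Legendre (s * y\<^sup>2) (int p)) * of_real (sieve_factor c T p))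
        = complex_of_real (nonresidue (s * y\<^sup>2) p * sieve_factor c T p)"
      using p(2) by (auto simp: nonresidue_def)
  qed
  moreover have "(1 / 2) * complex_of_real (sieve_mean c T) +
      (- 1 / 2) * (of_real (if odd_prime_divisors s \<subseteq> T then sieve_mean c T * disc_correction c s else 0))
     = of_real (1 / 2 * sieve_mean c T * (1 - (if odd_prime_divisors s \<subseteq> T then disc_correction c s else 0)))"
    by (simp add: algebra_simps)
  ultimately show ?thesis by (simp only:)
qed

text \<open>Combines the condition \<open>gcd (p - 1) h = 1\<close> with the totient factors: a
  prime \<open>q\<close> of \<open>h\<close> excludes every \<open>p\<close> congruent to 1 modulo
  \<open>q\<close>, any other \<open>q\<close> contributes \<open>1 - 1 / q\<close> there.\<close>

definition sieve_weight :: "nat \<Rightarrow> nat \<Rightarrow> real" where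
  "sieve_weight h q = (if q dvd h then 1 else 1 / real q)"

lemma sieve_weight_bounds: "0 \<le> sieve_weight h q" "sieve_weight h q \<le> 1"
  by (auto simp: sieve_weight_def divide_le_eq)

lemma prime_factors_squarefree_odd_int:
  fixes s :: int
  assumes "squarefree s" "odd s"
  shows "prime_factors (nat \<bar>s\<bar>) = odd_prime_divisors s" "squarefree (nat \<bar>s\<bar>)"
proof -
  have s0: "s \<noteq> 0" using assms by auto
  have dv: "int q dvd s \<longleftrightarrow> q dvd nat \<bar>s\<bar>" for q by (simp add: dvd_nat_abs_iff)
  have "odd q" if "int q dvd s" for q using that assms(2) by (metis dvd_trans even_of_nat)
  then show "prime_factors (nat \<bar>s\<bar>) = odd_prime_divisors s"
    using s0 unfolding odd_prime_divisors_def dv by (subst prime_factors_dvd) auto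
  show "squarefree (nat \<bar>s\<bar>)"
  proof (rule squarefreeI)
    fix x assume "x\<^sup>2 dvd nat \<bar>s\<bar>"
    then have "int (x\<^sup>2) dvd s" by (simp only: dv)
    then have "(int x)\<^sup>2 dvd s" by simp
    then have "int x dvd 1" using assms(1) by (rule squarefreeD[rotated])
    then show "x dvd 1" by simp
  qed
qed

text \<open>The local factor \<open>- c / (q - 1 - c)\<close> is \<open>- 1 / (q - 2)\<close> for
  \<open>c = 1\<close> and \<open>- 1 / (q^2 - q - 1)\<close> for \<open>c = 1 / q\<close>; the
  signs multiply to \<open>moebius\<close>. If \<open>s mod 4\<close> is not 1, the discriminant
  \<open>4 * s\<close> is not squarefree and both corrections vanish.\<close>

lemma A_d_eq:
  assumes s: "squarefree s"
  shows "A_d h (if s mod 4 = 1 then s else 4 * s) = 1 - disc_correction (sieve_weight h) s"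
proof (cases "s mod 4 = 1")
  case False
  have "\<not> squarefree (nat \<bar>4 * s\<bar>)"
  proof
    assume "squarefree (nat \<bar>4 * s\<bar>)"
    moreover have "2\<^sup>2 dvd nat \<bar>4 * s\<bar>" by (simp add: nat_abs_mult_distrib)
    ultimately have "(2::nat) dvd 1" by (rule squarefreeD)
    then show False by simp
  qed
  then show ?thesis using False by (simp add: A_d_def moebius_def disc_correction_def)
next
  case True
  define S where "S = odd_prime_divisors s"
  have s0: "s \<noteq> 0" using s by auto
  have finS: "finite S" unfolding S_def by (rule finite_odd_prime_divisors[OF s0])
  have "odd s" using True by presburger
  note pf = prime_factors_squarefree_odd_int[OF s this]
  have mob: "moebius (nat \<bar>s\<bar>) = (-1) ^ card S" using pf by (simp add: moebius_def S_def)
  have "{p. prime p \<and> int p dvd s} = S"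
    using \<open>odd s\<close> by (auto simp: S_def odd_prime_divisors_def dest: dvd_trans)
  then have sets: "{p. prime p \<and> int p dvd s \<and> p dvd h} = {p\<in>S. p dvd h}"
    "{p. prime p \<and> int p dvd s \<and> \<not> p dvd h} = {p\<in>S. \<not> p dvd h}" by auto
  have "disc_correction (sieve_weight h) s = (\<Prod>q\<in>S. -1 * ((if q dvd h then 1 / (real q - 2) else 1) * (if \<not> q dvd h then 1 / ((real q)\<^sup>2 - real q - 1) else 1)))"
    unfolding disc_correction_def if_P[OF True] S_def[symmetric]
  proof (intro prod.cong refl)
    fix q assume "q \<in> S"
    then have q2: "real q > 2" using odd_prime_gt_2[of q] by (simp add: S_def odd_prime_divisors_def)
    show "- sieve_weight h q / (real q - 1 - sieve_weight h q) =
        -1 * ((if q dvd h then 1 / (real q - 2) else 1) * (if \<not> q dvd h then 1 / ((real q)\<^sup>2 - real q - 1) else 1))"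
    proof (cases "q dvd h")
      case False
      have "real q * (real q - 1 - 1 / real q) = (real q)\<^sup>2 - real q - 1"
        using q2 by (simp add: algebra_simps power2_eq_square)
      moreover have "(1 / real q) / (real q - 1 - 1 / real q) = 1 / (real q * (real q - 1 - 1 / real q))" by simp
      ultimately show ?thesis using False by (simp add: sieve_weight_def)
    qed (simp add: sieve_weight_def)
  qed
  also have "\<dots> = (-1) ^ card S * ((\<Prod>q\<in>S. if q dvd h then 1 / (real q - 2) else 1) * (\<Prod>q\<in>S. if \<not> q dvd h then 1 / ((real q)\<^sup>2 - real q - 1) else 1))"
    unfolding prod.distrib by simp
  also have "(\<Prod>q\<in>S. if q dvd h then 1 / (real q - 2) else 1) = (\<Prod>q | q \<in> S \<and> q dvd h. 1 / (real q - 2))"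
    by (rule prod.inter_filter[OF finS, symmetric])
  also have "(\<Prod>q\<in>S. if \<not> q dvd h then 1 / ((real q)\<^sup>2 - real q - 1) else 1) = (\<Prod>q | q \<in> S \<and> \<not> q dvd h. 1 / ((real q)\<^sup>2 - real q - 1))"
    by (rule prod.inter_filter[OF finS, symmetric])
  finally show ?thesis using True by (simp add: A_d_def mob sets)
qed

section \<open>The limit of the ratio\<close>

definition prime_divisors :: "nat \<Rightarrow> nat set" where
  "prime_divisors h = {q. prime q \<and> q dvd h}"

text \<open>The prime 2 is kept apart: it divides \<open>p - 1\<close> for every odd
  \<open>p\<close>, so its totient factor is the constant 1/2, and the moduli in the product of
  local factors must be coprime to 8.\<close>

definition odd_primes_le :: "nat \<Rightarrow> nat set" where
  "odd_primes_le Q = {q. prime q \<and> odd q \<and> q \<le> Q}"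

lemma finite_prime_divisors: "h > 0 \<Longrightarrow> finite (prime_divisors h)"
  by (rule finite_subset[of _ "{..h}"]) (auto simp: prime_divisors_def dest: dvd_imp_le)

lemma finite_odd_primes_le: "finite (odd_primes_le Q)"
  by (rule finite_subset[of _ "{..Q}"]) (auto simp: odd_primes_le_def)

lemma prime_divisors_odd: "odd h \<Longrightarrow> q \<in> prime_divisors h \<Longrightarrow> prime q \<and> odd q"
  unfolding prime_divisors_def using dvd_trans by blast

lemma sieve_factor_prime_divisors:
  assumes h: "h > 0" and p: "prime p"
  shows "sieve_factor (sieve_weight h) (prime_divisors h) p = (if gcd (p - 1) h = 1 then 1 else 0)"
proof (cases "gcd (p - 1) h = 1")
  case True
  have "p mod q \<noteq> 1" if "q \<in> prime_divisors h" for q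
  proof
    assume "p mod q = 1"
    then have "q dvd p - 1" using that p prime_mod_eq_1_iff_dvd[of p q] by (simp add: prime_divisors_def)
    then have "q dvd gcd (p - 1) h" using that by (simp add: prime_divisors_def)
    then have "q dvd 1" using True by (simp only:)
    then show False using that by (simp add: prime_divisors_def)
  qed
  then show ?thesis using True unfolding sieve_factor_def by (simp add: prod.neutral)
next
  case False
  then obtain q where q: "prime q" "q dvd gcd (p - 1) h" using prime_factor_nat by blast
  then have "q \<in> prime_divisors h" "p mod q = 1"
    using prime_mod_eq_1_iff_dvd[OF p q(1)] by (auto simp: prime_divisors_def)
  then show ?thesis using False finite_prime_divisors[OF h] unfolding sieve_factor_def
    by (auto simp: prime_divisors_def sieve_weight_def intro!: prod_zero bexI[of _ q])
qed

lemma totient_trunc_eq_sieve: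
  assumes p: "prime p" "p > 2"
  shows "totient_trunc Q (p - 1) = (if Q \<ge> 2 then 1 / 2 else 1) * sieve_factor (\<lambda>q. 1 / real q) (odd_primes_le Q) p"
proof -
  have op: "odd p" using p by (simp add: prime_odd_nat)
  define f where "f q = 1 - 1 / real q * (if p mod q = 1 then 1 else 0)" for q
  have "totient_trunc Q (p - 1) = (\<Prod>q | prime q \<and> q \<le> Q. f q)"
    unfolding totient_trunc_def
  proof (rule prod.mono_neutral_cong_left)
    have iff: "p mod q = 1 \<longleftrightarrow> q dvd p - 1" if "prime q" for q
      using prime_mod_eq_1_iff_dvd[OF p(1) that] by simp
    show "\<forall>q\<in>{q. prime q \<and> q \<le> Q} - {q. prime q \<and> q \<le> Q \<and> q dvd p - 1}. f q = 1"
      using iff by (simp add: f_def)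
    show "1 - 1 / real q = f q" if "q \<in> {q. prime q \<and> q \<le> Q \<and> q dvd p - 1}" for q
      using iff that by (simp add: f_def)
  qed auto
  also have "{q. prime q \<and> q \<le> Q} = (if Q \<ge> 2 then {2} else {}) \<union> odd_primes_le Q"
  proof -
    have "x = 2" if "prime x" "even x" for x :: nat using primes_dvd_imp_eq[of 2 x] that by auto
    then show ?thesis by (auto simp: odd_primes_le_def)
  qed
  also have "(\<Prod>q\<in>\<dots>. f q) = (if Q \<ge> 2 then f 2 else 1) * (\<Prod>q\<in>odd_primes_le Q. f q)"
    using finite_odd_primes_le by (subst prod.union_disjoint) (auto simp: odd_primes_le_def)
  also have "f 2 = 1 / 2" using op by (simp add: f_def odd_iff_mod_2_eq_one)
  finally show ?thesis by (simp add: sieve_factor_def f_def)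
qed

text \<open>At a prime of \<open>h\<close> that occurs in both products, a \<open>p\<close>
  congruent to 1 is already excluded, so the additional totient factor changes nothing.\<close>

lemma sieve_factor_mult:
  assumes h: "h > 0"
  shows "sieve_factor (sieve_weight h) (prime_divisors h) p * sieve_factor (\<lambda>q. 1 / real q) (odd_primes_le Q) p
       = sieve_factor (sieve_weight h) (prime_divisors h \<union> odd_primes_le Q) p"
proof -
  let ?H = "prime_divisors h" and ?O = "odd_primes_le Q"
  define i where "i q = (if p mod q = 1 then 1 else (0::real))" for q
  note fin = finite_prime_divisors[OF h] finite_odd_primes_le[of Q]
  have "sieve_factor (sieve_weight h) ?H p = (\<Prod>q\<in>?H \<union> ?O. if q \<in> ?H then 1 - sieve_weight h q * i q else 1)"
    unfolding sieve_factor_def i_def[symmetric] using fin by (intro prod.mono_neutral_cong_left) auto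
  moreover have "sieve_factor (\<lambda>q. 1 / real q) ?O p = (\<Prod>q\<in>?H \<union> ?O. if q \<in> ?O then 1 - 1 / real q * i q else 1)"
    unfolding sieve_factor_def i_def[symmetric] using fin by (intro prod.mono_neutral_cong_left) auto
  ultimately show ?thesis
    unfolding sieve_factor_def[of _ "?H \<union> ?O"] i_def[symmetric]
    by (simp only: prod.distrib[symmetric])
       (intro prod.cong refl, auto simp: i_def sieve_weight_def prime_divisors_def odd_primes_le_def)
qed

text \<open>The constant 1/2 is the factor of the infinite product at \<open>n = 2\<close>, which is
  present because \<open>h\<close> is odd. At the other primes \<open>q\<close> outside
  \<open>h\<close>, \<open>1 - (1 / q) / (q - 1)\<close> is the factor of the product.\<close>

lemma sieve_mean_union:
  assumes h: "odd h" "h > 0"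
  shows "(if Q \<ge> 2 then 1 / 2 else 1) * sieve_mean (sieve_weight h) (prime_divisors h \<union> odd_primes_le Q)
    = sieve_mean (sieve_weight h) (prime_divisors h) *
      (\<Prod>n\<le>Q. if prime n \<and> \<not> n dvd h then 1 - 1 / (real n * (real n - 1)) else 1)"
proof -
  let ?H = "prime_divisors h" and ?O = "odd_primes_le Q"
  define f where "f n = 1 - 1 / (real n * (real n - 1))" for n
  note fin = finite_prime_divisors[OF h(2)] finite_odd_primes_le[of Q]
  have "sieve_mean (sieve_weight h) (?H \<union> ?O) = sieve_mean (sieve_weight h) (?H \<union> (?O - ?H))" by simp
  also have "\<dots> = sieve_mean (sieve_weight h) ?H * sieve_mean (sieve_weight h) (?O - ?H)"
    unfolding sieve_mean_def using fin by (intro prod.union_disjoint) auto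
  also have "sieve_mean (sieve_weight h) (?O - ?H) = (\<Prod>q\<in>?O - ?H. f q)"
    unfolding sieve_mean_def by (intro prod.cong) (auto simp: sieve_weight_def f_def prime_divisors_def odd_primes_le_def)
  finally have 1: "sieve_mean (sieve_weight h) (?H \<union> ?O) = sieve_mean (sieve_weight h) ?H * (\<Prod>q\<in>?O - ?H. f q)" .
  have "(\<Prod>n\<le>Q. if prime n \<and> \<not> n dvd h then f n else 1) = (\<Prod>n\<in>(if Q \<ge> 2 then {2} else {}) \<union> (?O - ?H). f n)"
  proof (rule prod.mono_neutral_cong_right)
    have "x = 2" if "prime x" "even x" for x :: nat using primes_dvd_imp_eq[of 2 x] that by auto
    then show "\<forall>n\<in>{..Q} - ((if Q \<ge> 2 then {2} else {}) \<union> (?O - ?H)). (if prime n \<and> \<not> n dvd h then f n else 1) = 1"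
      by (auto simp: prime_divisors_def odd_primes_le_def)
    show "(if prime n \<and> \<not> n dvd h then f n else 1) = f n" if "n \<in> (if Q \<ge> 2 then {2} else {}) \<union> (?O - ?H)" for n
      using that h(1) by (auto simp: prime_divisors_def odd_primes_le_def split: if_splits)
  qed (auto simp: odd_primes_le_def)
  also have "\<dots> = (if Q \<ge> 2 then f 2 else 1) * (\<Prod>q\<in>?O - ?H. f q)"
    using fin by (subst prod.union_disjoint) (auto simp: odd_primes_le_def)
  also have "f 2 = 1 / 2" by (simp add: f_def)
  finally show ?thesis unfolding 1 f_def by simp
qed

lemma A_tilde_h_LIMSEQ:
  "(\<lambda>Q. \<Prod>n\<le>Q. if prime n \<and> \<not> n dvd h then 1 - 1 / (real n * (real n - 1)) else 1) \<longlonglongrightarrow> A_tilde_h h"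
  unfolding A_tilde_h_def
proof (rule convergent_prod_LIMSEQ, rule abs_convergent_prod_imp_convergent_prod)
  let ?f = "\<lambda>n. if prime n \<and> \<not> n dvd h then 1 - 1 / (real n * (real n - 1)) else 1"
  have "summable (\<lambda>n. norm (?f n - 1))"
  proof (rule summable_comparison_test)
    show "summable (\<lambda>n. 2 * real n powr (-2))"
      by (intro summable_mult) (simp add: summable_real_powr_iff)
    show "\<exists>N. \<forall>n\<ge>N. norm (norm (?f n - 1)) \<le> 2 * real n powr (-2)"
    proof (intro exI[of _ 2] allI impI)
      fix n :: nat assume n: "n \<ge> 2"
      have "real n * real n / 2 \<le> real n * (real n - 1)" using n by (simp add: field_simps)
      then have "1 / (real n * (real n - 1)) \<le> 1 / (real n * real n / 2)"
        using n by (intro divide_left_mono) auto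
      also have "\<dots> = 2 * real n powr (-2)" using n by (simp add: powr_minus_divide power2_eq_square)
      finally have "1 / (real n * (real n - 1)) \<le> 2 * real n powr (-2)" .
      moreover have "0 \<le> 1 / (real n * (real n - 1))" using n by simp
      ultimately show "norm (norm (?f n - 1)) \<le> 2 * real n powr (-2)" by auto
    qed
  qed
  then show "abs_convergent_prod ?f" by (simp only: abs_convergent_prod_conv_summable)
qed

definition gcd_indicator :: "nat \<Rightarrow> nat \<Rightarrow> real" where
  "gcd_indicator h p = (if gcd (p - 1) h = 1 then 1 else 0)"

lemma has_prime_mean_denominator:
  assumes s: "squarefree s" and y: "y \<noteq> 0" and h: "odd h" "h > 0"
  shows "has_prime_mean k (\<lambda>p. of_real (nonresidue (s * y\<^sup>2) p * gcd_indicator h p))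
    (of_real (1 / 2 * sieve_mean (sieve_weight h) (prime_divisors h) *
      (1 - (if odd_prime_divisors s \<subseteq> prime_divisors h then disc_correction (sieve_weight h) s else 0))))"
proof (rule has_prime_mean_cong_large[where M = 0])
  show "has_prime_mean k (\<lambda>p. of_real (nonresidue (s * y\<^sup>2) p * sieve_factor (sieve_weight h) (prime_divisors h) p))
    (of_real (1 / 2 * sieve_mean (sieve_weight h) (prime_divisors h) *
      (1 - (if odd_prime_divisors s \<subseteq> prime_divisors h then disc_correction (sieve_weight h) s else 0))))"
    by (intro has_prime_mean_nonresidue_sieve s y finite_prime_divisors h(2) prime_divisors_odd[OF h(1)] conjI sieve_weight_bounds)
qed (simp add: sieve_factor_prime_divisors[OF h(2)] gcd_indicator_def)

lemma has_prime_mean_numerator: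
  assumes s: "squarefree s" and y: "y \<noteq> 0" and h: "odd h" "h > 0"
  shows "has_prime_mean k (\<lambda>p. of_real (nonresidue (s * y\<^sup>2) p * gcd_indicator h p) * of_real (real (totient (p - 1)) / real (p - 1)))
    (of_real (1 / 2 * sieve_mean (sieve_weight h) (prime_divisors h) * A_tilde_h h * (1 - disc_correction (sieve_weight h) s)))"
proof (rule has_prime_mean_totient)
  define U where "U Q = prime_divisors h \<union> odd_primes_le Q" for Q
  define a where "a Q = (if Q \<ge> 2 then 1 / 2 else 1) * (1 / 2 * sieve_mean (sieve_weight h) (U Q) *
      (1 - (if odd_prime_divisors s \<subseteq> U Q then disc_correction (sieve_weight h) s else 0)))" for Q :: nat
  show "norm (complex_of_real (nonresidue (s * y\<^sup>2) p * gcd_indicator h p)) \<le> 1" for p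
    by (simp add: nonresidue_def gcd_indicator_def)
  show "has_prime_mean k (\<lambda>p. of_real (nonresidue (s * y\<^sup>2) p * gcd_indicator h p) * of_real (totient_trunc Q (p - 1))) (of_real (a Q))" for Q
  proof -
    have U: "finite (U Q)" "\<And>q. q \<in> U Q \<Longrightarrow> prime q \<and> odd q"
      using finite_prime_divisors[OF h(2)] finite_odd_primes_le prime_divisors_odd[OF h(1)]
      by (auto simp: U_def odd_primes_le_def)
    have "has_prime_mean k (\<lambda>p. of_real (if Q \<ge> 2 then 1 / 2 else 1) * of_real (nonresidue (s * y\<^sup>2) p * sieve_factor (sieve_weight h) (U Q) p))
        (of_real (if Q \<ge> 2 then 1 / 2 else 1) * of_real (1 / 2 * sieve_mean (sieve_weight h) (U Q) *
      (1 - (if odd_prime_divisors s \<subseteq> U Q then disc_correction (sieve_weight h) s else 0))))"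
      by (intro has_prime_mean_cmult has_prime_mean_nonresidue_sieve s y U conjI sieve_weight_bounds)
    then have "has_prime_mean k (\<lambda>p. of_real (nonresidue (s * y\<^sup>2) p * gcd_indicator h p) * of_real (totient_trunc Q (p - 1)))
        (of_real (if Q \<ge> 2 then 1 / 2 else 1) * of_real (1 / 2 * sieve_mean (sieve_weight h) (U Q) *
      (1 - (if odd_prime_divisors s \<subseteq> U Q then disc_correction (sieve_weight h) s else 0))))"
    proof (rule has_prime_mean_cong_large)
      fix p :: nat assume p: "prime p" "p > 2"
      have "gcd_indicator h p * totient_trunc Q (p - 1) = (if Q \<ge> 2 then 1 / 2 else 1) * sieve_factor (sieve_weight h) (U Q) p"
        unfolding totient_trunc_eq_sieve[OF p] U_def sieve_factor_mult[OF h(2), symmetric]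
          sieve_factor_prime_divisors[OF h(2) p(1)] gcd_indicator_def by simp
      then have "nonresidue (s * y\<^sup>2) p * gcd_indicator h p * totient_trunc Q (p - 1) =
          (if Q \<ge> 2 then 1 / 2 else 1) * (nonresidue (s * y\<^sup>2) p * sieve_factor (sieve_weight h) (U Q) p)"
        by (simp only: mult.assoc mult.left_commute)
      then show "of_real (if Q \<ge> 2 then 1 / 2 else 1) * of_real (nonresidue (s * y\<^sup>2) p * sieve_factor (sieve_weight h) (U Q) p)
        = complex_of_real (nonresidue (s * y\<^sup>2) p * gcd_indicator h p) * of_real (totient_trunc Q (p - 1))"
        by (simp only: of_real_mult[symmetric])
    qed
    then show ?thesis unfolding a_def of_real_mult[of "if Q \<ge> 2 then 1 / 2 else 1"] .
  qed
  show "(\<lambda>Q. complex_of_real (a Q)) \<longlonglongrightarrow>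
     of_real (1 / 2 * sieve_mean (sieve_weight h) (prime_divisors h) * A_tilde_h h * (1 - disc_correction (sieve_weight h) s))"
  proof (rule tendsto_of_real, rule Lim_transform_eventually)
    let ?P = "\<lambda>Q. \<Prod>n\<le>Q. if prime n \<and> \<not> n dvd h then 1 - 1 / (real n * (real n - 1)) else 1"
    show "(\<lambda>Q. 1 / 2 * sieve_mean (sieve_weight h) (prime_divisors h) * ?P Q * (1 - disc_correction (sieve_weight h) s)) \<longlonglongrightarrow>
        1 / 2 * sieve_mean (sieve_weight h) (prime_divisors h) * A_tilde_h h * (1 - disc_correction (sieve_weight h) s)"
      by (intro tendsto_intros A_tilde_h_LIMSEQ)
    have s0: "s \<noteq> 0" using s by auto
    show "eventually (\<lambda>Q. 1 / 2 * sieve_mean (sieve_weight h) (prime_divisors h) * ?P Q * (1 - disc_correction (sieve_weight h) s) = a Q) sequentially"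
      \<comment> \<open>From this point on every odd prime divisor of \<open>s\<close> lies in
        \<open>U Q\<close>, so the correction is present in full.\<close>
      using eventually_ge_at_top[of "nat \<bar>s\<bar>"]
    proof eventually_elim
      case (elim Q)
      have "odd_prime_divisors s \<subseteq> U Q"
      proof
        fix q assume q: "q \<in> odd_prime_divisors s"
        then have "int q \<le> \<bar>s\<bar>" using dvd_imp_le_int[OF s0, of "int q"] by (simp add: odd_prime_divisors_def)
        then have "q \<le> Q" using elim by linarith
        then show "q \<in> U Q" using q by (simp add: U_def odd_primes_le_def odd_prime_divisors_def)
      qed
      then have "a Q = 1 / 2 * ((if Q \<ge> 2 then 1 / 2 else 1) * sieve_mean (sieve_weight h) (U Q)) * (1 - disc_correction (sieve_weight h) s)"
        by (simp add: a_def)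
      also have "(if Q \<ge> 2 then 1 / 2 else 1) * sieve_mean (sieve_weight h) (U Q) = sieve_mean (sieve_weight h) (prime_divisors h) * ?P Q"
        unfolding U_def by (rule sieve_mean_union[OF h])
      finally show ?case by (simp add: mult.assoc)
    qed
  qed
qed

section \<open>From sums over primes to sums over prime indices\<close>

lemma has_prime_mean_of_real_iff:
  "has_prime_mean k (\<lambda>p. of_real (f p)) (of_real a) \<longleftrightarrow>
     (\<lambda>N. (\<Sum>p | prime p \<and> p \<le> N. f p * prime_weight k p) / weight_total k N) \<longlonglongrightarrow> a"
proof -
  have "(\<lambda>N. (\<Sum>p | prime p \<and> p \<le> N. complex_of_real (f p) * of_real (prime_weight k p)) / of_real (weight_total k N))
      = (\<lambda>N. complex_of_real ((\<Sum>p | prime p \<and> p \<le> N. f p * prime_weight k p) / weight_total k N))"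
    by simp
  then show ?thesis unfolding has_prime_mean_def by (simp only: tendsto_of_real_iff)
qed

lemma prime_nth_prime: "prime (nth_prime i)"
  using enumerate_in_set[OF primes_infinite, of "i - 1"] by (simp add: nth_prime_def)

lemma bij_betw_nth_prime:
  assumes "N \<ge> 1"
  shows "bij_betw nth_prime {1..N} {p. prime p \<and> p \<le> nth_prime N}"
  unfolding bij_betw_def
proof
  show "inj_on nth_prime {1..N}"
  proof (rule inj_onI)
    fix i j assume "i \<in> {1..N}" "j \<in> {1..N}" "nth_prime i = nth_prime j"
    then show "i = j" using inj_enumerate[OF primes_infinite] by (auto simp: nth_prime_def dest!: injD)
  qed
  show "nth_prime ` {1..N} = {p. prime p \<and> p \<le> nth_prime N}"
  proof (intro Set.set_eqI iffI)
    fix p assume "p \<in> nth_prime ` {1..N}"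
    then obtain i where i: "i \<in> {1..N}" "p = nth_prime i" by auto
    then have "i - 1 \<le> N - 1" by (simp add: diff_le_mono)
    then have "nth_prime i \<le> nth_prime N"
      using enumerate_mono_le_iff[OF primes_infinite, of "i - 1" "N - 1"] by (simp add: nth_prime_def)
    then show "p \<in> {p. prime p \<and> p \<le> nth_prime N}" using i prime_nth_prime by simp
  next
    fix p assume p: "p \<in> {p. prime p \<and> p \<le> nth_prime N}"
    then obtain j where j: "enumerate {p. prime p} j = p" using p enumerate_Ex[OF primes_infinite] by blast
    have "j \<le> N - 1"
      using p enumerate_mono_le_iff[OF primes_infinite, of j "N - 1"] by (simp add: nth_prime_def j)
    then show "p \<in> nth_prime ` {1..N}"
      using j assms by (intro image_eqI[of _ _ "Suc j"]) (auto simp: nth_prime_def)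
  qed
qed

lemma nth_prime_at_top: "filterlim nth_prime at_top sequentially"
proof (rule filterlim_at_top_mono)
  show "filterlim (\<lambda>N::nat. N - 1) at_top sequentially"
    by (rule filterlim_minus_const_nat_at_top)
  show "eventually (\<lambda>N. N - 1 \<le> nth_prime N) sequentially"
    unfolding nth_prime_def by (intro always_eventually allI le_enumerate primes_infinite)
qed

lemma sum_restricted_indices:
  assumes N: "N \<ge> 1"
  shows "(\<Sum>i\<in>restricted_indices g h N. F (nth_prime i)) =
    (\<Sum>p | prime p \<and> p \<le> nth_prime N. nonresidue g p * gcd_indicator h p * F p)"
proof -
  define ok where "ok p \<longleftrightarrow> p \<noteq> 2 \<and> Legendre g (int p) = -1 \<and> gcd (p - 1) h = 1" for p
  have "(\<Sum>i\<in>restricted_indices g h N. F (nth_prime i)) = (\<Sum>i\<in>{i\<in>{1..N}. ok (nth_prime i)}. F (nth_prime i))"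
    by (simp add: restricted_indices_def ok_def)
  also have "\<dots> = (\<Sum>i\<in>{1..N}. if ok (nth_prime i) then F (nth_prime i) else 0)"
    by (rule sum.inter_filter) simp
  also have "\<dots> = (\<Sum>p | prime p \<and> p \<le> nth_prime N. if ok p then F p else 0)"
    by (rule sum.reindex_bij_betw[OF bij_betw_nth_prime[OF N]])
  also have "\<dots> = (\<Sum>p | prime p \<and> p \<le> nth_prime N. nonresidue g p * gcd_indicator h p * F p)"
    by (intro sum.cong) (auto simp: ok_def nonresidue_def gcd_indicator_def)
  finally show ?thesis .
qed

lemma sieve_mean_prime_divisors_pos:
  assumes h: "odd h" "h > 0"
  shows "sieve_mean (sieve_weight h) (prime_divisors h) > 0"
  unfolding sieve_mean_def
proof (rule prod_pos)
  fix q assume q: "q \<in> prime_divisors h"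
  then have "real q > 2" using prime_divisors_odd[OF h(1) q] odd_prime_gt_2[of q] by simp
  then show "1 - sieve_weight h q / (real q - 1) > 0" using sieve_weight_bounds[of h q] by (simp add: field_simps)
qed

lemma odd_prime_divisors_nonempty:
  assumes "squarefree s" "s mod 4 = 1" "s \<noteq> 1"
  shows "odd_prime_divisors s \<noteq> {}"
proof
  assume "odd_prime_divisors s = {}"
  moreover have "odd s" using assms(2) by presburger
  ultimately have "s = (if s < 0 then -1 else 1)" using squarefree_int_decompose[OF assms(1)] by simp
  then have "s = -1" using assms(3) by (metis (full_types))
  then show False using assms(2) by simp
qed

text \<open>Needed for a nonzero limit in the denominator. Here the correction is a nonempty product
  of \<open>- 1 / (q - 2)\<close> when \<open>s mod 4 = 1\<close>. A prime above 3 makes its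
  absolute value less than 1, and the prime 3 alone gives -1. For other \<open>s\<close> it is
  0.\<close>

lemma disc_correction_neq_1:
  assumes s: "squarefree s" "s \<noteq> 1" and sub: "odd_prime_divisors s \<subseteq> prime_divisors h"
  shows "disc_correction (sieve_weight h) s \<noteq> 1"
proof (cases "s mod 4 = 1")
  case True
  define S where "S = odd_prime_divisors s"
  have s0: "s \<noteq> 0" using s by auto
  have finS: "finite S" unfolding S_def by (rule finite_odd_prime_divisors[OF s0])
  have S0: "S \<noteq> {}" unfolding S_def by (rule odd_prime_divisors_nonempty[OF s(1) True s(2)])
  have S: "q > 2" if "q \<in> S" for q using that odd_prime_gt_2[of q] by (simp add: S_def odd_prime_divisors_def)
  have eq: "disc_correction (sieve_weight h) s = (\<Prod>q\<in>S. - 1 / (real q - 2))"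
    unfolding disc_correction_def if_P[OF True] S_def[symmetric]
    using sub by (intro prod.cong refl) (auto simp: S_def sieve_weight_def prime_divisors_def)
  show ?thesis
  proof (cases "S = {3}")
    case False
    then obtain r where r: "r \<in> S" "r \<noteq> 3" using S0 by blast
    then have r4: "r > 3" using S[OF r(1)] by simp
    have "\<bar>\<Prod>q\<in>S. - 1 / (real q - 2)\<bar> = \<bar>- 1 / (real r - 2)\<bar> * (\<Prod>q\<in>S - {r}. \<bar>- 1 / (real q - 2)\<bar>)"
      unfolding abs_prod using finS r(1) by (rule prod.remove)
    also have "\<dots> \<le> \<bar>- 1 / (real r - 2)\<bar> * 1"
    proof (intro mult_left_mono prod_le_1)
      fix q assume "q \<in> S - {r}"
      then have "real q \<ge> 3" using S[of q] by simp
      then show "0 \<le> \<bar>- 1 / (real q - 2)\<bar> \<and> \<bar>- 1 / (real q - 2)\<bar> \<le> 1" by (simp add: divide_simps)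
    qed simp
    also have "\<dots> < 1" using r4 by (simp add: divide_simps)
    finally show ?thesis unfolding eq by auto
  qed (simp add: eq)
qed (simp add: disc_correction_def)

text \<open>An odd \<open>h\<close> excludes the even discriminant \<open>4 * s\<close>; otherwise
  the discriminant is squarefree and odd, and divisibility is decided prime by prime.\<close>

lemma disc_dvd_iff:
  assumes s: "squarefree s" and h: "odd h" "h > 0"
  shows "(if s mod 4 = 1 then s else 4 * s) dvd int h \<longleftrightarrow> s mod 4 = 1 \<and> odd_prime_divisors s \<subseteq> prime_divisors h"
proof (cases "s mod 4 = 1")
  case False
  have "\<not> 4 * s dvd int h"
  proof
    assume "4 * s dvd int h"
    then have "2 * (2 * s) dvd int h" by simp
    then have "2 dvd int h" by (rule dvd_mult_left)
    then show False using h(1) by simp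
  qed
  then show ?thesis using False by simp
next
  case True
  have "odd s" using True by presburger
  have s0: "s \<noteq> 0" using s by auto
  have fin: "finite (odd_prime_divisors s)" by (rule finite_odd_prime_divisors[OF s0])
  have "s dvd int h \<longleftrightarrow> odd_prime_divisors s \<subseteq> prime_divisors h"
  proof
    assume d: "s dvd int h"
    show "odd_prime_divisors s \<subseteq> prime_divisors h"
    proof
      fix q assume "q \<in> odd_prime_divisors s"
      then have "prime q" and "int q dvd s" by (auto simp: odd_prime_divisors_def)
      moreover from this(2) d have "int q dvd int h" by (rule dvd_trans)
      ultimately show "q \<in> prime_divisors h" by (simp add: prime_divisors_def)
    qed
  next
    assume sub: "odd_prime_divisors s \<subseteq> prime_divisors h"
    have "(\<Prod>q\<in>A. q) dvd h" if "finite A" "A \<subseteq> prime_divisors h" for A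
      using that
    proof (induction A rule: finite_induct)
      case (insert q A)
      have q: "prime q" "q dvd h" using insert.prems by (auto simp: prime_divisors_def)
      have "coprime q (\<Prod>q\<in>A. q)"
        using insert.prems insert.hyps q
        by (intro prod_coprime_right) (auto simp: prime_divisors_def intro!: primes_coprime)
      then show ?case using insert q by (simp add: divides_mult)
    qed simp
    from this[OF fin sub] have "int (\<Prod>q\<in>odd_prime_divisors s. q) dvd int h"
      unfolding int_dvd_int_iff .
    moreover have "s = (if s < 0 then -1 else 1) * int (\<Prod>q\<in>odd_prime_divisors s. q)"
      using squarefree_int_decompose[OF s] \<open>odd s\<close> by simp
    ultimately show "s dvd int h" by (metis minus_dvd_iff mult_1 mult_minus1)
  qed
  then show ?thesis using True by simp
qed

text \<open>The limit is \<open>A_tilde_h\<close> times \<open>(1 - \<rho>) / (1 - \<rho>')\<close>.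
  Here \<open>\<rho>'\<close> agrees with \<open>\<rho>\<close> if \<open>d dvd h\<close>, so the
  quotient is 1; otherwise \<open>\<rho>' = 0\<close> and the quotient is \<open>1 - \<rho>\<close>,
  which is \<open>A_d\<close>. The common factor \<open>B / 2\<close> cancels.\<close>

lemma totient_ratio_tendsto:
  assumes s: "squarefree s" "s \<noteq> 1" and y: "y \<noteq> 0" and h: "odd h" "h > 0"
  shows "totient_ratio k (s * y\<^sup>2) h \<longlonglongrightarrow> A_tilde_const h (quadratic_disc (s * y\<^sup>2))"
proof -
  define g where "g = s * y\<^sup>2"
  define d where "d = (if s mod 4 = 1 then s else 4 * s)"
  have disc: "quadratic_disc g = d" unfolding g_def d_def by (rule quadratic_disc_squarefree[OF s y])
  define B where "B = sieve_mean (sieve_weight h) (prime_divisors h)"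
  define \<rho> where "\<rho> = disc_correction (sieve_weight h) s"
  define \<rho>' where "\<rho>' = (if odd_prime_divisors s \<subseteq> prime_divisors h then \<rho> else 0)"
  have B: "B > 0" unfolding B_def by (rule sieve_mean_prime_divisors_pos[OF h])
  have Ad: "A_d h d = 1 - \<rho>" unfolding d_def \<rho>_def by (rule A_d_eq[OF s(1)])
  have \<rho>1: "1 - \<rho>' \<noteq> 0" using disc_correction_neq_1[OF s, of h] by (auto simp: \<rho>'_def \<rho>_def)
  define Num where "Num N = (\<Sum>p | prime p \<and> p \<le> N. (nonresidue g p * gcd_indicator h p * (real (totient (p - 1)) / real (p - 1))) * prime_weight k p)" for N
  define Den where "Den N = (\<Sum>p | prime p \<and> p \<le> N. (nonresidue g p * gcd_indicator h p) * prime_weight k p)" for N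
  have num: "(\<lambda>N. Num N / weight_total k N) \<longlonglongrightarrow> 1 / 2 * B * A_tilde_h h * (1 - \<rho>)"
    using has_prime_mean_numerator[OF s(1) y h, of k]
    unfolding of_real_mult[symmetric, of "nonresidue (s * y\<^sup>2) _ * gcd_indicator h _"] has_prime_mean_of_real_iff
    by (simp only: Num_def g_def B_def \<rho>_def)
  have den: "(\<lambda>N. Den N / weight_total k N) \<longlonglongrightarrow> 1 / 2 * B * (1 - \<rho>')"
    using has_prime_mean_denominator[OF s(1) y h, of k]
    unfolding has_prime_mean_of_real_iff by (simp only: Den_def g_def B_def \<rho>_def \<rho>'_def)
  have "(\<lambda>N. (Num N / weight_total k N) / (Den N / weight_total k N)) \<longlonglongrightarrow>
      (1 / 2 * B * A_tilde_h h * (1 - \<rho>)) / (1 / 2 * B * (1 - \<rho>'))"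
    using B \<rho>1 by (intro tendsto_divide num den) simp
  moreover have "eventually (\<lambda>N. (Num N / weight_total k N) / (Den N / weight_total k N) = Num N / Den N) sequentially"
    using eventually_weight_total_pos[of k] by eventually_elim simp
  ultimately have "(\<lambda>N. Num N / Den N) \<longlonglongrightarrow> (1 / 2 * B * A_tilde_h h * (1 - \<rho>)) / (1 / 2 * B * (1 - \<rho>'))"
    by (rule Lim_transform_eventually)
  \<comment> \<open>The means run over primes up to a bound, the theorem over the first
    \<open>N\<close> primes; the bound is specialised to the \<open>N\<close>-th prime.\<close>
  then have "(\<lambda>N. Num (nth_prime N) / Den (nth_prime N)) \<longlonglongrightarrow> (1 / 2 * B * A_tilde_h h * (1 - \<rho>)) / (1 / 2 * B * (1 - \<rho>'))"
    by (rule filterlim_compose[OF _ nth_prime_at_top])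
  moreover have "(1 / 2 * B * A_tilde_h h * (1 - \<rho>)) / (1 / 2 * B * (1 - \<rho>')) = A_tilde_const h d"
  proof -
    have "(1 / 2 * B * A_tilde_h h * (1 - \<rho>)) / (1 / 2 * B * (1 - \<rho>')) = A_tilde_h h * ((1 - \<rho>) / (1 - \<rho>'))"
      using B \<rho>1 by simp
    also have "(1 - \<rho>) / (1 - \<rho>') = A_tilde_d h d"
    proof (cases "d dvd int h")
      case True
      then have "\<rho>' = \<rho>" using disc_dvd_iff[OF s(1) h] by (simp add: \<rho>'_def d_def)
      then show ?thesis using True \<rho>1 by (simp add: A_tilde_d_def)
    next
      case False
      then have "s mod 4 \<noteq> 1 \<or> \<not> odd_prime_divisors s \<subseteq> prime_divisors h"
        using disc_dvd_iff[OF s(1) h] unfolding d_def by blast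
      then have "\<rho>' = 0" by (auto simp: \<rho>'_def \<rho>_def disc_correction_def)
      then show ?thesis using False by (simp add: A_tilde_d_def Ad)
    qed
    finally show ?thesis by (simp add: A_tilde_const_def)
  qed
  moreover have "eventually (\<lambda>N. Num (nth_prime N) / Den (nth_prime N) = totient_ratio k g h N) sequentially"
    using eventually_ge_at_top[of 1]
  proof eventually_elim
    case (elim N)
    have pr: "real (p ^ k * (p - 1)) = prime_weight k p"
      "real (p ^ k * totient (p - 1)) = real (totient (p - 1)) / real (p - 1) * prime_weight k p" if "prime p" for p
    proof -
      have "p > 1" using that by (rule prime_gt_1_nat)
      then have "real (p - 1) = real p - 1" "real p - 1 \<noteq> 0" by (auto simp: of_nat_diff)
      then show "real (p ^ k * (p - 1)) = prime_weight k p"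
        "real (p ^ k * totient (p - 1)) = real (totient (p - 1)) / real (p - 1) * prime_weight k p"
        by (simp_all add: prime_weight_def)
    qed
    have "real (\<Sum>i\<in>restricted_indices g h N. nth_prime i ^ k * (nth_prime i - 1)) =
        (\<Sum>i\<in>restricted_indices g h N. prime_weight k (nth_prime i))"
      unfolding of_nat_sum by (intro sum.cong refl pr prime_nth_prime)
    also have "\<dots> = Den (nth_prime N)" unfolding Den_def by (rule sum_restricted_indices[OF elim])
    finally have 1: "real (\<Sum>i\<in>restricted_indices g h N. nth_prime i ^ k * (nth_prime i - 1)) = Den (nth_prime N)" .
    have "real (\<Sum>i\<in>restricted_indices g h N. nth_prime i ^ k * totient (nth_prime i - 1)) =
        (\<Sum>i\<in>restricted_indices g h N. real (totient (nth_prime i - 1)) / real (nth_prime i - 1) * prime_weight k (nth_prime i))"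
      unfolding of_nat_sum by (intro sum.cong refl pr prime_nth_prime)
    also have "\<dots> = Num (nth_prime N)"
      unfolding Num_def mult.assoc[of "nonresidue g _ * gcd_indicator h _"] by (rule sum_restricted_indices[OF elim])
    finally have 2: "real (\<Sum>i\<in>restricted_indices g h N. nth_prime i ^ k * totient (nth_prime i - 1)) = Num (nth_prime N)" .
    show ?case unfolding totient_ratio_def 1 2 ..
  qed
  ultimately show ?thesis unfolding g_def[symmetric] disc by (simp only: Lim_transform_eventually)
qed

theorem theorem1:
  fixes k h :: nat and g d :: int
  assumes "\<not> is_square g" and "g \<noteq> -1"
    and "h > 0" and "\<exists>g0 :: int. g = g0 ^ h"
    and "\<And>m. m > 0 \<Longrightarrow> \<exists>g0 :: int. g = g0 ^ m \<Longrightarrow> m \<le> h"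
    and "d = quadratic_disc g"
  shows "(h = 1 \<longrightarrow> totient_ratio k g h \<longlonglongrightarrow> A_const h d) \<and>
         (h > 1 \<longrightarrow> totient_ratio k g h \<longlonglongrightarrow> A_tilde_const h d)"
proof -
  define s where "s = squarefree_part g"
  define y where "y = square_part g"
  have gsy: "g = s * y\<^sup>2" unfolding s_def y_def by (rule squarefree_decompose)
  have s: "squarefree s" unfolding s_def by (rule squarefree_squarefree_part)
  have sq: "g \<noteq> x\<^sup>2" for x using assms(1) by (auto simp: is_nth_power_def)
  have s1: "s \<noteq> 1" using sq[of y] gsy by auto
  have y0: "y \<noteq> 0" using sq[of 0] gsy by auto
  \<comment> \<open>An even exponent would make \<open>g\<close> a perfect square.\<close>
  have "odd h"
  proof
    assume "even h"
    then obtain j where "h = j * 2" by (metis dvdE mult.commute)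
    then show False using assms(4) sq by (metis power_mult)
  qed
  then have lim: "totient_ratio k g h \<longlonglongrightarrow> A_tilde_const h d"
    unfolding assms(6) gsy using assms(3) by (intro totient_ratio_tendsto s s1 y0)
  \<comment> \<open>For \<open>h = 1\<close> the formula of the second case specialises to that of
    the first: the product over the primes of \<open>h\<close> is empty, and \<open>d dvd 1\<close>
    would leave \<open>s\<close> congruent to 1 modulo 4 without odd prime divisors, hence
    \<open>s = 1\<close>.\<close>
  moreover have "A_tilde_const h d = A_const h d" if h: "h = 1"
  proof -
    have "d = (if s mod 4 = 1 then s else 4 * s)"
      unfolding assms(6) gsy by (rule quadratic_disc_squarefree[OF s s1 y0])
    moreover have none: "{p. prime p \<and> p dvd (1::nat)} = {}" by auto
    then have "prime_divisors h = {}" unfolding prime_divisors_def h .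
    ultimately have "\<not> d dvd int h"
      using disc_dvd_iff[OF s \<open>odd h\<close> assms(3)] odd_prime_divisors_nonempty[OF s _ s1] by simp
    then show ?thesis
      using none unfolding A_tilde_const_def A_const_def A_tilde_d_def A_h_def A_tilde_h_def h by simp
  qed
  ultimately show ?thesis by auto
qed

end
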